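(* Let $\zeta$ be a primitive aperiodic substitution on $\mathcal A=\{1,\ldots,m\}$, with substitution matrix $\mathsf S$. Suppose that the characteristic polynomial of $\mathsf S$ is irreducible (over $\mathbb Q$), and that there are exactly $q$ eigenvalues of $\mathsf S$ of absolute value $\le1$, for some $0\le q<m-1$. Then for every $\eta>0$ there exist $\gamma=\gamma(\eta)>0$ and an exceptional set $\mathcal E_\eta\subset\Delta^{m-1}$ of Hausdorff dimension at most $q+\eta$ such that for every $\vec s\in\Delta^{m-1}\setminus\mathcal E_\eta$ and every $B>1$ there exist $r_0=r_0(\vec s,B)>0$ and $C=C(\vec s,B)>0$ for which the spectral measures $\sigma_a$ of the suspension flow $(\mathfrak X_\zeta^{\vec s},h_t)$ satisfy $$\sigma_a([\omega-r,\omega+r])\le C r^{\gamma}\quad\text{for all } |\omega|\in[B^{-1},B],\ 0<r\le r_0,\ a\in\mathcal A.$$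
   Context: Let $m\ge2$, $\mathcal A=\{1,\dots,m\}$, and let $\mathcal A^+$ be the set of nonempty finite words over $\mathcal A$. A substitution is a map $\zeta:\mathcal A\to\mathcal A^+$, extended to words and sequences by concatenation. The substitution matrix $\mathsf S$ is the $m\times m$ matrix with $\mathsf S(i,j)$ = number of symbols $i$ in $\zeta(j)$; $\zeta$ is primitive if some power $\mathsf S^n$ is entrywise strictly positive. $X_\zeta\subset\mathcal A^{\mathbb Z}$ is the set of bi-infinite sequences all of whose finite subwords occur as subwords of $\zeta^n(a)$ for some $a\in\mathcal A$, $n\in\mathbb N$; $T_\zeta$ is the left shift on $X_\zeta$. For primitive $\zeta$, aperiodic means $X_\zeta$ is infinite; $(X_\zeta,T_\zeta)$ is uniquely ergodic. For a strictly positive vector $\vec s=(s_1,\dots,s_m)$, the suspension flow $(\mathfrak X_\zeta^{\vec s},h_t)$ is the unit-speed vertical flow over $T_\zeta$ under the roof function equal to $s_j$ on $\{x\in X_\zeta:x_0=j\}$; thus $\mathfrak X_\zeta^{\vec s}=\{(x,t):x\in X_\zeta,\ 0\le t\le s_{x_0}\}$ with $(x,s_{x_0})$ identified with $(T_\zeta x,0)$. Let $\widetilde\mu$ be its unique invariant probability measure. For $a\in\mathcal A$ let $\mathfrak X_a=\{(x,t):x\in X_\zeta,\ x_0=a,\ 0\le t\le s_a\}$. For $f\in L^2(\mathfrak X_\zeta^{\vec s},\widetilde\mu)$ the spectral measure $\sigma_f$ is the finite positive Borel measure on $\mathbb R$ with $\int_{\mathbb R}e^{2\pi i\omega t}\,d\sigma_f(\omega)=\langle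 f\circ h_t,f\rangle$ for all $t\in\mathbb R$; $\sigma_a:=\sigma_f$ for $f=\mathbf 1_{\mathfrak X_a}$. $\Delta^{m-1}$ is the set of vectors in $\mathbb R^m$ with positive entries summing to $1$. The constant $\gamma(\eta)$ may depend on $\zeta$. *)

theory Defs
  imports
    "HOL-Probability.Probability"
    "HOL-Computational_Algebra.Computational_Algebra"
    "HOL-Library.Sublist"
begin

section \<open>Substitutions\<close>

text \<open>The alphabet is a finite type \<open>'a\<close>, so \<open>m\<close> is \<open>CARD('a)\<close> and the vectors and matrices
  indexed by the alphabet live in \<open>real ^ 'a\<close> and \<open>real ^ 'a ^ 'a\<close>.\<close>

definition substitution :: "('a \<Rightarrow> 'a list) \<Rightarrow> bool" where
  "substitution \<zeta> \<longleftrightarrow> (\<forall>a. \<zeta> a \<noteq> [])"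

definition subst_word :: "('a \<Rightarrow> 'a list) \<Rightarrow> 'a list \<Rightarrow> 'a list" where
  "subst_word \<zeta> w = concat (map \<zeta> w)"

text \<open>The entries are natural numbers, read in whichever semiring (naturals, rationals, complex
  numbers) the context calls for.\<close>

definition subst_matrix :: "('a::finite \<Rightarrow> 'a list) \<Rightarrow> 'b::semiring_1 ^ 'a ^ 'a" where
  "subst_matrix \<zeta> = (\<chi> i j. of_nat (count_list (\<zeta> j) i))"

text \<open>Matrix powers are iterated \<open>(**)\<close>, because \<open>(^)\<close> on vectors is componentwise.\<close>

definition primitive :: "('a::finite \<Rightarrow> 'a list) \<Rightarrow> bool" where
  "primitive \<zeta> \<longleftrightarrow>
     (\<exists>n\<ge>1. \<forall>i j. (((**) (subst_matrix \<zeta> :: nat ^ 'a ^ 'a)) ^^ n) (mat 1) $ i $ j > 0)"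

definition charpoly :: "'b::comm_ring_1 ^ 'a ^ 'a \<Rightarrow> 'b poly" where
  "charpoly A = det (mat [:0, 1:] - map_matrix (\<lambda>c. [:c:]) A)"

definition eigenvalues :: "'b::field ^ 'a ^ 'a \<Rightarrow> 'b set" where
  "eigenvalues A = {z. \<exists>v. v \<noteq> 0 \<and> A *v v = z *s v}"

text \<open>\<open>sublist\<close> is the relation of being a contiguous subword.\<close>

definition subst_space :: "('a \<Rightarrow> 'a list) \<Rightarrow> (int \<Rightarrow> 'a) set" where
  "subst_space \<zeta> = {x. \<forall>i j. \<exists>a n. sublist (map x [i..j]) ((subst_word \<zeta> ^^ n) [a])}"

definition aperiodic :: "('a \<Rightarrow> 'a list) \<Rightarrow> bool" where
  "aperiodic \<zeta> \<longleftrightarrow> infinite (subst_space \<zeta>)"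


section \<open>The suspension flow\<close>

text \<open>Birkhoff sum of the roof function: at least one of the two index sets is empty, and
  negative \<open>n\<close> contribute minus the sum over \<open>n \<le> k < 0\<close>.\<close>

definition roof_sum :: "real ^ 'a \<Rightarrow> (int \<Rightarrow> 'a) \<Rightarrow> int \<Rightarrow> real" where
  "roof_sum s x n = (\<Sum>k\<in>{0..<n}. s $ x k) - (\<Sum>k\<in>{n..<0}. s $ x k)"

text \<open>The identification \<open>(x, s\<^bsub>x 0\<^esub>) \<sim> (T x, 0)\<close> makes every pair \<open>(x, t)\<close>, \<open>t\<close> real, equivalent
  to exactly one pair \<open>(y, u)\<close> with \<open>0 \<le> u < s\<^bsub>y 0\<^esub>\<close> (for positive \<open>s\<close>). A point of the suspension
  is represented by this pair, which \<open>susp_repr\<close> computes.\<close>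

definition susp_repr :: "real ^ 'a \<Rightarrow> (int \<Rightarrow> 'a) \<times> real \<Rightarrow> (int \<Rightarrow> 'a) \<times> real" where
  "susp_repr s = (\<lambda>(x, t).
     let n = (THE n. roof_sum s x n \<le> t \<and> t < roof_sum s x (n + 1))
     in (\<lambda>k. x (k + n), t - roof_sum s x n))"

definition susp_space :: "('a \<Rightarrow> 'a list) \<Rightarrow> real ^ 'a \<Rightarrow> ((int \<Rightarrow> 'a) \<times> real) set" where
  "susp_space \<zeta> s = susp_repr s ` {(x, t). x \<in> subst_space \<zeta> \<and> 0 \<le> t \<and> t \<le> s $ x 0}"

definition susp_flow :: "real ^ 'a \<Rightarrow> real \<Rightarrow> (int \<Rightarrow> 'a) \<times> real \<Rightarrow> (int \<Rightarrow> 'a) \<times> real" where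
  "susp_flow s t = (\<lambda>(x, u). susp_repr s (x, u + t))"

definition susp_cylinder ::
  "('a \<Rightarrow> 'a list) \<Rightarrow> real ^ 'a \<Rightarrow> 'a \<Rightarrow> ((int \<Rightarrow> 'a) \<times> real) set" where
  "susp_cylinder \<zeta> s a =
     susp_repr s ` {(x, t). x \<in> subst_space \<zeta> \<and> x 0 = a \<and> 0 \<le> t \<and> t \<le> s $ a}"

text \<open>The Borel sets of the suspension: the trace of the product of the cylinder sigma-algebra on
  sequences with the Borel sets of the real line.\<close>

definition susp_borel :: "('a \<Rightarrow> 'a list) \<Rightarrow> real ^ 'a \<Rightarrow> ((int \<Rightarrow> 'a) \<times> real) measure" where
  "susp_borel \<zeta> s =
     restrict_space ((\<Pi>\<^sub>M k\<in>UNIV. count_space UNIV) \<Otimes>\<^sub>M borel) (susp_space \<zeta> s)"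

definition invariant_prob ::
  "('a \<Rightarrow> 'a list) \<Rightarrow> real ^ 'a \<Rightarrow> ((int \<Rightarrow> 'a) \<times> real) measure \<Rightarrow> bool" where
  "invariant_prob \<zeta> s M \<longleftrightarrow>
     prob_space M \<and> sets M = sets (susp_borel \<zeta> s) \<and>
     (\<forall>t. \<forall>A\<in>sets M. emeasure M (susp_flow s t -` A \<inter> space M) = emeasure M A)"

definition spectral_measure ::
  "'b measure \<Rightarrow> (real \<Rightarrow> 'b \<Rightarrow> 'b) \<Rightarrow> ('b \<Rightarrow> complex) \<Rightarrow> real measure \<Rightarrow> bool" where
  "spectral_measure M h f \<sigma> \<longleftrightarrow>
     finite_measure \<sigma> \<and> sets \<sigma> = sets borel \<and>
     (\<forall>t. (LINT \<omega>|\<sigma>. cis (2 * pi * \<omega> * t)) = (LINT p|M. f (h t p) * cnj (f p)))"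


section \<open>Hausdorff dimension\<close>

text \<open>Only bounded covering sets are admitted, since \<open>diameter\<close> is meaningless for unbounded ones.\<close>

definition hausdorff_content :: "real \<Rightarrow> real \<Rightarrow> 'b::metric_space set \<Rightarrow> ennreal" where
  "hausdorff_content d \<delta> E =
     (INF U\<in>{U :: nat \<Rightarrow> 'b set. E \<subseteq> (\<Union>i. U i) \<and> (\<forall>i. bounded (U i) \<and> diameter (U i) \<le> \<delta>)}.
        \<Sum>i. ennreal (diameter (U i) powr d))"

definition hausdorff_measure :: "real \<Rightarrow> 'b::metric_space set \<Rightarrow> ennreal" where
  "hausdorff_measure d E = (SUP \<delta>\<in>{0<..}. hausdorff_content d \<delta> E)"

text \<open>Restricting to \<open>d > 0\<close> does not change the infimum and avoids \<open>0 powr 0 = 0\<close>.\<close>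

definition hausdorff_dim :: "'b::metric_space set \<Rightarrow> ennreal" where
  "hausdorff_dim E = (INF d\<in>{d. 0 < d \<and> hausdorff_measure d E = 0}. ennreal d)"


definition open_simplex :: "(real ^ 'a) set" where
  "open_simplex = {s. (\<forall>a. 0 < s $ a) \<and> (\<Sum>a\<in>UNIV. s $ a) = 1}"

end

theory Submission
  imports Defs "HOL-Computational_Algebra.Field_as_Ring"
begin

text \<open>If \<open>\<sigma>\<^bsub>a\<^esub>\<close> put too much mass near \<open>\<omega>\<close>, then by a double-integral (Gram) identity some twisted orbit
  integral of length \<open>R \<sim> 1/r\<close> would be large, so it suffices to show that these are
  \<open>O(R powr (1 - \<gamma>))\<close>. Fix a word \<open>v\<close> starting with \<open>c\<close> such that \<open>v c\<close> occurs in
  \<open>\<zeta>\<^sup>L(b)\<close> for all \<open>b\<close>. At each level \<open>k\<close> for which \<open>\<omega>\<close> times the length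
  \<open>|\<zeta>\<^sup>k(v)|\<^bsub>s\<^esub>\<close> is far from the integers, two copies of the same sum partially cancel and a
  constant factor is gained; a positive proportion of such levels gives the power saving.

  The vectors \<open>s\<close> violating this are exceptional: the numbers
  \<open>t\<^sub>k = \<omega> |\<zeta>\<^sup>k(v)|\<^bsub>s\<^esub>\<close> satisfy the linear recurrence of the characteristic polynomial,
  and if \<open>t\<^sub>k\<close> is mostly close to an integer, the recurrence determines the nearest integers up to
  \<open>exp(\<epsilon> N)\<close> choices. These fix the coordinates of \<open>\<omega> s\<close> along the expanding directions up
  to an exponentially small error; the at most \<open>q\<close> remaining real coordinates give the bound
  \<open>q + \<eta>\<close> on the dimension. Irreducibility makes the eigenvalues simple and every nonzero
  rational vector cyclic.\<close>


section \<open>The characteristic polynomial\<close>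

text \<open>The order of the quantifiers shapes the proof: \<gamma> may depend on \<eta>, but not on
  s or B. The threshold \<rho> and the proportion \<delta> of good levels are therefore fixed first,
  from the recurrence and \<eta> alone; s and B enter only through the level from which the count
  holds and through bounds for s and 1 / \<omega>, hence through the radius and the factor in the
  conclusion.

  The sequence sees only the product w s of frequency and roof vector. So s is declared bad at a
  level as soon as some w in [1/K, K] is bad for it, which makes the estimate for good s uniform in
  the frequency. The free scalar w costs no dimension: s is a Lipschitz function of w s as long as w
  is bounded below.

  The orbit integrals are bounded at every point of the suspension, so the estimate applies to any
  invariant probability measure. Of the spectral measure only its defining identity is used: it says
  that the flow and the characters on the line have the same correlation kernel.\<close>

lemma poly_det:
  fixes A :: "'b::comm_ring_1 poly ^ 'n ^ 'n"
  shows "poly (det A) x = det (map_matrix (\<lambda>p. poly p x) A)"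
  by (simp add: det_def poly_sum poly_prod map_matrix_def)

lemma poly_charpoly: "poly (charpoly A) x = det (mat x - A)"
  unfolding charpoly_def poly_det
  by (rule arg_cong[where f = det]) (auto simp: vec_eq_iff map_matrix_def mat_def)

lemma coeff_prod_linear:
  assumes "finite I" "\<And>i. i \<in> I \<Longrightarrow> degree (f i) \<le> 1"
  shows "coeff (prod f I) (card I) = (\<Prod>i\<in>I. coeff (f i) 1)" "degree (prod f I) \<le> card I"
  using assms
proof (induction I rule: finite_induct)
  case (insert i I)
  { case 1
    have fi: "f i = [:coeff (f i) 0, coeff (f i) 1:]"
      using 1[of i] by (auto simp: poly_eq_iff coeff_pCons coeff_eq_0 split: nat.split)
    have "coeff (prod f I) (Suc (card I)) = 0"
      using 1 insert by (intro coeff_eq_0) (simp add: less_Suc_eq_le)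
    then have "coeff (f i * prod f I) (Suc (card I)) = coeff (f i) 1 * coeff (prod f I) (card I)"
      by (subst fi) simp
    then show ?case using insert 1 by simp
  next
    case 2
    have "degree (f i * prod f I) \<le> degree (f i) + degree (prod f I)" by (rule degree_mult_le)
    also have "\<dots> \<le> 1 + card I" using 2 insert by (intro add_mono) auto
    finally show ?case using insert by simp }
qed auto

text \<open>Each entry of the matrix in \<open>charpoly\<close> has degree at most one, and the
  degree-one coefficients form the identity matrix. The top coefficient of the determinant is
  therefore the determinant of the identity.\<close>

lemma charpoly_monic:
  fixes A :: "'b::comm_ring_1 ^ 'n ^ 'n"
  shows "degree (charpoly A) = CARD('n)" "coeff (charpoly A) CARD('n) = 1"
proof -
  let ?B = "mat [:0, 1:] - map_matrix (\<lambda>c. [:c:]) A"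
  have deg: "degree (?B $ i $ j) \<le> 1" for i j
    by (auto simp: mat_def map_matrix_def intro!: degree_diff_le)
  have c1: "coeff (?B $ i $ j) 1 = mat 1 $ i $ j" for i j
    by (auto simp: mat_def map_matrix_def)
  have s: "of_int k * p = smult (of_int k) p" for k and p :: "'b poly"
    by (metis of_int_poly mult_smult_left smult_1_left mult.left_neutral smult_one one_pCons)
  have "coeff (charpoly A) CARD('n) = det (mat 1 :: 'b ^ 'n ^ 'n)"
    unfolding charpoly_def det_def coeff_sum s coeff_smult
    by (subst coeff_prod_linear(1)[OF finite deg]) (simp only: c1)
  then show 1: "coeff (charpoly A) CARD('n) = 1" by simp
  have "degree (charpoly A) \<le> CARD('n)"
    unfolding charpoly_def det_def s
    by (intro degree_sum_le order.trans[OF degree_smult_le] coeff_prod_linear(2)[OF _ deg]) auto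
  moreover have "CARD('n) \<le> degree (charpoly A)" using 1 by (intro le_degree) auto
  ultimately show "degree (charpoly A) = CARD('n)" by simp
qed

section \<open>Polynomials acting through a matrix; the Cayley-Hamilton theorem\<close>

definition poly_act :: "'b::comm_ring_1 ^ 'n ^ 'n \<Rightarrow> 'b poly \<Rightarrow> 'b ^ 'n \<Rightarrow> 'b ^ 'n" where
  "poly_act A p v = (\<Sum>i\<le>degree p. coeff p i *s (((*v) A) ^^ i) v)"

lemma poly_act_altdef:
  assumes "degree p \<le> n"
  shows "poly_act A p v = (\<Sum>i\<le>n. coeff p i *s (((*v) A) ^^ i) v)"
  unfolding poly_act_def using assms
  by (intro sum.mono_neutral_left) (auto simp: coeff_eq_0)

lemma matrix_vector_mult_smult:
  fixes A :: "'b::comm_ring_1 ^ 'n ^ 'm"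
  shows "A *v (c *s v) = c *s (A *v v)"
  by (simp add: vec_eq_iff matrix_vector_mult_def sum_distrib_left mult_ac)

lemma matrix_vector_mult_sum: "A *v (\<Sum>i\<in>I. f i) = (\<Sum>i\<in>I. A *v f i)"
  by (induction I rule: infinite_finite_induct) (auto simp: matrix_vector_right_distrib)

lemma poly_act_pCons: "poly_act A (pCons a p) v = a *s v + A *v poly_act A p v"
proof -
  have "poly_act A (pCons a p) v = (\<Sum>i\<le>Suc (degree p). coeff (pCons a p) i *s (((*v) A) ^^ i) v)"
    by (rule poly_act_altdef) (rule degree_pCons_le)
  then show ?thesis
    by (simp add: sum.atMost_Suc_shift poly_act_def matrix_vector_mult_sum matrix_vector_mult_smult
        del: sum.atMost_Suc)
qed

lemma poly_act_0 [simp]: "poly_act A 0 v = 0" "poly_act A p 0 = 0"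
  by (simp add: poly_act_def) (induction p, simp add: poly_act_def, simp add: poly_act_pCons)

lemma poly_act_add: "poly_act A (p + q) v = poly_act A p v + poly_act A q v"
  by (induction p q rule: poly_induct2)
    (simp_all add: poly_act_pCons matrix_vector_right_distrib vector_sadd_rdistrib algebra_simps)

lemma poly_act_add_right: "poly_act A p (v + w) = poly_act A p v + poly_act A p w"
  by (induction p)
    (simp_all add: poly_act_pCons matrix_vector_right_distrib vector_add_ldistrib algebra_simps)

lemma poly_act_smult: "poly_act A (smult c p) v = c *s poly_act A p v"
  by (induction p)
    (simp_all add: poly_act_pCons matrix_vector_mult_smult vector_add_ldistrib)

lemma poly_act_scale: "poly_act A p (c *s v) = c *s poly_act A p v"
  by (induction p)
    (simp_all add: poly_act_pCons matrix_vector_mult_smult vector_add_ldistrib mult.commute)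

lemma poly_act_mult: "poly_act A (p * q) v = poly_act A p (poly_act A q v)"
  by (induction p) (simp_all add: poly_act_pCons poly_act_add poly_act_smult)

lemma poly_act_sum: "poly_act A (\<Sum>i\<in>I. f i) v = (\<Sum>i\<in>I. poly_act A (f i) v)"
  by (induction I rule: infinite_finite_induct) (simp_all add: poly_act_add)

lemma poly_act_sum_right: "poly_act A p (\<Sum>i\<in>I. f i) = (\<Sum>i\<in>I. poly_act A p (f i))"
  by (induction I rule: infinite_finite_induct) (simp_all add: poly_act_add_right)

text \<open>Cramer's rule by rows: the entry (i, k) of the witness is the determinant of
  \<open>B\<close> with row k replaced by the i-th unit vector. Summing against row j of
  \<open>B\<close> puts row j into place k, which gives \<open>det B\<close> for j = k and two equal
  rows otherwise.\<close>

lemma exists_right_adjugate: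
  fixes B :: "'b::comm_ring_1 ^ 'n ^ 'n"
  obtains C where "B ** C = mat (det B)"
proof
  define C where "C = (\<chi> i k. det (\<chi> r. if r = k then axis i 1 else B $ r))"
  have "(\<Sum>i\<in>UNIV. B $ j $ i * C $ i $ k) = (if j = k then det B else 0)" for j k
  proof -
    have B: "B $ j = (\<Sum>i\<in>UNIV. B $ j $ i *s axis i 1)"
      by (simp add: vec_eq_iff axis_def if_distrib cong: if_cong)
    have "(\<Sum>i\<in>UNIV. B $ j $ i * C $ i $ k)
        = (\<Sum>i\<in>UNIV. det (\<chi> r. if r = k then B $ j $ i *s axis i 1 else B $ r))"
      unfolding C_def by (simp add: det_row_mul)
    also have "\<dots> = det (\<chi> r. if r = k then B $ j else B $ r)"
      by (subst det_linear_row_sum[symmetric]) (simp, subst B[symmetric], rule refl)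
    also have "\<dots> = (if j = k then det B else 0)"
    proof (cases "j = k")
      case True
      then show ?thesis by (auto intro!: arg_cong[where f = det] simp: vec_eq_iff)
    next
      case False
      then show ?thesis
        by (auto intro!: det_identical_rows[of j k] simp: vec_eq_iff row_def)
    qed
    finally show ?thesis .
  qed
  then show "B ** C = mat (det B)"
    by (simp add: vec_eq_iff matrix_matrix_mult_def mat_def)
qed

text \<open>The module argument, with the variable acting as \<open>A\<close>. Each column of
  \<open>?B\<close> is a relation between the unit vectors (\<open>rel\<close>); combining these
  relations with the entries of the adjugate leaves \<open>charpoly A\<close> acting on a single
  unit vector.\<close>

theorem Cayley_Hamilton:
  fixes A :: "'b::comm_ring_1 ^ 'n ^ 'n"
  shows "poly_act A (charpoly A) v = 0"
proof -
  let ?B = "mat [:0, 1:] - map_matrix (\<lambda>c. [:c:]) A"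
  obtain C where "?B ** C = mat (det ?B)" by (rule exists_right_adjugate)
  then have "(?B ** C) $ i $ k = mat (charpoly A) $ i $ k" for i k
    by (simp only: charpoly_def)
  then have C: "(\<Sum>j\<in>UNIV. ?B $ i $ j * C $ j $ k) = (if i = k then charpoly A else 0)" for i k
    by (simp only: matrix_matrix_mult_def mat_def vec_lambda_beta)
  have rel: "(\<Sum>i\<in>UNIV. poly_act A (?B $ i $ j) (axis i 1)) = 0" for j
  proof -
    have "(\<Sum>i\<in>UNIV. poly_act A (?B $ i $ j) (axis i 1)) =
       (\<Sum>i\<in>UNIV. (if i = j then A *v axis i 1 else 0) - A $ i $ j *s axis i 1)"
      by (intro sum.cong) (auto simp: mat_def map_matrix_def poly_act_pCons vec_eq_iff)
    also have "\<dots> = A *v axis j 1 - (\<Sum>i\<in>UNIV. A $ i $ j *s axis i 1)"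
      by (simp add: sum_subtractf)
    also have "\<dots> = 0"
      by (simp add: vec_eq_iff matrix_vector_mult_def axis_def if_distrib cong: if_cong)
    finally show ?thesis .
  qed
  have ax: "poly_act A (charpoly A) (axis k 1) = 0" for k
  proof -
    have "(\<Sum>j\<in>UNIV. poly_act A (C $ j $ k) (\<Sum>i\<in>UNIV. poly_act A (?B $ i $ j) (axis i 1))) = 0"
      by (simp only: rel poly_act_0 sum.neutral_const)
    also have "(\<Sum>j\<in>UNIV. poly_act A (C $ j $ k) (\<Sum>i\<in>UNIV. poly_act A (?B $ i $ j) (axis i 1))) =
      (\<Sum>i\<in>UNIV. \<Sum>j\<in>UNIV. poly_act A (?B $ i $ j * C $ j $ k) (axis i 1))"
      by (subst sum.swap) (simp only: poly_act_sum_right poly_act_mult mult.commute)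
    also have "\<dots> = (\<Sum>i\<in>UNIV. poly_act A (\<Sum>j\<in>UNIV. ?B $ i $ j * C $ j $ k) (axis i 1))"
      by (simp only: poly_act_sum)
    finally have "(\<Sum>i\<in>UNIV. poly_act A (\<Sum>j\<in>UNIV. ?B $ i $ j * C $ j $ k) (axis i 1)) = 0"
      by simp
    then show ?thesis
      by (simp only: C if_distrib[of "\<lambda>p. poly_act A p _"] poly_act_0 sum.delta' sum.delta finite UNIV_I if_True)
  qed
  have "v = (\<Sum>k\<in>UNIV. v $ k *s axis k 1)"
    by (simp add: vec_eq_iff axis_def if_distrib cong: if_cong)
  then have "poly_act A (charpoly A) v = (\<Sum>k\<in>UNIV. v $ k *s poly_act A (charpoly A) (axis k 1))"
    by (metis (no_types, lifting) poly_act_sum_right poly_act_scale sum.cong)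
  then show ?thesis by (simp add: ax)
qed

section \<open>Eigenvalues, rational coefficients and cyclic vectors\<close>

lemma eigenvalues_charpoly:
  fixes A :: "'b::field ^ 'n ^ 'n"
  shows "eigenvalues A = {z. poly (charpoly A) z = 0}"
proof -
  have "A *v v = z *s v \<longleftrightarrow> (mat z - A) *v v = 0" for v z
    by (auto simp: vec_eq_iff matrix_vector_mult_def mat_def left_diff_distrib sum_subtractf
        if_distrib[of "\<lambda>x. x * _"] cong: if_cong)
  moreover have "(\<exists>v. v \<noteq> 0 \<and> (mat z - A) *v v = 0) \<longleftrightarrow> det (mat z - A) = 0" for z
    using matrix_left_invertible_ker[where A = "mat z - A"] invertible_left_inverse[of "mat z - A"]
      invertible_det_nz[of "mat z - A"] by blast
  ultimately show ?thesis by (simp add: eigenvalues_def poly_charpoly)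
qed

lemma det_of_rat:
  fixes A :: "rat ^ 'n ^ 'n"
  shows "det (map_matrix of_rat A :: 'b::field_char_0 ^ 'n ^ 'n) = of_rat (det A)"
  by (simp add: det_def of_rat_sum of_rat_mult of_rat_prod)

lemma map_poly_of_rat_hom:
  fixes p q :: "rat poly"
  shows "map_poly (of_rat :: rat \<Rightarrow> 'b::field_char_0) (p + q) = map_poly of_rat p + map_poly of_rat q"
    and "map_poly (of_rat :: rat \<Rightarrow> 'b::field_char_0) (p * q) = map_poly of_rat p * map_poly of_rat q"
    and "pderiv (map_poly (of_rat :: rat \<Rightarrow> 'b::field_char_0) p) = map_poly of_rat (pderiv p)"
  by (simp_all add: poly_eq_iff coeff_map_poly coeff_mult coeff_pderiv of_rat_add of_rat_mult of_rat_sum)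

lemma poly_map_poly_of_rat:
  "poly (map_poly of_rat p) (of_rat x :: 'b::field_char_0) = of_rat (poly p x)"
  by (induction p) (simp_all add: map_poly_pCons of_rat_add of_rat_mult)

text \<open>Compared through values: the two polynomials agree at every rational point, an infinite
  set. This needs \<open>of_rat\<close> to commute only with determinants of scalar
  matrices.\<close>

lemma charpoly_of_rat:
  fixes A :: "rat ^ 'n ^ 'n"
  shows "charpoly (map_matrix of_rat A :: 'b::field_char_0 ^ 'n ^ 'n) = map_poly of_rat (charpoly A)"
    (is "?p = ?q")
proof (rule ccontr)
  assume "?p \<noteq> ?q"
  then have "finite {x. poly (?p - ?q) x = 0}" by (intro poly_roots_finite) simp
  moreover have "range of_rat \<subseteq> {x. poly (?p - ?q) x = 0}"
  proof safe
    fix x :: rat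
    have "map_matrix of_rat (mat x - A) = mat (of_rat x) - (map_matrix of_rat A :: 'b ^ 'n ^ 'n)"
      by (auto simp: vec_eq_iff mat_def of_rat_diff)
    then show "poly (?p - ?q) (of_rat x) = 0"
      by (simp add: poly_map_poly_of_rat poly_charpoly flip: det_of_rat)
  qed
  ultimately have "finite (range (of_rat :: rat \<Rightarrow> 'b))" by (rule finite_subset[rotated])
  then show False by (simp add: finite_image_iff inj_on_def infinite_UNIV_char_0)
qed

text \<open>An irreducible rational polynomial is coprime to its nonzero derivative, and the Bezout
  identity survives the passage to the complex numbers, so no complex root is multiple.\<close>

lemma irreducible_complex_roots:
  fixes p :: "rat poly"
  assumes "irreducible p"
  shows "card {z :: complex. poly (map_poly of_rat p) z = 0} = degree p"
proof -
  let ?h = "map_poly of_rat :: rat poly \<Rightarrow> complex poly"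
  have deg: "degree p \<noteq> 0"
    using assms by (metis irreducible_def is_unit_iff_degree)
  then have "pderiv p \<noteq> 0" by (simp add: pderiv_eq_0_iff)
  moreover have "degree (pderiv p) < degree p" using deg by (simp add: degree_pderiv)
  ultimately have "\<not> p dvd pderiv p" by (auto dest: dvd_imp_degree_le)
  then have "coprime p (pderiv p)"
    using assms by (simp add: irreducible_imp_prime_elem prime_elem_imp_coprime)
  then obtain a b where ab: "a * p + b * pderiv p = 1"
    using bezout_coefficients_fst_snd[of p "pderiv p"] by (metis coprime_iff_gcd_eq_1)
  have "?h a * ?h p + ?h b * pderiv (?h p) = 1"
    using arg_cong[OF ab, of ?h] by (simp add: map_poly_of_rat_hom map_poly_1)
  then have "\<not> (poly (?h p) z = 0 \<and> poly (pderiv (?h p)) z = 0)" for z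
    by (metis add.right_neutral mult_zero_right poly_1 poly_add poly_mult zero_neq_one)
  then have "rsquarefree (?h p)" by (simp add: rsquarefree_roots)
  then have "smult (lead_coeff (?h p)) (\<Prod>z | poly (?h p) z = 0. [:- z, 1:]) = ?h p"
    by (rule complex_poly_decompose_rsquarefree)
  moreover have "degree (\<Prod>z | poly (?h p) z = 0. [:- z, 1:]) = card {z. poly (?h p) z = 0}"
    by (simp add: degree_prod_eq_sum_degree)
  moreover have "degree (?h p) = degree p" "lead_coeff (?h p) \<noteq> 0"
    using deg by (auto simp: degree_map_poly coeff_map_poly)
  ultimately show ?thesis by (metis degree_smult_eq)
qed

text \<open>A nonzero \<open>r\<close> of smaller degree is coprime to the irreducible
  \<open>charpoly A\<close>. The Bezout combination acts as the identity, yet both of its terms kill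
  v.\<close>

lemma poly_act_eq_0_imp:
  fixes A :: "'b::field_gcd ^ 'n ^ 'n"
  assumes "irreducible (charpoly A)" "v \<noteq> 0" "poly_act A r v = 0" "degree r < CARD('n)"
  shows "r = 0"
proof (rule ccontr)
  assume "r \<noteq> 0"
  then have "\<not> charpoly A dvd r" using assms(4) by (auto dest: dvd_imp_degree_le simp: charpoly_monic)
  then have "coprime (charpoly A) r"
    using assms(1) by (simp add: irreducible_imp_prime_elem prime_elem_imp_coprime)
  then obtain a b where ab: "a * charpoly A + b * r = 1"
    using bezout_coefficients_fst_snd[of "charpoly A" r] by (metis coprime_iff_gcd_eq_1)
  have "v = poly_act A (a * charpoly A + b * r) v" unfolding ab by (simp add: poly_act_def)
  also have "\<dots> = 0" by (simp add: poly_act_add poly_act_mult Cayley_Hamilton assms(3))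
  finally show False using assms(2) by simp
qed

lemma cyclic_vector_spans:
  fixes A :: "'b::field_gcd ^ 'n ^ 'n"
  assumes "irreducible (charpoly A)" "v \<noteq> 0"
  obtains b where "w = (\<Sum>i<CARD('n). b i *s (((*v) A) ^^ i) v)"
proof -
  let ?f = "\<lambda>i. (((*v) A) ^^ i) v" and ?I = "{..<CARD('n)}"
  have m: "x \<le> CARD('n) - Suc 0 \<Longrightarrow> x < CARD('n)" for x
    using zero_less_card_finite[where 'a = 'n] by linarith
  have indep: "u i = 0" if "(\<Sum>i\<in>?I. u i *s ?f i) = 0" "i \<in> ?I" for u i
  proof -
    define r where "r = (\<Sum>i\<in>?I. monom (u i) i)"
    have c: "coeff r j = (if j \<in> ?I then u j else 0)" for j
      unfolding r_def coeff_sum by (simp add: sum.delta')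
    have d: "degree r \<le> CARD('n) - 1" by (rule degree_le) (auto simp: c)
    have "poly_act A r v = (\<Sum>i\<le>CARD('n) - 1. coeff r i *s ?f i)"
      by (rule poly_act_altdef) (rule d)
    also have "\<dots> = (\<Sum>i\<in>?I. u i *s ?f i)"
      using m by (intro sum.cong) (auto simp: c)
    finally have "r = 0" using that(1) d m by (intro poly_act_eq_0_imp[OF assms]) auto
    then show ?thesis using c[of i] that(2) by simp
  qed
  \<comment> \<open>\<open>vec.independent\<close> speaks of a set, not of a family, so repeated
    iterates are excluded first; a repetition would be a relation with coefficients 1 and
    -1.\<close>
  have inj: "inj_on ?f ?I"
  proof (rule inj_onI, rule ccontr)
    fix i j assume ij: "i \<in> ?I" "j \<in> ?I" "?f i = ?f j" "i \<noteq> j"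
    let ?u = "\<lambda>k. (if k = i then 1 else 0) - (if k = j then 1 else 0) :: 'b"
    have "(\<Sum>k\<in>?I. ?u k *s ?f k) = 0"
      using ij by (simp add: vector_sub_rdistrib sum_subtractf if_distrib[of "\<lambda>x. x *s _"] cong: if_cong)
    from indep[OF this ij(1)] ij(4) show False by simp
  qed
  have "vec.independent (?f ` ?I)"
  proof (rule vec.independent_if_scalars_zero)
    fix u x assume "(\<Sum>x\<in>?f ` ?I. u x *s x) = 0" and x: "x \<in> ?f ` ?I"
    then have 0: "(\<Sum>i\<in>?I. u (?f i) *s ?f i) = 0" by (simp add: sum.reindex[OF inj])
    show "u x = 0" using indep[OF 0] x by auto
  qed simp
  moreover have "card (?f ` ?I) = vec.dim (UNIV :: ('b ^ 'n) set)"
    by (simp only: card_image[OF inj] card_lessThan vec_dim_card)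
  ultimately have "UNIV \<subseteq> vec.span (?f ` ?I)"
    by (intro vec.card_ge_dim_independent) auto
  then have "w \<in> vec.span (?f ` ?I)" by blast
  moreover have "finite (?f ` ?I)" by simp
  ultimately obtain u where "w = (\<Sum>x\<in>?f ` ?I. u x *s x)"
    using vec.span_finite[of "?f ` ?I"] by blast
  then show thesis by (intro that[of "\<lambda>i. u (?f i)"]) (simp add: sum.reindex[OF inj])
qed

section \<open>Linear recurrences\<close>

definition lin_rec :: "real poly \<Rightarrow> (nat \<Rightarrow> real) \<Rightarrow> bool" where
  "lin_rec p t \<longleftrightarrow> (\<forall>k. (\<Sum>i\<le>degree p. coeff p i * t (k + i)) = 0)"

definition cpoly :: "real poly \<Rightarrow> complex poly" where
  "cpoly p = map_poly of_real p"

definition char_roots :: "real poly \<Rightarrow> complex set" where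
  "char_roots p = {z. poly (cpoly p) z = 0}"

text \<open>The linear functional on polynomials that sends the i-th power of the variable to
  \<open>t i\<close>. Multiplication by the variable becomes the shift of \<open>t\<close>, and the
  characteristic polynomial pairs to zero with every solution.\<close>

definition seq_pair :: "complex poly \<Rightarrow> (nat \<Rightarrow> real) \<Rightarrow> complex" where
  "seq_pair r t = (\<Sum>i\<le>degree r. coeff r i * of_real (t i))"

text \<open>For a root z, the quotient Q of the polynomial p by x - z satisfies x Q = z Q + p, and p
  pairs to zero with solutions. So pairing with Q is an eigenfunctional of the shift with eigenvalue
  z. When the roots are simple it is, up to a nonzero factor, the coefficient of z^k in the
  solution.\<close>

definition root_coord :: "real poly \<Rightarrow> complex \<Rightarrow> (nat \<Rightarrow> real) \<Rightarrow> complex" where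
  "root_coord p z t = seq_pair (synthetic_div (cpoly p) z) t"

text \<open>The coordinates of a real sequence at \<open>z\<close> and \<open>cnj z\<close> are conjugate, so a
  conjugation-invariant set of \<open>q\<close> roots carries exactly \<open>q\<close> real parameters.\<close>

definition real_coord :: "real poly \<Rightarrow> complex \<Rightarrow> (nat \<Rightarrow> real) \<Rightarrow> real" where
  "real_coord p z t = (if Im z \<ge> 0 then Re (root_coord p z t) else Im (root_coord p z t))"

lemma lin_rec_shift: "lin_rec p t \<Longrightarrow> lin_rec p (\<lambda>k. t (n + k))"
  by (simp add: lin_rec_def flip: add.assoc)

lemma lin_rec_diff: "lin_rec p t \<Longrightarrow> lin_rec p t' \<Longrightarrow> lin_rec p (\<lambda>k. t k - t' k)"
  by (simp add: lin_rec_def right_diff_distrib sum_subtractf)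

lemma degree_cpoly [simp]: "degree (cpoly p) = degree p"
  by (simp add: cpoly_def degree_map_poly)

lemma coeff_cpoly [simp]: "coeff (cpoly p) i = of_real (coeff p i)"
  by (simp add: cpoly_def coeff_map_poly)

lemma seq_pair_altdef:
  assumes "degree r \<le> n"
  shows "seq_pair r t = (\<Sum>i\<le>n. coeff r i * of_real (t i))"
  unfolding seq_pair_def using assms
  by (intro sum.mono_neutral_left) (auto simp: coeff_eq_0)

lemma seq_pair_pCons: "seq_pair (pCons a r) t = a * of_real (t 0) + seq_pair r (\<lambda>k. t (Suc k))"
proof -
  have "seq_pair (pCons a r) t = (\<Sum>i\<le>Suc (degree r). coeff (pCons a r) i * of_real (t i))"
    by (rule seq_pair_altdef) (rule degree_pCons_le)
  then show ?thesis by (simp add: sum.atMost_Suc_shift seq_pair_def del: sum.atMost_Suc)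
qed

lemma seq_pair_0 [simp]: "seq_pair 0 t = 0"
  by (simp add: seq_pair_def)

lemma seq_pair_add: "seq_pair (r + s) t = seq_pair r t + seq_pair s t"
  by (induction r s arbitrary: t rule: poly_induct2) (simp_all add: seq_pair_pCons algebra_simps)

lemma seq_pair_smult: "seq_pair (smult c r) t = c * seq_pair r t"
  by (induction r arbitrary: t) (simp_all add: seq_pair_pCons algebra_simps)

lemma seq_pair_sum: "seq_pair (\<Sum>i\<in>I. f i) t = (\<Sum>i\<in>I. seq_pair (f i) t)"
  by (induction I rule: infinite_finite_induct) (simp_all add: seq_pair_add)

lemma seq_pair_diff_right: "seq_pair r (\<lambda>k. t k - t' k) = seq_pair r t - seq_pair r t'"
  by (simp add: seq_pair_def right_diff_distrib sum_subtractf)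

lemma real_coord_diff: "real_coord p z (\<lambda>k. t k - t' k) = real_coord p z t - real_coord p z t'"
  by (simp add: real_coord_def root_coord_def seq_pair_diff_right)

lemma cpoly_root_factor:
  assumes "z \<in> char_roots p"
  shows "cpoly p = [:- z, 1:] * synthetic_div (cpoly p) z"
  using synthetic_div_correct'[of z "cpoly p"] assms by (simp add: char_roots_def)

lemma root_coord_shift:
  assumes "lin_rec p t" "z \<in> char_roots p"
  shows "root_coord p z (\<lambda>k. t (n + k)) = z ^ n * root_coord p z t"
  using assms(1)
proof (induction n arbitrary: t)
  case (Suc n)
  let ?Q = "synthetic_div (cpoly p) z"
  have "(\<Sum>i\<le>degree p. coeff p i * t (0 + i)) = 0"
    using Suc.prems unfolding lin_rec_def by blast
  then have "complex_of_real (\<Sum>i\<le>degree p. coeff p i * t i) = 0" by simp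
  then have "seq_pair (cpoly p) t = 0"
    by (simp add: seq_pair_def)
  also have "cpoly p = pCons 0 ?Q + smult (- z) ?Q"
    by (subst cpoly_root_factor[OF assms(2)]) simp
  finally have *: "root_coord p z (\<lambda>k. t (Suc k)) = z * root_coord p z t"
    by (simp only: seq_pair_add seq_pair_smult seq_pair_pCons root_coord_def) simp
  have "root_coord p z (\<lambda>k. t (Suc (n + k))) = z ^ n * root_coord p z (\<lambda>k. t (Suc k))"
    using Suc.IH[of "\<lambda>k. t (Suc k)"] lin_rec_shift[OF Suc.prems, of 1] by simp
  then show ?case by (simp add: *)
qed simp

text \<open>Conjugating the factorisation of the real polynomial leaves the product unchanged;
  cancelling the factor x - \<open>cnj z\<close> identifies the quotient at \<open>cnj z\<close>
  with the conjugate of the quotient at z.\<close>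

lemma root_coord_cnj:
  assumes "z \<in> char_roots p"
  shows "cnj z \<in> char_roots p" "root_coord p (cnj z) t = cnj (root_coord p z t)"
proof -
  let ?Q = "synthetic_div (cpoly p) z"
  have hom: "map_poly cnj (a * b) = map_poly cnj a * map_poly cnj b" for a b
    by (simp add: poly_eq_iff coeff_map_poly coeff_mult)
  have "map_poly cnj (cpoly p) = cpoly p"
    by (simp add: poly_eq_iff coeff_map_poly)
  then have eq: "cpoly p = [:- cnj z, 1:] * map_poly cnj ?Q"
    using arg_cong[OF cpoly_root_factor[OF assms], of "map_poly cnj"]
    by (simp only: hom map_poly_pCons complex_cnj_zero map_poly_0 complex_cnj_one complex_cnj_minus)
  have "poly ([:- cnj z, 1:] * map_poly cnj ?Q) (cnj z) = 0" by (simp only: poly_mult) simp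
  then have "poly (cpoly p) (cnj z) = 0" by (simp only: eq[symmetric])
  then show 1: "cnj z \<in> char_roots p" by (simp add: char_roots_def)
  have "[:- cnj z, 1:] * map_poly cnj ?Q = [:- cnj z, 1:] * synthetic_div (cpoly p) (cnj z)"
    using eq cpoly_root_factor[OF 1] by simp
  then have "synthetic_div (cpoly p) (cnj z) = map_poly cnj ?Q"
    by (subst (asm) mult_left_cancel) auto
  then show "root_coord p (cnj z) t = cnj (root_coord p z t)"
    by (simp add: root_coord_def seq_pair_def coeff_map_poly degree_map_poly)
qed

text \<open>In a nonreal pair z, \<open>cnj z\<close>, one member carries the real part and the
  other, up to sign, the imaginary part of the same number. At a real root the coordinate is its own
  conjugate.\<close>

lemma norm_root_coord_le:
  assumes "z \<in> char_roots p"
  shows "norm (root_coord p z t) \<le> \<bar>real_coord p z t\<bar> + \<bar>real_coord p (cnj z) t\<bar>"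
proof (cases "Im z = 0")
  case True
  then have "cnj z = z" by (simp add: complex_eq_iff)
  then have "root_coord p z t = cnj (root_coord p z t)"
    using root_coord_cnj(2)[OF assms, of t] by simp
  then have "Im (root_coord p z t) = 0" by (simp add: complex_eq_iff)
  then show ?thesis using True by (simp add: real_coord_def cmod_def)
next
  case False
  have "norm (root_coord p z t) \<le> \<bar>Re (root_coord p z t)\<bar> + \<bar>Im (root_coord p z t)\<bar>"
    by (rule cmod_le)
  then show ?thesis using False by (auto simp: real_coord_def root_coord_cnj[OF assms])
qed

lemma poly_eq_0_if_many_roots:
  fixes r :: "'b::field poly"
  assumes "degree r < card S" "finite S" "\<And>z. z \<in> S \<Longrightarrow> poly r z = 0"
  shows "r = 0"
proof (rule ccontr)
  assume "r \<noteq> 0"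
  then have "card S \<le> card {z. poly r z = 0}"
    using assms by (intro card_mono poly_roots_finite) auto
  also have "\<dots> \<le> degree r" using \<open>r \<noteq> 0\<close> by (rule card_poly_roots_bound)
  finally show False using assms(1) by simp
qed

text \<open>The quotients at the distinct roots form, after scaling, the Lagrange basis: each
  vanishes at all the other roots and has degree below their number. Expanding monomials in this
  basis recovers the first terms of any sequence from its coordinates.\<close>

lemma lagrange_bound:
  assumes "card (char_roots p) = degree p" "degree p > 0"
  obtains C where "C > 0" "\<And>t i. i < degree p \<Longrightarrow> \<bar>t i\<bar> \<le> C * (\<Sum>z\<in>char_roots p. norm (root_coord p z t))"
proof -
  let ?R = "char_roots p" and ?Q = "\<lambda>z. synthetic_div (cpoly p) z"
  have fin: "finite ?R" using assms by (intro card_ge_0_finite) simp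
  have Q0: "poly (?Q z) w = 0" if "z \<in> ?R" "w \<in> ?R" "w \<noteq> z" for z w
  proof -
    have "poly ([:- z, 1:] * ?Q z) w = 0"
      using that(2) cpoly_root_factor[OF that(1)] by (simp add: char_roots_def)
    then show ?thesis using that(3) by simp
  qed
  have degQ: "degree (?Q z) < degree p" for z using assms(2) by (simp add: degree_synthetic_div)
  have Q1: "poly (?Q z) z \<noteq> 0" if "z \<in> ?R" for z
  proof
    assume "poly (?Q z) z = 0"
    then have "?Q z = 0"
      using Q0[OF that] degQ[of z] fin assms(1) by (intro poly_eq_0_if_many_roots[of _ ?R]) auto
    then have "cpoly p = 0" using cpoly_root_factor[OF that] by simp
    then show False using assms(2) by (metis degree_0 degree_cpoly less_irrefl)
  qed
  have lag: "monom 1 i = (\<Sum>z\<in>?R. smult (z ^ i / poly (?Q z) z) (?Q z))" (is "_ = ?S") if "i < degree p" for i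
  proof -
    have "monom 1 i - ?S = 0"
    proof (rule poly_eq_0_if_many_roots[of _ ?R])
      have "degree (?Q z) \<le> degree p - 1" "i \<le> degree p - 1" for z
        using degQ[of z] that by simp_all
      then have "degree (monom 1 i - ?S) \<le> degree p - 1"
        by (intro degree_diff_le degree_sum_le order.trans[OF degree_smult_le] order.trans[OF degree_monom_le] fin)
      then show "degree (monom 1 i - ?S) < card ?R" using assms by simp
      fix w assume w: "w \<in> ?R"
      have "poly ?S w = (\<Sum>z\<in>?R. if z = w then w ^ i else 0)"
        unfolding poly_sum using Q0 Q1 w by (intro sum.cong) auto
      then show "poly (monom 1 i - ?S) w = 0" using w fin by (simp add: poly_monom)
    qed (rule fin)
    then show ?thesis by simp
  qed
  define C where "C = 1 + (\<Sum>i<degree p. \<Sum>z\<in>?R. norm (z ^ i / poly (?Q z) z))"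
  have "\<bar>t i\<bar> \<le> C * (\<Sum>z\<in>?R. norm (root_coord p z t))" if "i < degree p" for t i
  proof -
    have "seq_pair (monom 1 i) t = t i"
      by (simp add: seq_pair_altdef[OF degree_monom_le] if_distrib[of "\<lambda>x. x * _"] cong: if_cong)
    then have "\<bar>t i\<bar> = norm (\<Sum>z\<in>?R. z ^ i / poly (?Q z) z * root_coord p z t)"
      by (simp add: lag[OF that] seq_pair_sum seq_pair_smult root_coord_def)
    also have "\<dots> \<le> (\<Sum>z\<in>?R. C * norm (root_coord p z t))"
    proof (intro sum_norm_le)
      fix z assume z: "z \<in> ?R"
      have "norm (z ^ i / poly (?Q z) z) \<le> (\<Sum>z\<in>?R. norm (z ^ i / poly (?Q z) z))"
        using z fin by (intro member_le_sum) auto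
      also have "\<dots> \<le> (\<Sum>i<degree p. \<Sum>z\<in>?R. norm (z ^ i / poly (?Q z) z))"
        using that by (intro member_le_sum[of i "{..<degree p}" "\<lambda>i. \<Sum>z\<in>?R. norm (z ^ i / poly (?Q z) z)"]) (auto intro: sum_nonneg)
      finally show "norm (z ^ i / poly (?Q z) z * root_coord p z t) \<le> C * norm (root_coord p z t)"
        unfolding norm_mult C_def by (intro mult_right_mono) auto
    qed
    finally show ?thesis by (simp add: sum_distrib_left)
  qed
  moreover have "C > 0" unfolding C_def by (intro add_pos_nonneg sum_nonneg) auto
  ultimately show thesis using that by blast
qed

text \<open>The reverse of \<open>lagrange_bound\<close>: the quotient has degree below
  \<open>degree p\<close>, so a coordinate reads only the first \<open>degree p\<close>
  terms.\<close>

lemma real_coord_bound: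
  assumes "finite (char_roots p)"
  obtains C where "C > 0"
    "\<And>t z B. z \<in> char_roots p \<Longrightarrow> (\<And>i. i < degree p \<Longrightarrow> \<bar>t i\<bar> \<le> B) \<Longrightarrow> B \<ge> 0 \<Longrightarrow>
       degree p > 0 \<Longrightarrow> \<bar>real_coord p z t\<bar> \<le> C * B"
proof -
  let ?Q = "\<lambda>z. synthetic_div (cpoly p) z"
  let ?c = "\<lambda>z. \<Sum>i\<le>degree p - 1. norm (coeff (?Q z) i)"
  define C where "C = 1 + (\<Sum>z\<in>char_roots p. ?c z)"
  have "\<bar>real_coord p z t\<bar> \<le> C * B"
    if z: "z \<in> char_roots p" and t: "\<And>i. i < degree p \<Longrightarrow> \<bar>t i\<bar> \<le> B" and "B \<ge> 0" and d: "degree p > 0" for t z B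
  proof -
    have "\<bar>real_coord p z t\<bar> \<le> norm (root_coord p z t)"
      by (simp add: real_coord_def abs_Re_le_cmod abs_Im_le_cmod)
    also have "root_coord p z t = (\<Sum>i\<le>degree p - 1. coeff (?Q z) i * of_real (t i))"
      unfolding root_coord_def by (rule seq_pair_altdef) (simp add: degree_synthetic_div)
    also have "norm \<dots> \<le> (\<Sum>i\<le>degree p - 1. norm (coeff (?Q z) i) * B)"
      using t d by (intro sum_norm_le) (auto simp: norm_mult intro!: mult_left_mono t)
    also have "\<dots> = ?c z * B" by (simp add: sum_distrib_right)
    also have "?c z \<le> C"
      using member_le_sum[OF z, of ?c] assms unfolding C_def by (simp add: sum_nonneg)
    finally show ?thesis using \<open>B \<ge> 0\<close> by (simp add: mult_right_mono)
  qed
  moreover have "C > 0" unfolding C_def by (intro add_pos_nonneg sum_nonneg) auto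
  ultimately show thesis using that by blast
qed


section \<open>Roots of modulus at most one, and how the others determine a bounded solution\<close>

definition stable_roots :: "real poly \<Rightarrow> complex set" where
  "stable_roots p = {z \<in> char_roots p. cmod z \<le> 1}"

lemma cnj_stable_roots: "z \<in> stable_roots p \<Longrightarrow> cnj z \<in> stable_roots p"
  by (simp add: stable_roots_def root_coord_cnj)

text \<open>At an unstable root the shift expands. A bound on the window beginning at n bounds the
  coordinate there, which is z^n times the coordinate at time 0; the latter is thus of order L^(-n).
  The stable coordinates gain nothing from the shift and are assumed that small.\<close>

lemma lin_rec_contraction:
  assumes card: "card (char_roots p) = degree p" and q: "card (stable_roots p) < degree p"
  obtains L C where "L > 1" "C > 0"
    "\<And>t n. lin_rec p t \<Longrightarrow> (\<And>k. k < n + degree p \<Longrightarrow> \<bar>t k\<bar> \<le> 1) \<Longrightarrow>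
       (\<And>z. z \<in> stable_roots p \<Longrightarrow> \<bar>real_coord p z t\<bar> \<le> inverse (L ^ n)) \<Longrightarrow>
       (\<And>i. i < degree p \<Longrightarrow> \<bar>t i\<bar> \<le> C * inverse (L ^ n))"
proof -
  let ?R = "char_roots p" and ?S = "stable_roots p"
  have d: "degree p > 0" using q by simp
  have fin: "finite ?R" using card d by (intro card_ge_0_finite) simp
  have "?S \<subseteq> ?R" by (auto simp: stable_roots_def)
  moreover have "?S \<noteq> ?R" using card q by auto
  ultimately have ne: "?R - ?S \<noteq> {}" by blast
  \<comment> \<open>The least modulus among the unstable roots. They form a nonempty finite set, so
    the minimum exceeds 1.\<close>
  define L where "L = Min (cmod ` (?R - ?S))"
  have L1: "L > 1" using ne fin by (auto simp: L_def Min_gr_iff stable_roots_def)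
  have Lle: "L \<le> cmod z" if "z \<in> ?R" "z \<notin> ?S" for z
    using that fin by (auto simp: L_def intro!: Min_le)
  obtain C1 where C1: "C1 > 0" "\<And>t i. i < degree p \<Longrightarrow> \<bar>t i\<bar> \<le> C1 * (\<Sum>z\<in>?R. norm (root_coord p z t))"
    using lagrange_bound[OF card d] by blast
  obtain C2 where C2: "C2 > 0"
    "\<And>t z B. z \<in> char_roots p \<Longrightarrow> (\<And>i. i < degree p \<Longrightarrow> \<bar>t i\<bar> \<le> B) \<Longrightarrow> B \<ge> 0 \<Longrightarrow>
       degree p > 0 \<Longrightarrow> \<bar>real_coord p z t\<bar> \<le> C2 * B"
    using real_coord_bound[OF fin] by blast
  have bound: "\<bar>t i\<bar> \<le> C1 * (degree p * (2 + 2 * C2)) * inverse (L ^ n)"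
    if rec: "lin_rec p t" and small: "\<And>k. k < n + degree p \<Longrightarrow> \<bar>t k\<bar> \<le> 1"
      and st: "\<And>z. z \<in> ?S \<Longrightarrow> \<bar>real_coord p z t\<bar> \<le> inverse (L ^ n)" and i: "i < degree p" for t n i
  proof -
    have "norm (root_coord p z t) \<le> (2 + 2 * C2) * inverse (L ^ n)" if z: "z \<in> ?R" for z
    proof (cases "z \<in> ?S")
      case True
      have "norm (root_coord p z t) \<le> 2 * inverse (L ^ n)"
        using norm_root_coord_le[OF z, of t] st[OF True] st[OF cnj_stable_roots[OF True]] by linarith
      also have "\<dots> \<le> (2 + 2 * C2) * inverse (L ^ n)" using C2(1) L1 by (intro mult_right_mono) auto
      finally show ?thesis .
    next
      case False
      have "norm (root_coord p z (\<lambda>k. t (n + k))) \<le> 2 * C2"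
        using norm_root_coord_le[OF z, of "\<lambda>k. t (n + k)"]
          C2(2)[OF z, of "\<lambda>k. t (n + k)" 1] C2(2)[OF root_coord_cnj(1)[OF z], of "\<lambda>k. t (n + k)" 1] small d
        by simp
      moreover have "norm (root_coord p z (\<lambda>k. t (n + k))) = cmod z ^ n * norm (root_coord p z t)"
        by (simp add: root_coord_shift[OF rec z] norm_mult norm_power)
      moreover have "L ^ n * norm (root_coord p z t) \<le> cmod z ^ n * norm (root_coord p z t)"
        using Lle[OF z False] L1 by (intro mult_right_mono power_mono) auto
      ultimately have "L ^ n * norm (root_coord p z t) \<le> 2 + 2 * C2" by linarith
      then show ?thesis using L1 by (simp add: field_simps)
    qed
    then have "(\<Sum>z\<in>?R. norm (root_coord p z t)) \<le> degree p * ((2 + 2 * C2) * inverse (L ^ n))"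
      using sum_bounded_above[of ?R "\<lambda>z. norm (root_coord p z t)"] card by simp
    then have "C1 * (\<Sum>z\<in>?R. norm (root_coord p z t)) \<le> C1 * (degree p * ((2 + 2 * C2) * inverse (L ^ n)))"
      using C1(1) by simp
    then show ?thesis using C1(2)[OF i, of t] by (simp add: mult.assoc)
  qed
  have "C1 * (degree p * (2 + 2 * C2)) > 0" using C1(1) C2(1) d by simp
  then show thesis by (rule that[OF L1]) (rule bound)
qed

section \<open>The Erdos--Kahane argument\<close>

definition int_dist :: "real \<Rightarrow> real" where
  "int_dist x = \<bar>x - of_int (round x)\<bar>"

lemma int_dist_le_half: "int_dist x \<le> 1 / 2"
  unfolding int_dist_def using of_int_round_abs_le[of x] by (simp add: abs_minus_commute)

lemma int_dist_nonneg: "int_dist x \<ge> 0"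
  by (simp add: int_dist_def)

text \<open>A Chernoff-type count: every nonzero value is given weight x. A sparse function weighs
  at least \<open>x powr D\<close>, while all functions together weigh a product of one-point sums,
  each \<open>1 + 2 * M * x\<close>.\<close>

lemma card_sparse_functions:
  fixes x :: real and M :: nat
  assumes "0 < x" "x \<le> 1" "finite I"
  shows "real (card {e \<in> I \<rightarrow>\<^sub>E {- int M..int M}. real (card {i \<in> I. e i \<noteq> 0}) \<le> D})
    \<le> (1 / x) powr D * (1 + 2 * M * x) ^ card I"
proof -
  let ?V = "{- int M..int M}" and ?w = "\<lambda>j :: int. if j = 0 then 1 else x"
  let ?E = "{e \<in> I \<rightarrow>\<^sub>E ?V. real (card {i \<in> I. e i \<noteq> 0}) \<le> D}"
  have fin: "finite (I \<rightarrow>\<^sub>E ?V)" using assms(3) by (intro finite_PiE) auto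
  have w: "(\<Sum>j\<in>?V. ?w j) = 1 + 2 * M * x"
  proof -
    have "(\<Sum>j\<in>?V. ?w j) = ?w 0 + (\<Sum>j\<in>?V - {0}. ?w j)"
      by (subst sum.remove[of _ 0]) auto
    also have "(\<Sum>j\<in>?V - {0}. ?w j) = (\<Sum>j\<in>?V - {0}. x)"
      by (intro sum.cong) auto
    finally show ?thesis by (simp add: card_Diff_singleton)
  qed
  have "x powr D * card ?E = (\<Sum>e\<in>?E. x powr D)" by simp
  also have "\<dots> \<le> (\<Sum>e\<in>?E. \<Prod>i\<in>I. ?w (e i))"
  proof (rule sum_mono)
    fix e assume "e \<in> ?E"
    then have "x powr D \<le> x powr card {i \<in> I. e i \<noteq> 0}"
      using assms(1,2) by (intro powr_mono') auto
    also have "\<dots> = (\<Prod>i\<in>I. ?w (e i))"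
      using assms(1,3) by (simp add: powr_realpow prod.If_cases Int_def)
    finally show "x powr D \<le> (\<Prod>i\<in>I. ?w (e i))" .
  qed
  also have "\<dots> \<le> (\<Sum>e\<in>I \<rightarrow>\<^sub>E ?V. \<Prod>i\<in>I. ?w (e i))"
    using assms(1) fin by (intro sum_mono2) (auto intro!: prod_nonneg)
  also have "\<dots> = (\<Prod>i\<in>I. \<Sum>j\<in>?V. ?w j)"
    using assms(3) by (intro prod_sum_PiE[symmetric]) auto
  also have "\<dots> = (1 + 2 * M * x) ^ card I" by (simp only: w prod_constant)
  finally have "x powr D * card ?E \<le> (1 + 2 * M * x) ^ card I" .
  then have "(1 / x) powr D * (x powr D * card ?E) \<le> (1 / x) powr D * (1 + 2 * M * x) ^ card I"
    by (intro mult_left_mono) auto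
  moreover have "(1 / x) powr D * x powr D = 1"
    using assms(1) by (simp add: powr_divide)
  ultimately show ?thesis by (simp add: mult.assoc[symmetric])
qed

text \<open>Together with the first \<open>degree p\<close> roundings, the defects encode all later
  ones (\<open>round_determined\<close>); they are bounded, and zero on every window without far
  indices. The prediction is rounded so that the defect is an integer although the coefficients are
  real.\<close>

definition round_defect :: "real poly \<Rightarrow> (nat \<Rightarrow> real) \<Rightarrow> nat \<Rightarrow> int" where
  "round_defect p t k = round (t (k + degree p))
     - round (- (\<Sum>i<degree p. coeff p i * of_int (round (t (k + i)))))"

text \<open>The recurrence annihilates \<open>t\<close> itself, so applied to the roundings it sees
  only the rounding errors.\<close>

lemma round_defect_error:
  assumes "lin_rec p t" "lead_coeff p = 1"
  shows "\<bar>of_int (round (t (k + degree p))) - (- (\<Sum>i<degree p. coeff p i * of_int (round (t (k + i)))))\<bar>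
    \<le> (\<Sum>i\<le>degree p. \<bar>coeff p i\<bar> * int_dist (t (k + i)))"
proof -
  have "of_int (round (t (k + degree p))) - (- (\<Sum>i<degree p. coeff p i * of_int (round (t (k + i)))))
    = (\<Sum>i\<le>degree p. coeff p i * of_int (round (t (k + i))))"
    using assms(2) by (simp flip: lessThan_Suc_atMost)
  also have "\<dots> = (\<Sum>i\<le>degree p. coeff p i * (of_int (round (t (k + i))) - t (k + i)))"
    using assms(1) by (simp add: lin_rec_def right_diff_distrib sum_subtractf)
  also have "\<bar>\<dots>\<bar> \<le> (\<Sum>i\<le>degree p. \<bar>coeff p i\<bar> * int_dist (t (k + i)))"
    by (intro order.trans[OF sum_abs] sum_mono) (simp add: abs_mult int_dist_def abs_minus_commute)
  finally show ?thesis .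
qed

definition coeff_norm :: "real poly \<Rightarrow> real" where
  "coeff_norm p = (\<Sum>i\<le>degree p. \<bar>coeff p i\<bar>)"

lemma coeff_norm_ge_1: "lead_coeff p = 1 \<Longrightarrow> coeff_norm p \<ge> 1"
  unfolding coeff_norm_def
  using member_le_sum[of "degree p" "{..degree p}" "\<lambda>i. \<bar>coeff p i\<bar>"] by simp

lemma abs_round_defect_le:
  assumes "lin_rec p t" "lead_coeff p = 1"
  shows "\<bar>real_of_int (round_defect p t k)\<bar> \<le> coeff_norm p"
proof -
  let ?x = "- (\<Sum>i<degree p. coeff p i * of_int (round (t (k + i))))"
  have "(\<Sum>i\<le>degree p. \<bar>coeff p i\<bar> * int_dist (t (k + i))) \<le> (\<Sum>i\<le>degree p. \<bar>coeff p i\<bar> * (1 / 2))"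
    by (intro sum_mono mult_left_mono int_dist_le_half) auto
  also have "\<dots> = coeff_norm p / 2" by (simp add: coeff_norm_def sum_divide_distrib)
  finally have "\<bar>of_int (round (t (k + degree p))) - ?x\<bar> \<le> coeff_norm p / 2"
    using round_defect_error[OF assms, of k] by linarith
  moreover have "\<bar>of_int (round ?x) - ?x\<bar> \<le> 1 / 2" by (rule of_int_round_abs_le)
  ultimately have "\<bar>real_of_int (round (t (k + degree p))) - of_int (round ?x)\<bar> \<le> coeff_norm p"
    using coeff_norm_ge_1[OF assms(2)] by linarith
  then show ?thesis by (simp add: round_defect_def)
qed

text \<open>The threshold keeps the total error at most 1/4, below the 1/2 within which the
  prediction rounds to the actual integer.\<close>

lemma round_defect_eq_0:
  assumes "lin_rec p t" "lead_coeff p = 1"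
    and "\<And>i. i \<le> degree p \<Longrightarrow> int_dist (t (k + i)) < 1 / (4 * coeff_norm p)"
  shows "round_defect p t k = 0"
proof -
  let ?x = "- (\<Sum>i<degree p. coeff p i * of_int (round (t (k + i))))"
  have "(\<Sum>i\<le>degree p. \<bar>coeff p i\<bar> * int_dist (t (k + i))) \<le> (\<Sum>i\<le>degree p. \<bar>coeff p i\<bar> * (1 / (4 * coeff_norm p)))"
    using assms(3) by (intro sum_mono mult_left_mono) (auto intro: less_imp_le)
  also have "\<dots> = coeff_norm p * (1 / (4 * coeff_norm p))" by (simp only: coeff_norm_def sum_distrib_right)
  also have "\<dots> < 1 / 2" using coeff_norm_ge_1[OF assms(2)] by simp
  finally have "\<bar>?x - of_int (round (t (k + degree p)))\<bar> < 1 / 2"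
    using round_defect_error[OF assms(1,2), of k] by linarith
  then have "round ?x = round (t (k + degree p))" by (rule round_unique')
  then show ?thesis by (simp add: round_defect_def)
qed

definition far_indices :: "real \<Rightarrow> nat \<Rightarrow> (nat \<Rightarrow> real) \<Rightarrow> nat set" where
  "far_indices \<rho> N t = {k. k < N \<and> \<rho> \<le> int_dist (t k)}"

lemma finite_far_indices [simp]: "finite (far_indices \<rho> N t)"
  by (simp add: far_indices_def)

lemma card_round_defect_nonzero:
  assumes "lin_rec p t" "lead_coeff p = 1"
  shows "card {k \<in> {..<n}. round_defect p t k \<noteq> 0}
    \<le> card (far_indices (1 / (4 * coeff_norm p)) (n + degree p) t) * (degree p + 1)"
proof -
  let ?F = "far_indices (1 / (4 * coeff_norm p)) (n + degree p) t"
  \<comment> \<open>A far index j spoils only the windows that start at j - i with i at most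
    \<open>degree p\<close>.\<close>
  have "{k \<in> {..<n}. round_defect p t k \<noteq> 0} \<subseteq> (\<lambda>(j, i). j - i) ` (?F \<times> {..degree p})"
  proof
    fix k assume k: "k \<in> {k \<in> {..<n}. round_defect p t k \<noteq> 0}"
    then obtain i where "i \<le> degree p" "int_dist (t (k + i)) \<ge> 1 / (4 * coeff_norm p)"
      using round_defect_eq_0[OF assms, of k] by force
    then show "k \<in> (\<lambda>(j, i). j - i) ` (?F \<times> {..degree p})"
      using k by (intro image_eqI[of _ _ "(k + i, i)"]) (auto simp: far_indices_def)
  qed
  then have "card {k \<in> {..<n}. round_defect p t k \<noteq> 0} \<le> card (?F \<times> {..degree p})"
    by (rule surj_card_le[rotated]) simp
  then show ?thesis by (simp add: card_cartesian_product)
qed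

lemma round_determined:
  assumes "\<And>i. i < degree p \<Longrightarrow> round (t i) = round (t' i)"
    and "\<And>k. k < n \<Longrightarrow> round_defect p t k = round_defect p t' k"
    and "k < n + degree p"
  shows "round (t k) = round (t' k)"
  using assms(3)
proof (induction k rule: less_induct)
  case (less k)
  show ?case
  proof (cases "k < degree p")
    case False
    define j where "j = k - degree p"
    have k: "k = j + degree p" using False by (simp add: j_def)
    have "(\<Sum>i<degree p. coeff p i * of_int (round (t (j + i)))) = (\<Sum>i<degree p. coeff p i * of_int (round (t' (j + i))))"
      using less unfolding k by (intro sum.cong) auto
    then show ?thesis
      using assms(2)[of j] less.prems unfolding k by (simp add: round_defect_def)
  qed (simp add: assms(1))
qed


text \<open>Two costs per step are kept below L^\<epsilon>. First x tames the growth factor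
  \<open>1 + 2 * M * x\<close>; then \<delta> is made so small that the price 1 / x of a nonzero
  value, paid d \<delta> times per step, is affordable. The ones added in the denominators keep
  these positive when M = 0 or x = 1.\<close>

lemma Erdos_Kahane_parameters:
  fixes L \<epsilon> :: real and M d :: nat
  assumes "L > 1" "\<epsilon> > 0"
  obtains x \<delta> :: real where "0 < x" "x \<le> 1" "\<delta> > 0" "1 + 2 * M * x \<le> L powr \<epsilon>"
    "(1 / x) powr (d * \<delta>) \<le> L powr \<epsilon>"
proof -
  have pos: "L powr \<epsilon> - 1 > 0" using assms by simp
  define x where "x = min 1 ((L powr \<epsilon> - 1) / (2 * M + 1))"
  have x: "0 < x" "x \<le> 1" using pos by (auto simp: x_def)
  have "2 * M * x \<le> (2 * M + 1) * ((L powr \<epsilon> - 1) / (2 * M + 1))"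
    using pos x(1) by (intro mult_mono) (auto simp: x_def)
  then have 1: "1 + 2 * M * x \<le> L powr \<epsilon>" by simp
  define \<delta> where "\<delta> = \<epsilon> * ln L / (d * ln (1 / x) + 1)"
  have lnx: "ln (1 / x) \<ge> 0" using x by simp
  then have den: "d * ln (1 / x) + 1 > 0" by (intro add_nonneg_pos) auto
  have "d * ln (1 / x) * \<delta> \<le> (d * ln (1 / x) + 1) * \<delta>"
    using den assms by (intro mult_right_mono) (auto simp: \<delta>_def)
  also have "\<dots> = \<epsilon> * ln L" using den by (simp add: \<delta>_def)
  finally have "exp (d * \<delta> * ln (1 / x)) \<le> exp (\<epsilon> * ln L)" by (simp add: mult_ac)
  then have "(1 / x) powr (d * \<delta>) \<le> L powr \<epsilon>" using x assms by (simp add: powr_def)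
  moreover have "\<delta> > 0" using den assms by (simp add: \<delta>_def)
  ultimately show thesis using that x 1 by blast
qed

lemma card_int_interval_le: "a \<le> b \<Longrightarrow> real (card {\<lfloor>a\<rfloor> - 1..\<lceil>b\<rceil> + 1 :: int}) \<le> b - a + 5"
  by simp linarith

text \<open>There are about L^(\<theta> n) pieces of size L^(-n), so \<theta> is the dimension that
  the cover witnesses. Far indices are counted up to \<open>n + degree p\<close>, the stretch on
  which \<open>lin_rec_contraction\<close> needs control to reach scale n.\<close>

definition near_integer_cover ::
  "real poly \<Rightarrow> real \<Rightarrow> real \<Rightarrow> real \<Rightarrow> real \<Rightarrow> real \<Rightarrow> real \<Rightarrow> nat \<Rightarrow> (nat \<Rightarrow> real) set set \<Rightarrow> bool" where
  "near_integer_cover p \<rho> \<delta> L \<theta> B C n \<T> \<longleftrightarrow> finite \<T> \<and> real (card \<T>) \<le> C * L powr (\<theta> * n) \<and>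
     {t. lin_rec p t \<and> (\<forall>i<degree p. \<bar>t i\<bar> \<le> B) \<and>
       real (card (far_indices \<rho> (n + degree p) t)) \<le> \<delta> * (n + degree p)} \<subseteq> \<Union>\<T> \<and>
     (\<forall>T\<in>\<T>. \<forall>t\<in>T. \<forall>t'\<in>T. \<forall>i<degree p. \<bar>t i - t' i\<bar> \<le> C * inverse (L ^ n))"

text \<open>The Erdos--Kahane argument: a solution that is close to integers most of the time is
  determined, up to few choices, by its first roundings; the remaining freedom is that of the
  real coordinates at the roots of modulus at most one.\<close>

proposition Erdos_Kahane_cover:
  fixes \<eta> :: real
  assumes card: "card (char_roots p) = degree p" and q: "card (stable_roots p) < degree p"
    and monic: "lead_coeff p = 1" and \<eta>: "\<eta> > 0"
  obtains L \<rho> \<delta> :: real where "L > 1" "\<rho> > 0" "\<delta> > 0"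
    "\<forall>B>0. \<exists>C>0. \<forall>n. \<exists>\<T>. near_integer_cover p \<rho> \<delta> L (card (stable_roots p) + \<eta>) B C n \<T>"
proof -
  let ?m = "degree p" and ?S = "stable_roots p"
  have d: "?m > 0" using q by simp
  have fin: "finite (char_roots p)" using card d by (intro card_ge_0_finite) simp
  have Ssub: "?S \<subseteq> char_roots p" by (auto simp: stable_roots_def)
  have finS: "finite ?S" using fin Ssub by (rule finite_subset[rotated])
  obtain L C1 where L: "L > 1" and C1: "C1 > 0"
    and contr: "\<And>t n i. lin_rec p t \<Longrightarrow> (\<And>k. k < n + ?m \<Longrightarrow> \<bar>t k\<bar> \<le> 1) \<Longrightarrow>
       (\<And>z. z \<in> ?S \<Longrightarrow> \<bar>real_coord p z t\<bar> \<le> inverse (L ^ n)) \<Longrightarrow>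
       i < ?m \<Longrightarrow> \<bar>t i\<bar> \<le> C1 * inverse (L ^ n)"
    by (rule lin_rec_contraction[OF card q]) blast
  obtain C2 where C2: "C2 > 0"
    and rc: "\<And>t z B. z \<in> char_roots p \<Longrightarrow> (\<And>i. i < ?m \<Longrightarrow> \<bar>t i\<bar> \<le> B) \<Longrightarrow> B \<ge> 0 \<Longrightarrow>
       ?m > 0 \<Longrightarrow> \<bar>real_coord p z t\<bar> \<le> C2 * B"
    by (rule real_coord_bound[OF fin]) blast
  define \<rho> where "\<rho> = 1 / (4 * coeff_norm p)"
  have \<rho>: "\<rho> > 0" using coeff_norm_ge_1[OF monic] by (simp add: \<rho>_def)
  define M where "M = nat \<lceil>coeff_norm p\<rceil>"
  obtain x \<delta> :: real where x: "0 < x" "x \<le> 1" and \<delta>: "\<delta> > 0" and x1: "1 + 2 * M * x \<le> L powr (\<eta> / 2)"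
    and x2: "(1 / x) powr (real (?m + 1) * \<delta>) \<le> L powr (\<eta> / 2)"
    by (rule Erdos_Kahane_parameters[OF L half_gt_zero[OF \<eta>]])
  have "\<exists>C>0. \<forall>n. \<exists>\<T>. near_integer_cover p \<rho> \<delta> L (card ?S + \<eta>) B C n \<T>" if B: "B > 0" for B
  proof -
    \<comment> \<open>The factors count the initial roundings and the cells of the stable
      coordinates; the power of L is the surplus of the defect sequences caused by counting far
      indices up to \<open>n + ?m\<close> instead of n.\<close>
    define C where "C = max C1 ((2 * B + 5) ^ ?m * (2 * C2 * B + 5) ^ card ?S * L powr (\<eta> / 2 * ?m))"
    have "\<exists>\<T>. near_integer_cover p \<rho> \<delta> L (card ?S + \<eta>) B C n \<T>" for n
    proof -
      let ?TT = "{t. lin_rec p t \<and> (\<forall>i<?m. \<bar>t i\<bar> \<le> B) \<and>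
         real (card (far_indices \<rho> (n + ?m) t)) \<le> \<delta> * (n + ?m)}"
      define D where "D = real (?m + 1) * \<delta> * (n + ?m)"
      define b where "b = C2 * B * L ^ n"
      \<comment> \<open>A solution is encoded by its first roundings (\<open>F1\<close>), its sparse
        defect sequence (\<open>F2\<close>) and its stable coordinates rounded down to multiples of
        L^(-n) (\<open>F3\<close>). The pieces of the cover are the fibres of this code.\<close>
      define F1 where "F1 = {..<?m} \<rightarrow>\<^sub>E {\<lfloor>- B\<rfloor> - 1..\<lceil>B\<rceil> + 1}"
      define F2 where "F2 = {e \<in> {..<n} \<rightarrow>\<^sub>E {- int M..int M}. real (card {i \<in> {..<n}. e i \<noteq> 0}) \<le> D}"
      define F3 where "F3 = ?S \<rightarrow>\<^sub>E {\<lfloor>- b\<rfloor> - 1..\<lceil>b\<rceil> + 1}"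
      define f1 where "f1 = (\<lambda>t :: nat \<Rightarrow> real. restrict (\<lambda>i. round (t i)) {..<?m})"
      define f2 where "f2 = (\<lambda>t. restrict (round_defect p t) {..<n})"
      define f3 where "f3 = (\<lambda>t. restrict (\<lambda>z. \<lfloor>real_coord p z t * L ^ n\<rfloor>) ?S)"
      define code where "code = (\<lambda>t. (f1 t, f2 t, f3 t))"
      have "finite ({..<n} \<rightarrow>\<^sub>E {- int M..int M})" by (rule finite_PiE) auto
      then have finF2: "finite F2" by (rule finite_subset[rotated]) (auto simp: F2_def)
      have finF: "finite F1" "finite F3"
        unfolding F1_def F3_def using finS by (auto intro!: finite_PiE)
      note finF = this finF2
      have b: "b > 0" using B C2 L by (simp add: b_def)
      have code: "code t \<in> F1 \<times> F2 \<times> F3" if t: "t \<in> ?TT" for t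
      proof -
        have rec: "lin_rec p t" using t by simp
        have "round (t i) \<in> {\<lfloor>- B\<rfloor> - 1..\<lceil>B\<rceil> + 1}" if "i < ?m" for i
        proof -
          have "\<bar>t i\<bar> \<le> B" using t that by simp
          then show ?thesis using of_int_round_abs_le[of "t i"]
            by (simp only: atLeastAtMost_iff) (intro conjI; linarith)
        qed
        then have 1: "f1 t \<in> F1" by (simp add: f1_def F1_def)
        have "round_defect p t k \<in> {- int M..int M}" for k
          using abs_round_defect_le[OF rec monic, of k] unfolding M_def
          by (simp only: atLeastAtMost_iff) (intro conjI; linarith)
        moreover have "real (card {i \<in> {..<n}. f2 t i \<noteq> 0}) \<le> D"
        proof -
          have "{i \<in> {..<n}. f2 t i \<noteq> 0} = {i \<in> {..<n}. round_defect p t i \<noteq> 0}" by (auto simp: f2_def)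
          then have "real (card {i \<in> {..<n}. f2 t i \<noteq> 0}) \<le> real (card (far_indices \<rho> (n + ?m) t) * (?m + 1))"
            using card_round_defect_nonzero[OF rec monic, of n] by (simp only: \<rho>_def of_nat_le_iff)
          also have "\<dots> \<le> \<delta> * (n + ?m) * real (?m + 1)"
            unfolding of_nat_mult using t by (intro mult_right_mono) auto
          finally show ?thesis by (simp add: D_def mult_ac)
        qed
        ultimately have 2: "f2 t \<in> F2" by (auto simp: F2_def f2_def)
        have "\<lfloor>real_coord p z t * L ^ n\<rfloor> \<in> {\<lfloor>- b\<rfloor> - 1..\<lceil>b\<rceil> + 1}" if z: "z \<in> ?S" for z
        proof -
          have "\<bar>real_coord p z t\<bar> \<le> C2 * B" using z Ssub t B d by (intro rc) auto
          then have "\<bar>real_coord p z t * L ^ n\<bar> \<le> b"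
            using L by (simp add: b_def abs_mult mult_right_mono)
          then show ?thesis by (simp only: atLeastAtMost_iff) (intro conjI; linarith)
        qed
        then have 3: "f3 t \<in> F3" by (simp add: f3_def F3_def)
        show ?thesis using 1 2 3 by (simp add: code_def)
      qed
      define \<T> where "\<T> = (\<lambda>c. {t \<in> ?TT. code t = c}) ` (F1 \<times> F2 \<times> F3)"
      have T1: "finite \<T>" using finF by (simp add: \<T>_def)
      have T2: "?TT \<subseteq> \<Union>\<T>" using code unfolding \<T>_def by blast
      have T3: "\<bar>t i - t' i\<bar> \<le> C * inverse (L ^ n)"
        if T: "T \<in> \<T>" and t: "t \<in> T" and t': "t' \<in> T" and i: "i < ?m" for T t t' i
      proof -
        have TT: "t \<in> ?TT" "t' \<in> ?TT" and eq: "code t = code t'" using T t t' by (auto simp: \<T>_def)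
        have e1: "round (t i) = round (t' i)" if "i < ?m" for i
          using eq that by (auto simp: code_def f1_def restrict_def fun_eq_iff split: if_splits)
        have e2: "round_defect p t k = round_defect p t' k" if "k < n" for k
          using eq that by (auto simp: code_def f2_def restrict_def fun_eq_iff split: if_splits)
        have e3: "\<lfloor>real_coord p z t * L ^ n\<rfloor> = \<lfloor>real_coord p z t' * L ^ n\<rfloor>" if "z \<in> ?S" for z
          using eq that by (auto simp: code_def f3_def restrict_def fun_eq_iff split: if_splits)
        have "\<bar>t i - t' i\<bar> \<le> C1 * inverse (L ^ n)"
        proof (rule contr[OF lin_rec_diff _ _ i])
          show "lin_rec p t" "lin_rec p t'" using TT by auto
          \<comment> \<open>Both numbers lie within 1/2 of the same integer.\<close>
          show "\<bar>t k - t' k\<bar> \<le> 1" if "k < n + ?m" for k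
            using round_determined[OF e1 e2 that] of_int_round_abs_le[of "t k"] of_int_round_abs_le[of "t' k"]
            unfolding abs_le_iff by simp
          show "\<bar>real_coord p z (\<lambda>k. t k - t' k)\<bar> \<le> inverse (L ^ n)" if z: "z \<in> ?S" for z
          proof -
            have "\<bar>real_coord p z t * L ^ n - real_coord p z t' * L ^ n\<bar> \<le> 1"
              using e3[OF z] by linarith
            then have "\<bar>real_coord p z t - real_coord p z t'\<bar> * L ^ n \<le> 1"
              using L by (simp add: abs_mult flip: left_diff_distrib)
            then show ?thesis using L by (simp add: real_coord_diff field_simps)
          qed
        qed
        also have "\<dots> \<le> C * inverse (L ^ n)" using L by (intro mult_right_mono) (auto simp: C_def)
        finally show ?thesis .
      qed
      have T4: "real (card \<T>) \<le> C * L powr ((card ?S + \<eta>) * n)"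
      proof -
        have c1: "real (card F1) \<le> (2 * B + 5) ^ ?m"
          unfolding F1_def card_PiE[OF finite_lessThan] prod_constant of_nat_power card_lessThan
          using card_int_interval_le[of "- B" B] B by (intro power_mono) auto
        have "real (card F2) \<le> (1 / x) powr D * (1 + 2 * M * x) ^ n"
          using card_sparse_functions[OF x, of "{..<n}" M D] by (simp add: F2_def)
        also have "\<dots> \<le> L powr (\<eta> / 2 * (n + ?m)) * L powr (\<eta> / 2 * n)"
        proof (intro mult_mono)
          have "(1 / x) powr D = ((1 / x) powr (real (?m + 1) * \<delta>)) powr (n + ?m)"
            by (simp only: powr_powr D_def)
          also have "\<dots> \<le> (L powr (\<eta> / 2)) powr (n + ?m)" using x2 by (intro powr_mono2) auto
          finally show "(1 / x) powr D \<le> L powr (\<eta> / 2 * (n + ?m))" by (simp only: powr_powr)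
          have "(1 + 2 * M * x) ^ n \<le> (L powr (\<eta> / 2)) ^ n" using x1 x by (intro power_mono) auto
          then show "(1 + 2 * M * x) ^ n \<le> L powr (\<eta> / 2 * n)"
            using L by (simp add: powr_realpow[symmetric] powr_powr)
        qed (use x in auto)
        also have "\<dots> = L powr (\<eta> / 2 * ?m) * L powr (\<eta> * n)"
          by (simp add: powr_add[symmetric] field_simps)
        finally have c2: "real (card F2) \<le> L powr (\<eta> / 2 * ?m) * L powr (\<eta> * n)" .
        have "1 \<le> L ^ n" using L by (simp add: one_le_power)
        then have "2 * b + 5 \<le> (2 * C2 * B + 5) * L ^ n" by (simp add: b_def algebra_simps)
        \<comment> \<open>The one factor whose exponential rate is not arbitrarily small: each
          stable root contributes L^n, hence the summand \<open>card ?S\<close> in the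
          exponent.\<close>
        then have "real (card F3) \<le> ((2 * C2 * B + 5) * L ^ n) ^ card ?S"
          unfolding F3_def card_PiE[OF finS] prod_constant of_nat_power
          using card_int_interval_le[of "- b" b] b by (intro power_mono) auto
        also have "\<dots> = (2 * C2 * B + 5) ^ card ?S * (L ^ n) ^ card ?S"
          by (rule power_mult_distrib)
        also have "(L ^ n) ^ card ?S = L powr (real (card ?S) * real n)"
          using L by (simp add: powr_realpow[symmetric] powr_powr mult.commute[of "real n"])
        finally have c3: "real (card F3) \<le> (2 * C2 * B + 5) ^ card ?S * L powr (real (card ?S) * real n)" .
        have pw: "L powr ((card ?S + \<eta>) * n) = L powr (real (card ?S) * real n) * L powr (\<eta> * n)"
          by (simp add: powr_add[symmetric] distrib_right)
        have "card \<T> \<le> card (F1 \<times> F2 \<times> F3)" unfolding \<T>_def using finF by (intro card_image_le) auto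
        then have "real (card \<T>) \<le> real (card F1) * (real (card F2) * real (card F3))"
          by (simp only: card_cartesian_product of_nat_mult[symmetric] of_nat_le_iff)
        also have "\<dots> \<le> (2 * B + 5) ^ ?m * (L powr (\<eta> / 2 * ?m) * L powr (\<eta> * n) *
            ((2 * C2 * B + 5) ^ card ?S * L powr (real (card ?S) * real n)))"
          using B by (intro mult_mono[OF c1 mult_mono[OF c2 c3]]) auto
        also have "\<dots> = (2 * B + 5) ^ ?m * (2 * C2 * B + 5) ^ card ?S * L powr (\<eta> / 2 * ?m)
           * L powr ((card ?S + \<eta>) * n)"
          unfolding pw by (simp only: mult_ac)
        also have "\<dots> \<le> C * L powr ((card ?S + \<eta>) * n)"
          by (intro mult_right_mono) (auto simp: C_def)
        finally show ?thesis .
      qed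
      show ?thesis
        unfolding near_integer_cover_def
      proof (intro exI conjI)
        show "finite \<T>" by (rule T1)
        show "real (card \<T>) \<le> C * L powr ((card ?S + \<eta>) * n)" by (rule T4)
        show "?TT \<subseteq> \<Union>\<T>" by (rule T2)
        show "\<forall>T\<in>\<T>. \<forall>t\<in>T. \<forall>t'\<in>T. \<forall>i<?m. \<bar>t i - t' i\<bar> \<le> C * inverse (L ^ n)"
        proof (intro ballI allI impI)
          fix T t t' i assume "T \<in> \<T>" "t \<in> T" "t' \<in> T" "i < ?m"
          then show "\<bar>t i - t' i\<bar> \<le> C * inverse (L ^ n)" by (rule T3)
        qed
      qed
    qed
    note cover = this
    have "C > 0" using C1 by (simp add: C_def)
    then show ?thesis by (rule exI[of _ C, OF conjI, OF _ allI]) (rule cover)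
  qed
  note main = this
  show thesis by (rule that[OF L \<rho> \<delta>], intro allI impI) (erule main)
qed

section \<open>Hausdorff null sets\<close>

lemma hausdorff_content_le:
  fixes U :: "nat \<Rightarrow> 'b::metric_space set"
  assumes "E \<subseteq> (\<Union>i. U i)" "\<And>i. bounded (U i)" "\<And>i. diameter (U i) \<le> \<delta>"
  shows "hausdorff_content d \<delta> E \<le> (\<Sum>i. ennreal (diameter (U i) powr d))"
  unfolding hausdorff_content_def using assms by (intro INF_lower) auto

lemma hausdorff_content_mono: "E \<subseteq> F \<Longrightarrow> hausdorff_content d \<delta> E \<le> hausdorff_content d \<delta> F"
  unfolding hausdorff_content_def by (intro INF_superset_mono) auto

text \<open>Near-optimal covers with errors e / 2^(k+1) are merged into a single sequence through
  \<open>prod_decode\<close>. Infinite content is treated apart, since no cover is strictly better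
  than infinity plus an error.\<close>

lemma hausdorff_content_UN_le:
  fixes E :: "nat \<Rightarrow> 'b::metric_space set"
  shows "hausdorff_content d \<delta> (\<Union>k. E k) \<le> (\<Sum>k. hausdorff_content d \<delta> (E k))"
proof (cases "\<exists>k. hausdorff_content d \<delta> (E k) = top")
  case True
  then obtain k where k: "hausdorff_content d \<delta> (E k) = top" by blast
  have "hausdorff_content d \<delta> (E k) \<le> (\<Sum>k. hausdorff_content d \<delta> (E k))"
    using sum_le_suminf[of "\<lambda>k. hausdorff_content d \<delta> (E k)" "{k}"] by simp
  then show ?thesis using k by (simp add: top_unique)
next
  case False
  show ?thesis
  proof (rule ennreal_le_epsilon)
    fix e :: real assume e: "0 < e"
    let ?Q = "\<lambda>k (U :: nat \<Rightarrow> 'b set). E k \<subseteq> (\<Union>i. U i) \<and> (\<forall>i. bounded (U i) \<and> diameter (U i) \<le> \<delta>) \<and>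
      (\<Sum>i. ennreal (diameter (U i) powr d)) < hausdorff_content d \<delta> (E k) + ennreal (e * (1 / 2) ^ Suc k)"
    have "\<exists>U. ?Q k U" for k
    proof -
      have "hausdorff_content d \<delta> (E k) < hausdorff_content d \<delta> (E k) + ennreal (e * (1 / 2) ^ Suc k)"
        using False e
        by (cases "hausdorff_content d \<delta> (E k)") (auto simp: ennreal_plus[symmetric] simp del: ennreal_plus
            intro!: ennreal_lessI add_nonneg_pos)
      then show ?thesis
        unfolding hausdorff_content_def[of d \<delta> "E k"] INF_less_iff by blast
    qed
    then have "\<forall>k. \<exists>U. ?Q k U"
      by (rule allI)
    from choice[OF this] obtain U :: "nat \<Rightarrow> nat \<Rightarrow> 'b set" where
      "\<forall>k. ?Q k (U k)"
      by (rule exE)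
    then have U: "E k \<subseteq> (\<Union>i. U k i)" "bounded (U k i)" "diameter (U k i) \<le> \<delta>"
      "(\<Sum>i. ennreal (diameter (U k i) powr d)) < hausdorff_content d \<delta> (E k) + ennreal (e * (1 / 2) ^ Suc k)"
      for k i by simp_all
    have "(\<lambda>k. e * (1 / 2) ^ Suc k) sums (e * 1)"
      by (rule sums_mult[OF power_half_series])
    then have half: "(\<Sum>k. ennreal (e * (1 / 2) ^ Suc k)) = ennreal e"
      using e by (subst suminf_ennreal2) (simp_all add: sums_iff)
    let ?V = "\<lambda>i. case prod_decode i of (k, j) \<Rightarrow> U k j"
    have "hausdorff_content d \<delta> (\<Union>k. E k) \<le> (\<Sum>i. ennreal (diameter (?V i) powr d))"
    proof (rule hausdorff_content_le)
      show "(\<Union>k. E k) \<subseteq> (\<Union>i. ?V i)"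
      proof
        fix x assume "x \<in> (\<Union>k. E k)"
        then obtain k where "x \<in> E k" by blast
        then obtain j where "x \<in> U k j" using U(1) by blast
        then have "x \<in> ?V (prod_encode (k, j))" by simp
        then show "x \<in> (\<Union>i. ?V i)" by (rule UN_I[OF UNIV_I])
      qed
    qed (simp_all add: U(2,3) split: prod.split)
    also have "\<dots> = (\<Sum>i. case prod_decode i of (k, j) \<Rightarrow> ennreal (diameter (U k j) powr d))"
      by (intro suminf_cong) (simp split: prod.split)
    also have "\<dots> = (\<Sum>k. \<Sum>j. ennreal (diameter (U k j) powr d))"
      by (rule suminf_ennreal_2dimen[of _ "\<lambda>(k, j). ennreal (diameter (U k j) powr d)"]) simp
    also have "\<dots> \<le> (\<Sum>k. hausdorff_content d \<delta> (E k) + ennreal (e * (1 / 2) ^ Suc k))"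
      by (rule suminf_le[OF less_imp_le[OF U(4)]]) auto
    also have "\<dots> = (\<Sum>k. hausdorff_content d \<delta> (E k)) + (\<Sum>k. ennreal (e * (1 / 2) ^ Suc k))"
      by (rule suminf_add[symmetric]) auto
    also have "\<dots> = (\<Sum>k. hausdorff_content d \<delta> (E k)) + ennreal e"
      by (simp only: half)
    finally show "hausdorff_content d \<delta> (\<Union>k. E k) \<le> (\<Sum>k. hausdorff_content d \<delta> (E k)) + ennreal e" .
  qed
qed

lemma hausdorff_content_finite_le:
  fixes \<T> :: "'b::metric_space set set"
  assumes "finite \<T>" "E \<subseteq> \<Union>\<T>" "\<And>T. T \<in> \<T> \<Longrightarrow> bounded T" "\<And>T. T \<in> \<T> \<Longrightarrow> diameter T \<le> D"
    "0 \<le> D" "D \<le> \<delta>" "0 < d"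
  shows "hausdorff_content d \<delta> E \<le> ennreal (card \<T> * D powr d)"
proof -
  obtain f where f: "bij_betw f {..<card \<T>} \<T>"
    using assms(1) ex_bij_betw_nat_finite lessThan_atLeast0 by metis
  \<comment> \<open>Contents are defined by sequences of sets. Empty sets have diameter 0 and
    \<open>0 powr d = 0\<close>, so the padding costs nothing.\<close>
  define U where "U = (\<lambda>i. if i < card \<T> then f i else {})"
  have fT: "f i \<in> \<T>" if "i < card \<T>" for i using f that by (auto simp: bij_betw_def)
  have "hausdorff_content d \<delta> E \<le> (\<Sum>i. ennreal (diameter (U i) powr d))"
  proof (rule hausdorff_content_le)
    show "E \<subseteq> (\<Union>i. U i)"
    proof
      fix x assume "x \<in> E"
      then obtain T where T: "T \<in> \<T>" "x \<in> T" using assms(2) by blast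
      then obtain i where "i < card \<T>" "T = f i" using f by (auto simp: bij_betw_def)
      then show "x \<in> (\<Union>i. U i)" using T by (intro UN_I[of i]) (simp_all add: U_def)
    qed
    show "bounded (U i)" "diameter (U i) \<le> \<delta>" for i
      using assms(3)[OF fT[of i]] order.trans[OF assms(4)[OF fT[of i]] assms(6)] assms(5,6)
      by (simp_all add: U_def)
  qed
  also have "\<dots> = (\<Sum>i<card \<T>. ennreal (diameter (U i) powr d))"
    by (intro suminf_finite) (auto simp: U_def)
  also have "\<dots> \<le> (\<Sum>i<card \<T>. ennreal (D powr d))"
  proof (intro sum_mono ennreal_leI powr_mono2)
    fix i assume "i \<in> {..<card \<T>}"
    then show "0 \<le> diameter (U i)" "diameter (U i) \<le> D"
      using assms(3,4)[OF fT[of i]] by (simp_all add: U_def diameter_ge_0)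
  qed (use assms in simp)
  also have "\<dots> = ennreal (card \<T> * D powr d)"
    by (simp add: ennreal_mult' ennreal_of_nat_eq_real_of_nat)
  finally show ?thesis .
qed

lemma hausdorff_measure_eq_0_iff:
  "hausdorff_measure d E = 0 \<longleftrightarrow> (\<forall>\<delta>>0. hausdorff_content d \<delta> E = 0)"
  by (auto simp: hausdorff_measure_def bot_ennreal[symmetric] SUP_bot_conv)

lemma hausdorff_measure_UN_eq_0:
  fixes E :: "nat \<Rightarrow> 'b::metric_space set"
  assumes "\<And>k. hausdorff_measure d (E k) = 0"
  shows "hausdorff_measure d (\<Union>k. E k) = 0"
  unfolding hausdorff_measure_eq_0_iff
proof (intro allI impI)
  fix \<delta> :: real assume "\<delta> > 0"
  then have "hausdorff_content d \<delta> (E k) = 0" for k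
    using assms by (simp add: hausdorff_measure_eq_0_iff)
  then show "hausdorff_content d \<delta> (\<Union>k. E k) = 0"
    using hausdorff_content_UN_le[of d \<delta> E] by simp
qed

text \<open>A Borel--Cantelli argument.\<close>

lemma hausdorff_measure_limsup_eq_0:
  fixes E :: "nat \<Rightarrow> 'b::metric_space set"
  assumes cover: "\<And>n. \<exists>\<T>. finite \<T> \<and> E n \<subseteq> \<Union>\<T> \<and> (\<forall>T\<in>\<T>. bounded T \<and> diameter T \<le> D n) \<and>
      card \<T> * D n powr d \<le> a n"
    and "summable a" "D \<longlonglongrightarrow> 0" "\<And>n. 0 \<le> D n" "0 < d"
    and sub: "\<And>N. F \<subseteq> (\<Union>n. E (n + N))"
  shows "hausdorff_measure d F = 0"
  unfolding hausdorff_measure_eq_0_iff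
proof (intro allI impI)
  fix \<delta> :: real assume \<delta>: "\<delta> > 0"
  have a: "a n \<ge> 0" for n
  proof -
    obtain \<T> :: "'b set set" where "card \<T> * D n powr d \<le> a n"
      using cover[of n] by (elim exE conjE) (rule that)
    moreover have "0 \<le> card \<T> * D n powr d" by simp
    ultimately show ?thesis by linarith
  qed
  have "hausdorff_content d \<delta> F \<le> 0"
  proof (rule ennreal_le_epsilon)
    fix e :: real assume e: "e > 0"
    obtain N1 where N1: "\<And>n. n \<ge> N1 \<Longrightarrow> D n \<le> \<delta>"
      using order_tendstoD(2)[OF assms(3) \<delta>] by (auto simp: eventually_sequentially intro: less_imp_le)
    obtain N2 where N2: "\<And>n. n \<ge> N2 \<Longrightarrow> norm (\<Sum>i. a (i + n)) < e"
      using suminf_exist_split[OF e \<open>summable a\<close>] by blast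
    define N where "N = max N1 N2"
    have "hausdorff_content d \<delta> F \<le> hausdorff_content d \<delta> (\<Union>n. E (n + N))"
      by (rule hausdorff_content_mono[OF sub])
    also have "\<dots> \<le> (\<Sum>n. hausdorff_content d \<delta> (E (n + N)))" by (rule hausdorff_content_UN_le)
    also have "\<dots> \<le> (\<Sum>n. ennreal (a (n + N)))"
    proof (intro suminf_le)
      fix n
      obtain \<T> where \<T>: "finite \<T>" "E (n + N) \<subseteq> \<Union>\<T>" "\<forall>T\<in>\<T>. bounded T \<and> diameter T \<le> D (n + N)"
        "card \<T> * D (n + N) powr d \<le> a (n + N)" 
        using cover[of "n + N"] by (elim exE conjE) (rule that)
      have "hausdorff_content d \<delta> (E (n + N)) \<le> ennreal (card \<T> * D (n + N) powr d)"
      proof (rule hausdorff_content_finite_le[OF \<T>(1,2)])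
        show "bounded T" "diameter T \<le> D (n + N)" if "T \<in> \<T>" for T using \<T>(3) that by simp_all
        show "D (n + N) \<le> \<delta>" by (rule N1) (simp add: N_def)
      qed (rule assms)+
      also have "\<dots> \<le> ennreal (a (n + N))" using \<T>(4) by (rule ennreal_leI)
      finally show "hausdorff_content d \<delta> (E (n + N)) \<le> ennreal (a (n + N))" .
    qed auto
    also have "\<dots> = ennreal (\<Sum>n. a (n + N))"
      using a \<open>summable a\<close> by (intro suminf_ennreal2) (auto simp: summable_iff_shift)
    also have "\<dots> \<le> ennreal e" using N2[of N] by (intro ennreal_leI) (auto simp: N_def)
    finally show "hausdorff_content d \<delta> F \<le> 0 + ennreal e" by simp
  qed
  then show "hausdorff_content d \<delta> F = 0" by simp
qed

lemma hausdorff_dim_le: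
  assumes "hausdorff_measure d E = 0" "0 < d"
  shows "hausdorff_dim E \<le> ennreal d"
  unfolding hausdorff_dim_def using assms by (intro INF_lower[where f = ennreal]) simp

section \<open>The exceptional set\<close>

text \<open>At half-integers \<open>round\<close> does not commute with negation, so the proof
  compares distances by the minimality of the rounding instead.\<close>

lemma int_dist_minus [simp]: "int_dist (- x) = int_dist x"
proof -
  have "int_dist (- y) \<le> int_dist y" for y
    using round_diff_minimal[of "- y" "- round y"] by (simp add: int_dist_def abs_minus_commute)
  from this[of x] this[of "- x"] show ?thesis by simp
qed

lemma far_indices_minus: "far_indices \<rho> N (\<lambda>k. - t k) = far_indices \<rho> N t"
  by (simp add: far_indices_def)

lemma lin_rec_inner:
  fixes l :: "nat \<Rightarrow> real ^ 'a"
  assumes "\<And>a. lin_rec p (\<lambda>k. l k $ a)"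
  shows "lin_rec p (\<lambda>k. c * (s \<bullet> l k))"
  unfolding lin_rec_def
proof
  fix k
  have "(\<Sum>i\<le>degree p. coeff p i * (c * (s \<bullet> l (k + i))))
      = (\<Sum>a\<in>UNIV. c * s $ a * (\<Sum>i\<le>degree p. coeff p i * l (k + i) $ a))"
    by (simp add: inner_vec_def sum_distrib_left mult_ac, subst sum.swap, simp)
  also have "\<dots> = 0" using assms by (simp add: lin_rec_def)
  finally show "(\<Sum>i\<le>degree p. coeff p i * (c * (s \<bullet> l (k + i)))) = 0" .
qed

lemma open_simplex_norm_le: "s \<in> open_simplex \<Longrightarrow> norm s \<le> 1"
  using norm_le_l1_cart[of s] by (auto simp: open_simplex_def abs_of_pos)

lemma open_simplex_le_1: "s \<in> open_simplex \<Longrightarrow> s $ a \<le> 1"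
  using open_simplex_norm_le[of s] component_le_norm_cart[of s a] by linarith

text \<open>The factor w is the sum of the entries of w s, so the same errors control it; dividing
  it out costs 1 / w, at most K.\<close>

lemma open_simplex_normalize_lipschitz:
  fixes s s' :: "real ^ 'a" and K \<epsilon> w w' :: real
  assumes s: "s \<in> open_simplex" and s': "s' \<in> open_simplex" and w: "1 / K \<le> w" and K: "K > 0"
    and close: "\<And>a. \<bar>w * s $ a - w' * s' $ a\<bar> \<le> \<epsilon>"
  shows "dist s s' \<le> CARD('a) * (K * (1 + CARD('a)) * \<epsilon>)"
proof -
  have w0: "w > 0" using w K by (meson divide_pos_pos less_le_trans zero_less_one)
  have inv: "1 / w \<le> K" using w K w0 by (simp add: field_simps)
  have \<epsilon>: "\<epsilon> \<ge> 0" using close[of undefined] by linarith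
  have "w - w' = (\<Sum>a\<in>UNIV. w * s $ a - w' * s' $ a)"
    using s s' by (simp add: open_simplex_def sum_subtractf flip: sum_distrib_left)
  then have ww: "\<bar>w - w'\<bar> \<le> CARD('a) * \<epsilon>"
    using order.trans[OF sum_abs[of "\<lambda>a. w * s $ a - w' * s' $ a" UNIV]
        sum_mono[of UNIV "\<lambda>a. \<bar>w * s $ a - w' * s' $ a\<bar>" "\<lambda>_. \<epsilon>"]] close
    by simp
  have "\<bar>(s - s') $ a\<bar> \<le> K * (1 + CARD('a)) * \<epsilon>" for a
  proof -
    have "s' $ a > 0" "s' $ a \<le> 1" using s' open_simplex_le_1 by (auto simp: open_simplex_def)
    then have "\<bar>s' $ a * (w - w')\<bar> \<le> 1 * (CARD('a) * \<epsilon>)"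
      unfolding abs_mult using ww by (intro mult_mono) auto
    moreover have "w * (s - s') $ a = (w * s $ a - w' * s' $ a) - s' $ a * (w - w')"
      by (simp add: algebra_simps)
    ultimately have "\<bar>w * (s - s') $ a\<bar> \<le> \<epsilon> + CARD('a) * \<epsilon>" using close[of a] by linarith
    then have "w * \<bar>(s - s') $ a\<bar> \<le> \<epsilon> + CARD('a) * \<epsilon>"
      using w0 unfolding abs_mult by simp
    then have "\<bar>(s - s') $ a\<bar> \<le> (1 / w) * (\<epsilon> + CARD('a) * \<epsilon>)"
      using w0 by (simp add: pos_le_divide_eq mult.commute)
    also have "\<dots> \<le> K * (\<epsilon> + CARD('a) * \<epsilon>)" using inv \<epsilon> by (intro mult_right_mono) auto
    finally show ?thesis by (simp add: algebra_simps)
  qed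
  then have "(\<Sum>a\<in>UNIV. \<bar>(s - s') $ a\<bar>) \<le> (\<Sum>a\<in>(UNIV :: 'a set). K * (1 + CARD('a)) * \<epsilon>)"
    by (intro sum_mono)
  then show ?thesis using norm_le_l1_cart[of "s - s'"] by (simp add: dist_norm)
qed

text \<open>The frequency is bound inside the set, so a vector outside satisfies the count for all
  frequencies of the range at once. Positive ones suffice, because \<open>far_indices\<close> is
  invariant under a change of sign.\<close>

definition resonant_set :: "(nat \<Rightarrow> real ^ 'a) \<Rightarrow> real \<Rightarrow> real \<Rightarrow> real \<Rightarrow> nat \<Rightarrow> (real ^ 'a) set" where
  "resonant_set l \<rho> \<delta> K N = {s \<in> open_simplex. \<exists>w. 1 / K \<le> w \<and> w \<le> K \<and>
     real (card (far_indices \<rho> N (\<lambda>k. w * (s \<bullet> l k)))) \<le> \<delta> * N}"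

text \<open>The cover of solutions is pulled back to the simplex. By \<open>span\<close> the first
  \<open>degree p\<close> terms recover w s linearly, and normalising recovers s, so a piece of size
  L^(-n) has a preimage of that order.\<close>

lemma resonant_set_cover:
  fixes l :: "nat \<Rightarrow> real ^ 'a" and p :: "real poly" and \<rho> \<delta> L \<theta> K :: real
  assumes rec: "\<And>a. lin_rec p (\<lambda>k. l k $ a)"
    and span: "\<And>y a. y $ a = (\<Sum>i<degree p. b a i * (y \<bullet> l i))"
    and L: "L > 1" and K: "K > 1"
    and cover: "\<forall>B>0. \<exists>C>0. \<forall>n. \<exists>\<T>. near_integer_cover p \<rho> \<delta> L \<theta> B C n \<T>"
  shows "\<exists>C>0. \<forall>n. \<exists>\<T>. finite \<T> \<and> resonant_set l \<rho> \<delta> K (n + degree p) \<subseteq> \<Union>\<T> \<and>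
    (\<forall>T\<in>\<T>. bounded T \<and> diameter T \<le> C * inverse (L ^ n)) \<and> real (card \<T>) \<le> C * L powr (\<theta> * n)"
proof -
  let ?m = "degree p" and ?d = "CARD('a)"
  define B where "B = K * (1 + (\<Sum>i<?m. norm (l i)))"
  have sl: "(\<Sum>i<?m. norm (l i)) \<ge> 0" by (intro sum_nonneg) auto
  then have B: "B > 0" using K by (simp add: B_def add_pos_nonneg)
  obtain C where C: "C > 0" and cov: "\<forall>n. \<exists>\<T>. near_integer_cover p \<rho> \<delta> L \<theta> B C n \<T>"
    using cover[rule_format, OF B] by (elim exE conjE) (rule that)
  define \<beta> where "\<beta> = (\<Sum>a\<in>UNIV. \<Sum>i<?m. \<bar>b a i\<bar>)"
  have \<beta>: "(\<Sum>i<?m. \<bar>b a i\<bar>) \<le> \<beta>" for a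
    unfolding \<beta>_def by (intro member_le_sum[of a UNIV "\<lambda>a. \<Sum>i<?m. \<bar>b a i\<bar>"]) (auto intro: sum_nonneg)
  have \<beta>0: "\<beta> \<ge> 0" unfolding \<beta>_def by (intro sum_nonneg) auto
  define C' where "C' = C + ?d * (K * (1 + ?d) * (\<beta> * C))"
  have CC': "C \<le> C'" "?d * (K * (1 + ?d) * (\<beta> * C)) \<le> C'"
    using C K \<beta>0 by (auto simp: C'_def intro!: mult_nonneg_nonneg)
  have main: "\<exists>\<T>. finite \<T> \<and> resonant_set l \<rho> \<delta> K (n + ?m) \<subseteq> \<Union>\<T> \<and>
    (\<forall>T\<in>\<T>. bounded T \<and> diameter T \<le> C' * inverse (L ^ n)) \<and> real (card \<T>) \<le> C' * L powr (\<theta> * n)" for n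
  proof -
    have Ln: "inverse (L ^ n) \<ge> 0" using L by simp
    obtain \<T> where \<T>: "finite \<T>" "real (card \<T>) \<le> C * L powr (\<theta> * n)"
       "{t. lin_rec p t \<and> (\<forall>i<?m. \<bar>t i\<bar> \<le> B) \<and>
         real (card (far_indices \<rho> (n + ?m) t)) \<le> \<delta> * (n + ?m)} \<subseteq> \<Union>\<T>"
       and close: "\<forall>T\<in>\<T>. \<forall>t\<in>T. \<forall>t'\<in>T. \<forall>i<?m. \<bar>t i - t' i\<bar> \<le> C * inverse (L ^ n)"
      using cov[rule_format, of n] unfolding near_integer_cover_def by (elim exE conjE) (rule that)
    define cell where "cell = (\<lambda>T. {s \<in> open_simplex. \<exists>w. 1 / K \<le> w \<and> w \<le> K \<and> (\<lambda>k. w * (s \<bullet> l k)) \<in> T})"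
    have "resonant_set l \<rho> \<delta> K (n + ?m) \<subseteq> \<Union>(cell ` \<T>)"
    proof
      fix s assume "s \<in> resonant_set l \<rho> \<delta> K (n + ?m)"
      then obtain w where s: "s \<in> open_simplex" and w: "1 / K \<le> w" "w \<le> K"
        and far: "real (card (far_indices \<rho> (n + ?m) (\<lambda>k. w * (s \<bullet> l k)))) \<le> \<delta> * (n + ?m)"
        by (auto simp: resonant_set_def)
      have w0: "w > 0" using w(1) K by (meson divide_pos_pos less_le_trans zero_less_one less_trans)
      have "\<bar>w * (s \<bullet> l i)\<bar> \<le> B" if "i < ?m" for i
      proof -
        have "\<bar>s \<bullet> l i\<bar> \<le> norm s * norm (l i)" by (rule Cauchy_Schwarz_ineq2)
        also have "\<dots> \<le> 1 * norm (l i)" using open_simplex_norm_le[OF s] by (intro mult_right_mono) auto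
        also have "norm (l i) \<le> (\<Sum>i<?m. norm (l i))"
          using that by (intro member_le_sum[of i "{..<?m}" "\<lambda>i. norm (l i)"]) auto
        finally have "\<bar>s \<bullet> l i\<bar> \<le> 1 + (\<Sum>i<?m. norm (l i))" by simp
        then show ?thesis unfolding abs_mult B_def using w w0 by (intro mult_mono) auto
      qed
      then have "(\<lambda>k. w * (s \<bullet> l k)) \<in> \<Union>\<T>"
        using far lin_rec_inner[OF rec] by (intro subsetD[OF \<T>(3)]) simp
      then show "s \<in> \<Union>(cell ` \<T>)" using s w by (auto simp: cell_def)
    qed
    moreover have "finite (cell ` \<T>)" using \<T>(1) by simp
    moreover have "bounded (cell T)" for T
      by (rule bounded_subset[of "cball 0 1"]) (auto simp: cell_def open_simplex_norm_le)
    moreover have "diameter (cell T) \<le> C' * inverse (L ^ n)" if T: "T \<in> \<T>" for T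
    proof (rule diameter_le)
      show "cell T \<noteq> {} \<or> 0 \<le> C' * inverse (L ^ n)" using C CC' Ln by simp
      fix s s' assume "s \<in> cell T" "s' \<in> cell T"
      then obtain w w' where s: "s \<in> open_simplex" "s' \<in> open_simplex" and w: "1 / K \<le> w"
        and t: "(\<lambda>k. w * (s \<bullet> l k)) \<in> T" "(\<lambda>k. w' * (s' \<bullet> l k)) \<in> T"
        by (auto simp: cell_def)
      have "\<bar>w * s $ a - w' * s' $ a\<bar> \<le> \<beta> * C * inverse (L ^ n)" for a
      proof -
        have "w * s $ a - w' * s' $ a = (\<Sum>i<?m. b a i * (w * (s \<bullet> l i) - w' * (s' \<bullet> l i)))"
          by (subst span[of s], subst span[of s'])
            (simp add: sum_distrib_left right_diff_distrib sum_subtractf mult_ac)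
        also have "\<bar>\<dots>\<bar> \<le> (\<Sum>i<?m. \<bar>b a i\<bar> * (C * inverse (L ^ n)))"
        proof (rule order.trans[OF sum_abs sum_mono])
          fix i assume "i \<in> {..<?m}"
          then have "\<bar>w * (s \<bullet> l i) - w' * (s' \<bullet> l i)\<bar> \<le> C * inverse (L ^ n)"
            using close[rule_format, OF T t, of i] by simp
          then show "\<bar>b a i * (w * (s \<bullet> l i) - w' * (s' \<bullet> l i))\<bar> \<le> \<bar>b a i\<bar> * (C * inverse (L ^ n))"
            unfolding abs_mult by (intro mult_left_mono) auto
        qed
        also have "\<dots> = (\<Sum>i<?m. \<bar>b a i\<bar>) * (C * inverse (L ^ n))" by (simp add: sum_distrib_right)
        also have "\<dots> \<le> \<beta> * (C * inverse (L ^ n))" using \<beta>[of a] C Ln by (intro mult_right_mono) auto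
        finally show ?thesis by (simp only: mult.assoc)
      qed
      then have "dist s s' \<le> ?d * (K * (1 + ?d) * (\<beta> * C * inverse (L ^ n)))"
        using K by (intro open_simplex_normalize_lipschitz[OF s w]) auto
      also have "\<dots> = ?d * (K * (1 + ?d) * (\<beta> * C)) * inverse (L ^ n)" by (simp only: mult.assoc)
      also have "\<dots> \<le> C' * inverse (L ^ n)" using CC' Ln by (intro mult_right_mono) auto
      finally show "norm (s - s') \<le> C' * inverse (L ^ n)" by (simp add: dist_norm)
    qed
    moreover have "real (card (cell ` \<T>)) \<le> C' * L powr (\<theta> * n)"
    proof -
      have "real (card (cell ` \<T>)) \<le> real (card \<T>)" using card_image_le[OF \<T>(1)] by simp
      also have "\<dots> \<le> C * L powr (\<theta> * n)" by (rule \<T>(2))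
      also have "\<dots> \<le> C' * L powr (\<theta> * n)" using CC' by (intro mult_right_mono) auto
      finally show ?thesis .
    qed
    ultimately show ?thesis by (intro exI[of _ "cell ` \<T>"] conjI) auto
  qed
  have "C' > 0" using C CC' by linarith
  then show ?thesis using main by (intro exI[of _ C']) simp
qed


proposition exceptional_set:
  fixes l :: "nat \<Rightarrow> real ^ 'a" and p :: "real poly" and \<eta> :: real
  assumes card: "card (char_roots p) = degree p" and q: "card (stable_roots p) < degree p"
    and monic: "lead_coeff p = 1" and \<eta>: "\<eta> > 0"
    and rec: "\<And>a. lin_rec p (\<lambda>k. l k $ a)"
    and span: "\<And>y a. y $ a = (\<Sum>i<degree p. b a i * (y \<bullet> l i))"
  obtains \<rho> \<delta> :: real and E where "\<rho> > 0" "\<delta> > 0" "E \<subseteq> open_simplex"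
    "hausdorff_dim E \<le> ennreal (card (stable_roots p) + \<eta>)"
    "\<forall>s\<in>open_simplex - E. \<forall>B>1. \<exists>N\<^sub>0. \<forall>N\<ge>N\<^sub>0. \<forall>w. 1 / B \<le> \<bar>w\<bar> \<and> \<bar>w\<bar> \<le> B \<longrightarrow>
       \<delta> * N < card (far_indices \<rho> N (\<lambda>k. w * (s \<bullet> l k)))"
proof -
  let ?q = "card (stable_roots p)"
  \<comment> \<open>One half of \<eta> goes into the number of pieces; the other half makes the sum
    over the levels a convergent geometric series.\<close>
  obtain L \<rho> \<delta> :: real where L: "L > 1" and \<rho>: "\<rho> > 0" and \<delta>: "\<delta> > 0"
    and cover: "\<forall>B>0. \<exists>C>0. \<forall>n. \<exists>\<T>. near_integer_cover p \<rho> \<delta> L (?q + \<eta> / 2) B C n \<T>"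
    by (rule Erdos_Kahane_cover[OF card q monic half_gt_zero[OF \<eta>]])
  let ?R = "resonant_set l \<rho> \<delta>"
  \<comment> \<open>The limsup of the resonant sets for the range K = k + 2. The 2 keeps K above 1,
    and countably many k exhaust all B.\<close>
  define F where "F = (\<lambda>k. \<Inter>N. \<Union>n. ?R (real (k + 2)) (n + N + degree p))"
  have null: "hausdorff_measure (?q + \<eta>) (F k) = 0" for k
  proof -
    have "real (k + 2) > 1" by simp
    from resonant_set_cover[OF rec span L this cover]
    obtain C where C: "C > 0" and cov: "\<forall>n. \<exists>\<T>. finite \<T> \<and> ?R (real (k + 2)) (n + degree p) \<subseteq> \<Union>\<T> \<and>
      (\<forall>T\<in>\<T>. bounded T \<and> diameter T \<le> C * inverse (L ^ n)) \<and> real (card \<T>) \<le> C * L powr ((?q + \<eta> / 2) * n)"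
      by (elim exE conjE) (rule that)
    show ?thesis
    proof (rule hausdorff_measure_limsup_eq_0)
      fix n
      from cov[rule_format, of n] obtain \<T> where \<T>: "finite \<T>" "?R (real (k + 2)) (n + degree p) \<subseteq> \<Union>\<T>"
        "\<forall>T\<in>\<T>. bounded T \<and> diameter T \<le> C * inverse (L ^ n)" "real (card \<T>) \<le> C * L powr ((?q + \<eta> / 2) * n)"
        by (elim exE conjE) (rule that)
      have "inverse (L ^ n) = L powr (- real n)" using L by (simp add: powr_minus powr_realpow)
      then have "card \<T> * (C * inverse (L ^ n)) powr (?q + \<eta>) = card \<T> * (C powr (?q + \<eta>) * L powr (- real n * (?q + \<eta>)))"
        using C L by (simp add: powr_mult powr_powr)
      also have "\<dots> \<le> C * L powr ((?q + \<eta> / 2) * n) * (C powr (?q + \<eta>) * L powr (- real n * (?q + \<eta>)))"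
        using \<T>(4) by (intro mult_right_mono) auto
      also have "\<dots> = C * C powr (?q + \<eta>) * (L powr ((?q + \<eta> / 2) * n) * L powr (- real n * (?q + \<eta>)))"
        by (simp only: mult_ac)
      also have "L powr ((?q + \<eta> / 2) * n) * L powr (- real n * (?q + \<eta>)) = L powr (- \<eta> / 2 * real n)"
      proof -
        have "(?q + \<eta> / 2) * real n + - real n * (?q + \<eta>) = - \<eta> / 2 * real n" by (simp add: algebra_simps)
        then show ?thesis by (simp only: powr_add[symmetric])
      qed
      also have "L powr (- \<eta> / 2 * real n) = (L powr (- \<eta> / 2)) ^ n"
        using L powr_realpow[of "L powr (- \<eta> / 2)" n] by (simp add: powr_powr)
      finally show "\<exists>\<T>. finite \<T> \<and> ?R (real (k + 2)) (n + degree p) \<subseteq> \<Union>\<T> \<and>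
        (\<forall>T\<in>\<T>. bounded T \<and> diameter T \<le> C * inverse (L ^ n)) \<and>
        card \<T> * (C * inverse (L ^ n)) powr (?q + \<eta>) \<le> C * C powr (?q + \<eta>) * (L powr (- \<eta> / 2)) ^ n"
        using \<T>(1-3) by (intro exI[of _ \<T>] conjI)
    next
      have "L powr (- \<eta> / 2) < 1" using L \<eta> by (simp add: powr_less_one)
      then show "summable (\<lambda>n. C * C powr (?q + \<eta>) * (L powr (- \<eta> / 2)) ^ n)"
        by (intro summable_mult summable_geometric) simp
      have "(\<lambda>n. C * inverse (L ^ n)) \<longlonglongrightarrow> C * 0"
        by (intro tendsto_mult tendsto_const LIMSEQ_inverse_realpow_zero L)
      then show "(\<lambda>n. C * inverse (L ^ n)) \<longlonglongrightarrow> 0" by simp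
      show "0 \<le> C * inverse (L ^ n)" for n using C L by simp
      show "0 < ?q + \<eta>" using \<eta> by simp
      show "F k \<subseteq> (\<Union>n. ?R (real (k + 2)) (n + N + degree p))" for N by (auto simp: F_def)
    qed
  qed
  have dim: "hausdorff_dim (\<Union>k. F k) \<le> ennreal (?q + \<eta>)"
    using \<eta> by (intro hausdorff_dim_le hausdorff_measure_UN_eq_0 null) auto
  have sub: "(\<Union>k. F k) \<subseteq> open_simplex" by (auto simp: F_def resonant_set_def)
  have "\<exists>N\<^sub>0. \<forall>N\<ge>N\<^sub>0. \<forall>w. 1 / B \<le> \<bar>w\<bar> \<and> \<bar>w\<bar> \<le> B \<longrightarrow>
       \<delta> * N < card (far_indices \<rho> N (\<lambda>k. w * (s \<bullet> l k)))"
    if s: "s \<in> open_simplex - (\<Union>k. F k)" and B: "B > 1" for s B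
  proof -
    obtain k :: nat where k: "B \<le> real k" using real_arch_simple by blast
    have "s \<notin> F k" using s by blast
    then obtain N1 where N1: "\<And>n. s \<notin> ?R (real (k + 2)) (n + N1 + degree p)" by (auto simp: F_def)
    have "\<delta> * N < card (far_indices \<rho> N (\<lambda>k. w * (s \<bullet> l k)))"
      if N: "N \<ge> N1 + degree p" and w: "1 / B \<le> \<bar>w\<bar>" "\<bar>w\<bar> \<le> B" for N w
    proof -
      have eq: "far_indices \<rho> N (\<lambda>k. \<bar>w\<bar> * (s \<bullet> l k)) = far_indices \<rho> N (\<lambda>k. w * (s \<bullet> l k))"
        using far_indices_minus[of \<rho> N "\<lambda>k. w * (s \<bullet> l k)"] by (cases "w \<ge> 0") auto
      have "1 / real (k + 2) \<le> 1 / B" using k B by (intro divide_left_mono) auto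
      then have "1 / real (k + 2) \<le> \<bar>w\<bar>" "\<bar>w\<bar> \<le> real (k + 2)" using w k by linarith+
      moreover have "s \<notin> ?R (real (k + 2)) N" using N1[of "N - N1 - degree p"] N by simp
      ultimately show ?thesis using s unfolding resonant_set_def eq[symmetric] by force
    qed
    then show ?thesis by (intro exI[of _ "N1 + degree p"]) simp
  qed
  then show thesis by (intro that[OF \<rho> \<delta> sub dim] ballI allI impI)
qed

section \<open>Words and twisted sums\<close>

definition subst_iter :: "('a \<Rightarrow> 'a list) \<Rightarrow> nat \<Rightarrow> 'a list \<Rightarrow> 'a list" where
  "subst_iter \<zeta> n = subst_word \<zeta> ^^ n"

lemma subst_iter_0 [simp]: "subst_iter \<zeta> 0 w = w"
  by (simp add: subst_iter_def)

lemma subst_iter_Suc: "subst_iter \<zeta> (Suc n) w = subst_word \<zeta> (subst_iter \<zeta> n w)"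
  by (simp add: subst_iter_def)

lemma subst_iter_add: "subst_iter \<zeta> (n + k) w = subst_iter \<zeta> n (subst_iter \<zeta> k w)"
  by (simp add: subst_iter_def funpow_add)

lemma subst_iter_append: "subst_iter \<zeta> n (u @ v) = subst_iter \<zeta> n u @ subst_iter \<zeta> n v"
  by (induction n) (simp_all add: subst_iter_Suc subst_word_def)

lemma subst_iter_Nil [simp]: "subst_iter \<zeta> n [] = []"
  by (induction n) (simp_all add: subst_iter_Suc subst_word_def)

lemma subst_iter_Cons: "subst_iter \<zeta> n (b # w) = subst_iter \<zeta> n [b] @ subst_iter \<zeta> n w"
  using subst_iter_append[of \<zeta> n "[b]" w] by simp

lemma subst_iter_concat: "subst_iter \<zeta> n w = concat (map (\<lambda>b. subst_iter \<zeta> n [b]) w)"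
  by (induction w) (simp, subst subst_iter_Cons, simp)

lemma count_list_subst_word:
  "count_list (subst_word \<zeta> w) i = (\<Sum>j\<in>(UNIV :: 'a::finite set). count_list (\<zeta> j) i * count_list w j)"
proof (induction w)
  case (Cons b w)
  have "(\<Sum>j\<in>UNIV. count_list (\<zeta> j) i * count_list (b # w) j)
      = (\<Sum>j\<in>UNIV. count_list (\<zeta> j) i * count_list w j + (if j = b then count_list (\<zeta> j) i else 0))"
    by (intro sum.cong) auto
  then show ?case using Cons by (simp add: subst_word_def sum.distrib)
qed (simp add: subst_word_def)

lemma subst_matrix_power:
  fixes \<zeta> :: "'a::finite \<Rightarrow> 'a list"
  shows "(((**) (subst_matrix \<zeta> :: nat ^ 'a ^ 'a)) ^^ n) (mat 1) $ i $ j = count_list (subst_iter \<zeta> n [j]) i"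
proof (induction n arbitrary: i)
  case 0
  then show ?case by (simp add: mat_def)
next
  case (Suc n)
  let ?S = "subst_matrix \<zeta> :: nat ^ 'a ^ 'a"
  have "((**) ?S ^^ Suc n) (mat 1) $ i $ j = (\<Sum>k\<in>UNIV. ?S $ i $ k * (((**) ?S ^^ n) (mat 1) $ k $ j))"
    by (simp add: matrix_matrix_mult_def)
  then show ?case
    unfolding Suc by (simp add: subst_iter_Suc count_list_subst_word subst_matrix_def)
qed

lemma subst_matrix_vector_power:
  fixes \<zeta> :: "'a::finite \<Rightarrow> 'a list"
  shows "(((*v) (subst_matrix \<zeta> :: 'b::comm_ring_1 ^ 'a ^ 'a)) ^^ n) (\<chi> a. of_nat (count_list w a))
    = (\<chi> a. of_nat (count_list (subst_iter \<zeta> n w) a))"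
proof (induction n)
  case (Suc n)
  then show ?case
    by (simp add: subst_iter_Suc count_list_subst_word matrix_vector_mult_def subst_matrix_def vec_eq_iff)
qed simp

lemma set_subst_iter: "x \<in> set (subst_iter \<zeta> n w) \<longleftrightarrow> (\<exists>b\<in>set w. x \<in> set (subst_iter \<zeta> n [b]))"
  by (subst subst_iter_concat) auto

lemma sublist_subst_iter:
  assumes "b \<in> set w"
  shows "sublist (subst_iter \<zeta> n [b]) (subst_iter \<zeta> n w)"
proof -
  obtain u v where "w = u @ [b] @ v" using split_list[OF assms] by auto
  then show ?thesis by (simp add: subst_iter_append subst_iter_Cons[of \<zeta> n b v] sublist_appendI)
qed

section \<open>Growth of the images of letters, and return words\<close>

definition max_length :: "('a::finite \<Rightarrow> 'a list) \<Rightarrow> nat \<Rightarrow> nat" where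
  "max_length \<zeta> n = Max (range (\<lambda>b. length (subst_iter \<zeta> n [b])))"

lemma length_le_max_length: "length (subst_iter \<zeta> n [b]) \<le> max_length \<zeta> n"
  unfolding max_length_def by (rule Max_ge) auto

lemma max_length_le: "(\<And>b. length (subst_iter \<zeta> n [b]) \<le> k) \<Longrightarrow> max_length \<zeta> n \<le> k"
  unfolding max_length_def by (subst Max_le_iff) auto

lemma length_subst_iter_le: "length (subst_iter \<zeta> n w) \<le> max_length \<zeta> n * length w"
proof (induction w)
  case (Cons b w)
  then show ?case
    using length_le_max_length[of \<zeta> n b] by (subst subst_iter_Cons) simp
qed simp

lemma max_length_add: "max_length \<zeta> (n + k) \<le> max_length \<zeta> n * max_length \<zeta> k"
proof (rule max_length_le)
  fix b
  have "length (subst_iter \<zeta> (n + k) [b]) \<le> max_length \<zeta> n * length (subst_iter \<zeta> k [b])"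
    unfolding subst_iter_add by (rule length_subst_iter_le)
  also have "\<dots> \<le> max_length \<zeta> n * max_length \<zeta> k"
    by (rule mult_left_mono[OF length_le_max_length]) simp
  finally show "length (subst_iter \<zeta> (n + k) [b]) \<le> max_length \<zeta> n * max_length \<zeta> k" .
qed

lemma max_length_power: "max_length \<zeta> n \<le> max_length \<zeta> 1 ^ n"
proof (induction n)
  case 0
  then show ?case by (intro max_length_le) simp
next
  case (Suc n)
  have "max_length \<zeta> (1 + n) \<le> max_length \<zeta> 1 * max_length \<zeta> n" by (rule max_length_add)
  also have "\<dots> \<le> max_length \<zeta> 1 * max_length \<zeta> 1 ^ n" using Suc by (intro mult_left_mono) auto
  finally show ?case by simp
qed

lemma length_subst_word_ge:
  assumes "substitution \<zeta>"
  shows "length w \<le> length (subst_word \<zeta> w)"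
proof (induction w)
  case (Cons b w)
  have "\<zeta> b \<noteq> []" using assms by (simp add: substitution_def)
  then have "1 \<le> length (\<zeta> b)" by (simp add: Suc_le_eq)
  then show ?case using Cons unfolding subst_word_def by simp
qed (simp add: subst_word_def)

lemma length_subst_iter_mono:
  assumes "substitution \<zeta>" "n \<le> k"
  shows "length (subst_iter \<zeta> n w) \<le> length (subst_iter \<zeta> k w)"
  using assms(2)
  by (induction k rule: dec_induct)
    (auto simp: subst_iter_Suc intro: order.trans[OF _ length_subst_word_ge[OF assms(1)]])

lemma max_length_mono:
  assumes "substitution \<zeta>" "n \<le> k"
  shows "max_length \<zeta> n \<le> max_length \<zeta> k"
  by (rule max_length_le) (rule order.trans[OF length_subst_iter_mono[OF assms] length_le_max_length])

text \<open>Three rounds of a positive power. The first image of c contains the whole alphabet, so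
  it has two letters; the second therefore contains c twice; the third puts this stretch into the
  image of every letter. The return word is \<open>c # v\<close>, where v may be empty.\<close>

lemma primitive_common_return_word:
  fixes \<zeta> :: "'a::finite \<Rightarrow> 'a list"
  assumes "primitive \<zeta>" "CARD('a) \<ge> 2"
  obtains n c v where "n \<ge> 1" "\<forall>a b. a \<in> set (subst_iter \<zeta> n [b])"
    "\<forall>b. \<exists>x y. subst_iter \<zeta> n [b] = x @ [c] @ v @ [c] @ y"
proof -
  obtain n where n: "n \<ge> 1" and pos: "\<forall>i j. (((**) (subst_matrix \<zeta> :: nat ^ 'a ^ 'a)) ^^ n) (mat 1) $ i $ j > 0"
    using assms(1) unfolding primitive_def by blast
  have all: "a \<in> set (subst_iter \<zeta> n [b])" for a b
    using pos unfolding subst_matrix_power by (metis count_notin less_irrefl)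
  have two: "a \<in> set (subst_iter \<zeta> (n + n) [b])" for a b
    unfolding subst_iter_add set_subst_iter[of a \<zeta> n "subst_iter \<zeta> n [b]"] using all by blast
  have three: "a \<in> set (subst_iter \<zeta> (n + n + n) [b])" for a b
    unfolding subst_iter_add[of \<zeta> "n + n" n] set_subst_iter[of a \<zeta> "n + n" "subst_iter \<zeta> n [b]"]
    using all two by blast
  fix c :: 'a
  have "card (set (subst_iter \<zeta> n [c])) = CARD('a)" using all by (metis UNIV_eq_I)
  then have "length (subst_iter \<zeta> n [c]) \<ge> 2"
    using assms(2) card_length[of "subst_iter \<zeta> n [c]"] by linarith
  then obtain d e r where der: "subst_iter \<zeta> n [c] = d # e # r"
    by (cases "subst_iter \<zeta> n [c]") (auto simp: Suc_le_length_iff)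
  obtain p1 q1 where 1: "subst_iter \<zeta> n [d] = p1 @ c # q1" using split_list[OF all] by blast
  obtain p2 q2 where 2: "subst_iter \<zeta> n [e] = p2 @ c # q2" using split_list[OF all] by blast
  have "subst_iter \<zeta> (n + n) [c] = subst_iter \<zeta> n [d] @ subst_iter \<zeta> n [e] @ subst_iter \<zeta> n r"
    unfolding subst_iter_add der subst_iter_Cons[of \<zeta> n d "e # r"] subst_iter_Cons[of \<zeta> n e r] ..
  then have c: "subst_iter \<zeta> (n + n) [c] = p1 @ [c] @ (q1 @ p2) @ [c] @ (q2 @ subst_iter \<zeta> n r)"
    unfolding 1 2 by simp
  have "\<exists>x y. subst_iter \<zeta> (n + n + n) [b] = x @ [c] @ (q1 @ p2) @ [c] @ y" for b
  proof -
    obtain u w where "subst_iter \<zeta> n [b] = u @ c # w" using split_list[OF all] by blast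
    then have "subst_iter \<zeta> (n + n + n) [b] =
      subst_iter \<zeta> (n + n) u @ subst_iter \<zeta> (n + n) [c] @ subst_iter \<zeta> (n + n) w"
      unfolding subst_iter_add[of \<zeta> "n + n" n]
      by (simp only: subst_iter_append subst_iter_Cons[of \<zeta> "n + n" c w])
    then have "subst_iter \<zeta> (n + n + n) [b] = (subst_iter \<zeta> (n + n) u @ p1) @ [c] @ (q1 @ p2) @ [c]
        @ (q2 @ subst_iter \<zeta> n r) @ subst_iter \<zeta> (n + n) w"
      unfolding c by (simp only: append_assoc)
    then show ?thesis by blast
  qed
  moreover have "n + n + n \<ge> 1" using n by simp
  ultimately show thesis using three by (intro that[of "n + n + n" c "q1 @ p2"]) blast+
qed


text \<open>Such a factor is a run of whole blocks between two cut ones, or lies inside a single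
  block; A bounds what is left over at either end.\<close>

lemma sublist_concat_map_decompose:
  assumes A: "\<And>b. length (f b) \<le> A" and "sublist u (concat (map f w))"
  obtains p w' q where "u = p @ concat (map f w') @ q" "length p \<le> A" "length q \<le> A"
proof -
  have pre: "\<exists>w' q. u = concat (map f w') @ q \<and> length q \<le> A" if "prefix u (concat (map f w))" for u w
    using that
  proof (induction w arbitrary: u)
    case Nil
    then show ?case by (intro exI[of _ "[]"]) simp
  next
    case (Cons b w)
    then consider "prefix u (f b)" | v where "u = f b @ v" "prefix v (concat (map f w))"
      by (auto simp: prefix_append)
    then show ?case
    proof cases
      case 1
      then have "length u \<le> A" using A[of b] prefix_length_le[of u "f b"] by linarith
      then show ?thesis by (intro exI[of _ "[]"] exI[of _ u]) simp
    next
      case 2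
      obtain w' q where "v = concat (map f w') @ q" "length q \<le> A" using Cons.IH[OF 2(2)] by blast
      then show ?thesis using 2(1) by (intro exI[of _ "b # w'"] exI[of _ q]) simp
    qed
  qed
  have "\<exists>p w' q. u = p @ concat (map f w') @ q \<and> length p \<le> A \<and> length q \<le> A"
    using assms(2)
  proof (induction w)
    case Nil
    then show ?case by (intro exI[of _ "[]"]) simp
  next
    case (Cons b w)
    then consider "sublist u (f b)" | "sublist u (concat (map f w))"
      | x y where "u = x @ y" "suffix x (f b)" "prefix y (concat (map f w))"
      by (auto simp: sublist_append)
    then show ?case
    proof cases
      case 1
      then have "length u \<le> A" using A[of b] sublist_length_le[of u "f b"] by linarith
      then show ?thesis by (intro exI[of _ u] exI[of _ "[]"]) simp
    next
      case 3
      obtain w' q where "y = concat (map f w') @ q" "length q \<le> A" using pre[OF 3(3)] by blast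
      moreover have "length x \<le> A" using 3(2) A[of b] suffix_length_le[of x "f b"] by linarith
      ultimately show ?thesis using 3(1) by blast
    qed (rule Cons.IH)
  qed
  then show thesis by (elim exE conjE) (rule that)
qed

text \<open>Unfolded, this is the sum, over the positions of the letter a, of e^(-2 \<pi> i \<omega>
  h) with h the \<open>flow_length\<close> of the prefix before that position.\<close>

fun exp_sum :: "real ^ 'a \<Rightarrow> 'a \<Rightarrow> real \<Rightarrow> 'a list \<Rightarrow> complex" where
  "exp_sum s a \<omega> [] = 0"
| "exp_sum s a \<omega> (b # w) = (if b = a then 1 else 0) + cis (- 2 * pi * \<omega> * s $ b) * exp_sum s a \<omega> w"

definition flow_length :: "real ^ 'a \<Rightarrow> 'a list \<Rightarrow> real" where
  "flow_length s w = (\<Sum>b\<leftarrow>w. s $ b)"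

lemma flow_length_simps [simp]:
  "flow_length s [] = 0" "flow_length s (b # w) = s $ b + flow_length s w"
  "flow_length s (u @ v) = flow_length s u + flow_length s v"
  by (simp_all add: flow_length_def)

lemma flow_length_inner: "flow_length s w = s \<bullet> (\<chi> a. of_nat (count_list w a))"
proof (induction w)
  case (Cons b w)
  have "s \<bullet> (\<chi> a. of_nat (count_list (b # w) a)) = (\<Sum>a\<in>UNIV. s $ a * count_list w a + (if a = b then s $ a else 0))"
    unfolding inner_vec_def by (intro sum.cong) (auto simp: algebra_simps)
  also have "\<dots> = flow_length s w + s $ b"
    unfolding Cons inner_vec_def by (simp add: sum.distrib)
  finally show ?case by simp
qed (simp add: inner_vec_def)

lemma exp_sum_append:
  "exp_sum s a \<omega> (u @ v) = exp_sum s a \<omega> u + cis (- 2 * pi * \<omega> * flow_length s u) * exp_sum s a \<omega> v"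
  by (induction u) (simp_all add: distrib_left cis_mult mult.assoc[symmetric])

lemma norm_exp_sum_append_le:
  "norm (exp_sum s a \<omega> (u @ v)) \<le> norm (exp_sum s a \<omega> u) + norm (exp_sum s a \<omega> v)"
  unfolding exp_sum_append by (rule order.trans[OF norm_triangle_ineq]) (simp add: norm_mult)

lemma norm_exp_sum_le: "norm (exp_sum s a \<omega> w) \<le> length w"
proof (induction w)
  case (Cons b w)
  have "norm (exp_sum s a \<omega> (b # w)) \<le> norm (if b = a then 1 else 0 :: complex) + norm (exp_sum s a \<omega> w)"
    unfolding exp_sum.simps by (rule order.trans[OF norm_triangle_ineq]) (simp add: norm_mult)
  also have "\<dots> \<le> 1 + real (length w)" using Cons by (intro add_mono) auto
  finally show ?case by simp
qed simp

text \<open>A bound relative to the length is additive under concatenation, so it passes from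
  letters to words with the same D.\<close>

lemma norm_exp_sum_subst_iter_le:
  fixes D :: real
  assumes "\<And>b. norm (exp_sum s a \<omega> (subst_iter \<zeta> n [b])) \<le> D * length (subst_iter \<zeta> n [b])"
  shows "norm (exp_sum s a \<omega> (subst_iter \<zeta> n w)) \<le> D * length (subst_iter \<zeta> n w)"
proof (induction w)
  case (Cons b w)
  have "norm (exp_sum s a \<omega> (subst_iter \<zeta> n (b # w)))
    \<le> norm (exp_sum s a \<omega> (subst_iter \<zeta> n [b])) + norm (exp_sum s a \<omega> (subst_iter \<zeta> n w))"
    by (subst subst_iter_Cons) (rule norm_exp_sum_append_le)
  also have "\<dots> \<le> D * length (subst_iter \<zeta> n [b]) + D * length (subst_iter \<zeta> n w)"
    using Cons assms by (intro add_mono)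
  also have "\<dots> = D * length (subst_iter \<zeta> n (b # w))"
    using subst_iter_Cons[of \<zeta> n b w] by (simp add: distrib_left)
  finally show ?case .
qed simp

text \<open>By the half-angle formula the norm is \<open>2 * \<bar>cos (pi * x)\<bar>\<close>, which
  has period 1 and thus depends only on the distance to the integers.\<close>

lemma norm_one_plus_cis_le:
  assumes "\<rho> \<le> int_dist x" "0 \<le> \<rho>"
  shows "norm (1 + cis (- 2 * pi * x)) \<le> 2 * cos (pi * \<rho>)"
proof -
  have "1 + cis (- 2 * pi * x) = 2 * cos (pi * x) * cis (- pi * x)"
    using cos_double_cos[of "pi * x"] sin_double[of "pi * x"]
    by (simp add: complex_eq_iff power2_eq_square mult_ac)
  then have 1: "norm (1 + cis (- 2 * pi * x)) = 2 * \<bar>cos (pi * x)\<bar>"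
    by (simp add: norm_mult)
  have "x = (x - round x) + round x" by simp
  then have "cos (pi * x) = cos (pi * (x - round x) + pi * round x)" by (simp add: algebra_simps)
  also have "\<dots> = cos (pi * (x - round x)) * cos (pi * round x)"
    by (simp add: cos_add sin_integer_2pi mult.commute[of pi] sin_times_pi_eq_0)
  finally have "\<bar>cos (pi * x)\<bar> \<le> \<bar>cos (pi * (x - round x))\<bar>"
    by (simp add: abs_mult mult_left_le)
  also have "cos (pi * (x - round x)) = cos (pi * int_dist x)"
    using cos_abs_real[of "pi * (x - round x)"] by (simp add: int_dist_def abs_mult)
  also have "\<bar>cos (pi * int_dist x)\<bar> = cos (pi * int_dist x)"
    using int_dist_le_half[of x] int_dist_nonneg[of x] by (intro abs_of_nonneg cos_ge_zero) (auto simp: field_simps intro: order.trans[OF _ mult_nonneg_nonneg])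
  also have "\<dots> \<le> cos (pi * \<rho>)"
    using assms int_dist_le_half[of x] by (intro cos_monotone_0_pi_le) (auto simp: field_simps)
  finally show ?thesis using 1 by simp
qed


text \<open>Two occurrences of the return word's first letter contribute two copies of the same sum,
  whose phases differ by the length of the image of the return word.\<close>

lemma exp_sum_return_word_gain:
  fixes D :: real
  assumes ret: "subst_iter \<zeta> L [b] = x @ [c] @ v @ [c] @ y"
    and D: "\<And>b. norm (exp_sum s a \<omega> (subst_iter \<zeta> n [b])) \<le> D * length (subst_iter \<zeta> n [b])" "D \<ge> 0"
    and far: "\<rho> \<le> int_dist (\<omega> * flow_length s (subst_iter \<zeta> n (c # v)))" and \<rho>: "0 \<le> \<rho>"
  shows "norm (exp_sum s a \<omega> (subst_iter \<zeta> (n + L) [b]))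
    \<le> D * (length (subst_iter \<zeta> (n + L) [b]) - (2 - 2 * cos (pi * \<rho>)) * length (subst_iter \<zeta> n [c]))"
proof -
  let ?I = "subst_iter \<zeta> n" and ?e = "exp_sum s a \<omega>" and ?len = "\<lambda>w. real (length (subst_iter \<zeta> n w))"
  have eq: "subst_iter \<zeta> (n + L) [b] = ?I x @ ?I [c] @ ?I v @ ?I [c] @ ?I y"
    unfolding subst_iter_add ret by (simp only: subst_iter_append)
  have bd: "norm (?e (?I w)) \<le> D * ?len w" for w by (rule norm_exp_sum_subst_iter_le[OF D(1)])
  let ?f = "\<lambda>u. cis (- 2 * pi * \<omega> * flow_length s u)"
  have cv: "?I (c # v) = ?I [c] @ ?I v" by (rule subst_iter_Cons)
  have "?e (?I [c] @ ?I v @ ?I [c] @ ?I y) = (1 + ?f (?I (c # v))) * ?e (?I [c])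
      + ?f (?I [c]) * ?e (?I v) + ?f (?I (c # v)) * ?f (?I [c]) * ?e (?I y)"
    by (simp add: cv exp_sum_append algebra_simps cis_mult)
  then have "norm (?e (?I [c] @ ?I v @ ?I [c] @ ?I y)) \<le> norm (1 + ?f (?I (c # v))) * norm (?e (?I [c]))
      + norm (?e (?I v)) + norm (?e (?I y))"
    using norm_triangle_ineq[of "(1 + ?f (?I (c # v))) * ?e (?I [c]) + ?f (?I [c]) * ?e (?I v)"
        "?f (?I (c # v)) * ?f (?I [c]) * ?e (?I y)"]
      norm_triangle_ineq[of "(1 + ?f (?I (c # v))) * ?e (?I [c])" "?f (?I [c]) * ?e (?I v)"]
    by (simp only: norm_mult norm_cis mult_1_left mult_1_right)
  moreover have cos: "norm (1 + ?f (?I (c # v))) \<le> 2 * cos (pi * \<rho>)"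
    using norm_one_plus_cis_le[OF far \<rho>] by (simp add: mult.assoc)
  then have "norm (1 + ?f (?I (c # v))) * norm (?e (?I [c])) \<le> 2 * cos (pi * \<rho>) * (D * ?len [c])"
    by (intro mult_mono bd order.trans[OF norm_ge_zero cos] norm_ge_zero)
  ultimately have "norm (?e (?I [c] @ ?I v @ ?I [c] @ ?I y)) \<le> 2 * cos (pi * \<rho>) * (D * ?len [c])
      + D * ?len v + D * ?len y"
    using bd[of v] bd[of y] by linarith
  then have "norm (?e (subst_iter \<zeta> (n + L) [b])) \<le> D * ?len x + (2 * cos (pi * \<rho>) * (D * ?len [c])
      + D * ?len v + D * ?len y)"
    unfolding eq using norm_exp_sum_append_le[of s a \<omega> "?I x" "?I [c] @ ?I v @ ?I [c] @ ?I y"] bd[of x] by linarith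
  also have "\<dots> = D * (length (subst_iter \<zeta> (n + L) [b]) - (2 - 2 * cos (pi * \<rho>)) * length (subst_iter \<zeta> n [c]))"
    unfolding eq by (simp add: algebra_simps)
  finally show ?thesis .
qed

text \<open>Images of different letters have comparable length: for n > L the n-th image of c
  contains the (n - L)-th image of every letter, and L further steps multiply lengths by at most
  \<open>max_length \<zeta> L\<close>.\<close>

lemma max_length_le_length:
  assumes sub: "substitution \<zeta>" and all: "\<forall>a b. a \<in> set (subst_iter \<zeta> L [b])"
  shows "max_length \<zeta> n \<le> max_length \<zeta> L * length (subst_iter \<zeta> n [c])"
proof (cases "n \<le> L")
  case True
  have "length (subst_iter \<zeta> 0 [c]) \<le> length (subst_iter \<zeta> n [c])"
    by (rule length_subst_iter_mono[OF sub]) simp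
  then have "max_length \<zeta> L * 1 \<le> max_length \<zeta> L * length (subst_iter \<zeta> n [c])"
    by (intro mult_left_mono) auto
  then show ?thesis by (rule order.trans[rotated]) (simp add: max_length_mono[OF sub True])
next
  case False
  define k where "k = n - L"
  have n: "n = k + L" using False by (simp add: k_def)
  have "max_length \<zeta> k \<le> length (subst_iter \<zeta> n [c])"
  proof (rule max_length_le)
    fix b
    show "length (subst_iter \<zeta> k [b]) \<le> length (subst_iter \<zeta> n [c])"
      unfolding n subst_iter_add using all by (intro sublist_length_le sublist_subst_iter) blast
  qed
  then have "max_length \<zeta> L * max_length \<zeta> k \<le> max_length \<zeta> L * length (subst_iter \<zeta> n [c])"
    by (intro mult_left_mono) auto
  moreover have "max_length \<zeta> n \<le> max_length \<zeta> L * max_length \<zeta> k"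
    using max_length_add[of \<zeta> k L] unfolding n by (simp only: mult.commute)
  ultimately show ?thesis by (rule order.trans[rotated])
qed

lemma max_length_pos:
  assumes "substitution \<zeta>" shows "max_length \<zeta> n \<ge> 1"
proof -
  fix b
  have "length (subst_iter \<zeta> 0 [b]) \<le> length (subst_iter \<zeta> n [b])"
    by (rule length_subst_iter_mono[OF assms]) simp
  then show ?thesis using length_le_max_length[of \<zeta> n b] by simp
qed

text \<open>The condition \<open>k + L \<le> N\<close> keeps the levels whose gain is already felt
  at N: cancellation at level k shows in the images of level k + L.\<close>

definition far_levels :: "('a \<Rightarrow> 'a list) \<Rightarrow> real ^ 'a \<Rightarrow> 'a list \<Rightarrow> real \<Rightarrow> nat \<Rightarrow> real \<Rightarrow> nat \<Rightarrow> nat set" where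
  "far_levels \<zeta> s w \<rho> L \<omega> N = {k. k + L \<le> N \<and> \<rho> \<le> int_dist (\<omega> * flow_length s (subst_iter \<zeta> k w))}"

lemma finite_far_levels: "finite (far_levels \<zeta> s w \<rho> L \<omega> N)"
  by (rule finite_subset[of _ "{..N}"]) (auto simp: far_levels_def)

text \<open>If level N - L is far, the bound improves by a factor g on the way from N - L to N and
  the induction resumes at N - L; otherwise it descends by one level. A jump uses up at most L far
  levels, so each is credited with the L-th root of g.\<close>

lemma exp_sum_decay:
  fixes \<zeta> :: "'a::finite \<Rightarrow> 'a list" and \<rho> :: real
  assumes sub: "substitution \<zeta>" and L: "L \<ge> 1" and all: "\<forall>a b. a \<in> set (subst_iter \<zeta> L [b])"
    and ret: "\<forall>b. \<exists>x y. subst_iter \<zeta> L [b] = x @ [c] @ v @ [c] @ y" and \<rho>: "\<rho> > 0"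
  obtains \<beta> :: real where "0 < \<beta>" "\<beta> < 1" "\<forall>s a \<omega> N b. norm (exp_sum s a \<omega> (subst_iter \<zeta> N [b]))
    \<le> \<beta> ^ card (far_levels \<zeta> s (c # v) \<rho> L \<omega> N) * length (subst_iter \<zeta> N [b])"
proof -
  \<comment> \<open>The cap keeps \<open>pi * \<rho>'\<close> where the cosine is strictly
    decreasing, so that \<kappa> is positive.\<close>
  define \<rho>' where "\<rho>' = min \<rho> (1 / 2)"
  define A where "A = real (max_length \<zeta> L)"
  define \<kappa> where "\<kappa> = 2 - 2 * cos (pi * \<rho>')"
  have \<rho>': "0 < \<rho>'" "\<rho>' \<le> \<rho>" "\<rho>' \<le> 1 / 2" using \<rho> by (auto simp: \<rho>'_def)
  have A: "A \<ge> 1" using max_length_pos[OF sub, of L] by (simp add: A_def)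
  have "pi * \<rho>' \<le> pi * 1" using \<rho>' by (intro mult_left_mono) auto
  then have "cos (pi * \<rho>') < cos 0" using \<rho>' by (intro cos_monotone_0_pi) auto
  then have \<kappa>: "\<kappa> > 0" by (simp add: \<kappa>_def)
  \<comment> \<open>An image at level n + L is at most A^2 times as long as the image of c at level
    n, so the gain \<kappa> on the latter is a fixed fraction of the former. The 1/2 keeps g
    positive for the root.\<close>
  define g where "g = max (1 / 2) (1 - \<kappa> / A\<^sup>2)"
  have g: "0 < g" "g < 1" using \<kappa> A by (auto simp: g_def)
  define \<beta> where "\<beta> = root L g"
  have \<beta>L: "\<beta> ^ L = g" using L g by (simp add: \<beta>_def)
  have \<beta>: "0 < \<beta>" "\<beta> < 1" using L g by (auto simp: \<beta>_def)
  have main: "norm (exp_sum s a \<omega> (subst_iter \<zeta> N [b]))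
    \<le> \<beta> ^ card (far_levels \<zeta> s (c # v) \<rho> L \<omega> N) * length (subst_iter \<zeta> N [b])" for s a \<omega> N b
  proof (induction N arbitrary: b rule: less_induct)
    case (less N)
    let ?G = "far_levels \<zeta> s (c # v) \<rho> L \<omega>"
    consider "N < L" | "N \<ge> L" "N - L \<notin> ?G N" | "N \<ge> L" "N - L \<in> ?G N" by linarith
    then show ?case
    proof cases
      case 1
      then have "?G N = {}" by (auto simp: far_levels_def)
      then show ?thesis using norm_exp_sum_le by simp
    next
      case 2
      then obtain n where n: "N = Suc n" using L by (cases N) auto
      have "k \<noteq> N - L" if "k \<in> ?G N" for k using that 2 by blast
      then have "?G N = ?G n"
        unfolding n far_levels_def by (force simp: n)
      then show ?thesis
        using norm_exp_sum_subst_iter_le[OF less.IH[of n], of "subst_iter \<zeta> 1 [b]"]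
        unfolding n by (simp flip: subst_iter_add)
    next
      case 3
      define n where "n = N - L"
      have N: "N = n + L" using 3 by (simp add: n_def)
      define D where "D = \<beta> ^ card (?G n)"
      have D: "D \<ge> 0" using \<beta> by (simp add: D_def)
      obtain x y where xy: "subst_iter \<zeta> L [b] = x @ [c] @ v @ [c] @ y" using ret by blast
      have far: "\<rho>' \<le> int_dist (\<omega> * flow_length s (subst_iter \<zeta> n (c # v)))"
        using 3 \<rho>' by (simp add: far_levels_def n_def)
      have IH: "norm (exp_sum s a \<omega> (subst_iter \<zeta> n [b])) \<le> D * length (subst_iter \<zeta> n [b])" for b
        unfolding D_def using less.IH[of n b] N L by simp
      have gain: "norm (exp_sum s a \<omega> (subst_iter \<zeta> N [b]))
        \<le> D * (length (subst_iter \<zeta> N [b]) - \<kappa> * length (subst_iter \<zeta> n [c]))"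
        unfolding N \<kappa>_def using \<rho>' by (intro exp_sum_return_word_gain[OF xy IH D far]) simp
      have "length (subst_iter \<zeta> N [b]) \<le> max_length \<zeta> n * max_length \<zeta> L"
        using length_le_max_length[of \<zeta> N b] max_length_add[of \<zeta> n L] unfolding N by linarith
      also have "\<dots> \<le> (max_length \<zeta> L * length (subst_iter \<zeta> n [c])) * max_length \<zeta> L"
        by (intro mult_right_mono max_length_le_length[OF sub all]) simp
      finally have "real (length (subst_iter \<zeta> N [b])) \<le> A\<^sup>2 * length (subst_iter \<zeta> n [c])"
        unfolding A_def power2_eq_square by (metis (no_types, lifting) mult.assoc mult.commute of_nat_le_iff of_nat_mult)
      then have "length (subst_iter \<zeta> N [b]) * (\<kappa> / A\<^sup>2) \<le> A\<^sup>2 * length (subst_iter \<zeta> n [c]) * (\<kappa> / A\<^sup>2)"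
        using \<kappa> by (intro mult_right_mono) auto
      also have "\<dots> = \<kappa> * length (subst_iter \<zeta> n [c])" using A by simp
      finally have "length (subst_iter \<zeta> N [b]) - \<kappa> * length (subst_iter \<zeta> n [c])
        \<le> (1 - \<kappa> / A\<^sup>2) * length (subst_iter \<zeta> N [b])" by (simp add: algebra_simps)
      also have "\<dots> \<le> g * length (subst_iter \<zeta> N [b])" by (intro mult_right_mono) (auto simp: g_def)
      finally have "D * (length (subst_iter \<zeta> N [b]) - \<kappa> * length (subst_iter \<zeta> n [c]))
        \<le> D * (g * length (subst_iter \<zeta> N [b]))" using D by (intro mult_left_mono)
      also have "\<dots> = \<beta> ^ (card (?G n) + L) * length (subst_iter \<zeta> N [b])"
        by (simp add: D_def power_add \<beta>L)
      also have "\<dots> \<le> \<beta> ^ card (?G N) * length (subst_iter \<zeta> N [b])"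
      proof (intro mult_right_mono power_decreasing)
        \<comment> \<open>Only the levels k with k \<le> n < k + L are lost.\<close>
        have "?G N \<subseteq> ?G n \<union> {Suc n - L..n}" by (auto simp: far_levels_def N)
        then have "card (?G N) \<le> card (?G n \<union> {Suc n - L..n})"
          using finite_far_levels by (intro card_mono) auto
        also have "\<dots> \<le> card (?G n) + card {Suc n - L..n}" by (rule card_Un_le)
        also have "card {Suc n - L..n} \<le> L" by simp
        finally show "card (?G N) \<le> card (?G n) + L" by simp
      qed (use \<beta> in auto)
      finally show ?thesis using gain by linarith
    qed
  qed
  show thesis by (rule that[OF \<beta>]) (intro allI main)
qed


text \<open>Cut u into images at level n; the two incomplete images at its ends are bounded by their
  lengths. When k is at most n, all of u is that short.\<close>

lemma exp_sum_language_le: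
  fixes D :: real and \<zeta> :: "'a::finite \<Rightarrow> 'a list"
  assumes sub: "substitution \<zeta>"
    and D: "\<And>b. norm (exp_sum s a \<omega> (subst_iter \<zeta> n [b])) \<le> D * length (subst_iter \<zeta> n [b])" "D \<ge> 0"
    and u: "sublist u (subst_iter \<zeta> k [d])"
  shows "norm (exp_sum s a \<omega> u) \<le> D * length u + 2 * max_length \<zeta> n"
proof (cases "k \<le> n")
  case True
  have "length u \<le> max_length \<zeta> k"
    using sublist_length_le[OF u] length_le_max_length[of \<zeta> k d] by linarith
  also have "\<dots> \<le> max_length \<zeta> n" by (rule max_length_mono[OF sub True])
  finally have "real (length u) \<le> max_length \<zeta> n" by simp
  moreover have "0 \<le> D * length u" using D(2) by simp
  ultimately show ?thesis using norm_exp_sum_le[of s a \<omega> u] by linarith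
next
  case False
  define j where "j = k - n"
  have "k = n + j" using False by (simp add: j_def)
  then have "subst_iter \<zeta> k [d] = concat (map (\<lambda>b. subst_iter \<zeta> n [b]) (subst_iter \<zeta> j [d]))"
    by (simp only: subst_iter_add subst_iter_concat[of \<zeta> n "subst_iter \<zeta> j [d]"])
  then have "sublist u (concat (map (\<lambda>b. subst_iter \<zeta> n [b]) (subst_iter \<zeta> j [d])))" using u by (simp only:)
  then obtain p w q where pwq: "u = p @ concat (map (\<lambda>b. subst_iter \<zeta> n [b]) w) @ q"
    "length p \<le> max_length \<zeta> n" "length q \<le> max_length \<zeta> n"
    by (rule sublist_concat_map_decompose[OF length_le_max_length])
  then have u: "u = p @ subst_iter \<zeta> n w @ q" by (simp only: subst_iter_concat[of \<zeta> n w])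
  have "norm (exp_sum s a \<omega> u) \<le> length p + D * length (subst_iter \<zeta> n w) + length q"
    unfolding u using norm_exp_sum_append_le[of s a \<omega> p "subst_iter \<zeta> n w @ q"]
      norm_exp_sum_append_le[of s a \<omega> "subst_iter \<zeta> n w" q] norm_exp_sum_le[of s a \<omega> p] norm_exp_sum_le[of s a \<omega> q]
      norm_exp_sum_subst_iter_le[OF D(1), of w] by linarith
  also have "D * length (subst_iter \<zeta> n w) \<le> D * length u" using D(2) by (intro mult_left_mono) (auto simp: u)
  finally show ?thesis using pwq(2,3) by linarith
qed

text \<open>The square-root term pays for the two incomplete images in
  \<open>exp_sum_language_le\<close>, whose level is chosen with \<open>max_length\<close> at most
  the square root of R. One pair of constants serves all frequencies in \<Omega>.\<close>

definition power_saving ::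
  "('a \<Rightarrow> 'a list) \<Rightarrow> real ^ 'a \<Rightarrow> real set \<Rightarrow> real \<Rightarrow> real \<Rightarrow> real \<Rightarrow> bool" where
  "power_saving \<zeta> s \<Omega> \<gamma> C R\<^sub>0 \<longleftrightarrow> (\<forall>R\<ge>R\<^sub>0. \<forall>\<omega>\<in>\<Omega>. \<forall>a k d u. sublist u (subst_iter \<zeta> k [d]) \<longrightarrow>
     norm (exp_sum s a \<omega> u) \<le> C * real (length u) * R powr (- \<gamma>) + 2 * R powr (1 / 2))"

proposition exp_sum_power_bound:
  fixes \<zeta> :: "'a::finite \<Rightarrow> 'a list" and \<rho> \<delta> :: real
  assumes sub: "substitution \<zeta>" and L: "L \<ge> 1" and all: "\<forall>a b. a \<in> set (subst_iter \<zeta> L [b])"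
    and ret: "\<forall>b. \<exists>x y. subst_iter \<zeta> L [b] = x @ [c] @ v @ [c] @ y" and \<rho>: "\<rho> > 0" and \<delta>: "\<delta> > 0"
  obtains \<gamma> :: real where "0 < \<gamma>" "\<gamma> \<le> 1 / 2"
    "\<forall>s \<Omega> N\<^sub>0. (\<forall>N\<ge>N\<^sub>0. \<forall>\<omega>\<in>\<Omega>. \<delta> * N < card (far_indices \<rho> N (\<lambda>k. \<omega> * flow_length s (subst_iter \<zeta> k (c # v)))))
     \<longrightarrow> (\<exists>C>0. \<exists>R\<^sub>0\<ge>1. power_saving \<zeta> s \<Omega> \<gamma> C R\<^sub>0)"
proof -
  obtain \<beta> :: real where \<beta>: "0 < \<beta>" "\<beta> < 1" and decay: "\<forall>s a \<omega> N b. norm (exp_sum s a \<omega> (subst_iter \<zeta> N [b]))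
    \<le> \<beta> ^ card (far_levels \<zeta> s (c # v) \<rho> L \<omega> N) * length (subst_iter \<zeta> N [b])"
    by (rule exp_sum_decay[OF sub L all ret \<rho>])
  \<comment> \<open>A bound for the growth of lengths per level; the 2 makes \<open>ln K\<close>
    positive.\<close>
  define K where "K = real (max 2 (max_length \<zeta> 1))"
  define \<tau> where "\<tau> = \<beta> powr \<delta>"
  \<comment> \<open>At level n about ln R / (2 ln K) the decay \<tau>^n is the power of R with
    exponent ln \<tau> / (2 ln K). The cap 1/2 later lets R^(1 - \<gamma>) absorb the square-root
    term.\<close>
  define \<gamma> where "\<gamma> = min (1 / 2) (- ln \<tau> / (2 * ln K))"
  have K: "K \<ge> 2" by (simp add: K_def)
  then have lnK: "ln K > 0" by simp
  have \<tau>: "0 < \<tau>" "\<tau> < 1" using \<beta> \<delta> powr_less_mono2[of \<delta> \<beta> 1] by (auto simp: \<tau>_def)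
  have \<gamma>: "0 < \<gamma>" "\<gamma> \<le> 1 / 2" using \<tau> lnK by (auto simp: \<gamma>_def field_simps)
  have "\<exists>C>0. \<exists>R\<^sub>0\<ge>1. power_saving \<zeta> s \<Omega> \<gamma> C R\<^sub>0"
    if far: "\<forall>N\<ge>N\<^sub>0. \<forall>\<omega>\<in>\<Omega>. \<delta> * N < card (far_indices \<rho> N (\<lambda>k. \<omega> * flow_length s (subst_iter \<zeta> k (c # v))))"
    for s \<Omega> N\<^sub>0
  proof -
    \<comment> \<open>C pays for the at most L + 1 levels lost by rounding x down and by counting
      only below n - L; \<open>R\<^sub>0\<close> is large enough for n - L to reach
      \<open>N\<^sub>0\<close>.\<close>
    define C where "C = \<tau> powr (- real L - 1)"
    define R\<^sub>0 where "R\<^sub>0 = K powr (2 * (real N\<^sub>0 + real L + 1))"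
    have "norm (exp_sum s a \<omega> u) \<le> C * real (length u) * R powr (- \<gamma>) + 2 * R powr (1 / 2)"
      if R: "R \<ge> R\<^sub>0" and \<omega>: "\<omega> \<in> \<Omega>" and u: "sublist u (subst_iter \<zeta> k [d])" for R \<omega> a k d u
    proof -
      have R1: "R \<ge> 1" using R K ge_one_powr_ge_zero[of K "2 * (real N\<^sub>0 + real L + 1)"] by (simp add: R\<^sub>0_def)
      define x where "x = ln R / (2 * ln K)"
      define n where "n = nat \<lfloor>x\<rfloor>"
      have "ln R \<ge> ln R\<^sub>0" using R R1 K by (subst ln_le_cancel_iff) (auto simp: R\<^sub>0_def)
      then have "ln R \<ge> (real N\<^sub>0 + real L + 1) * (2 * ln K)" using K by (simp add: R\<^sub>0_def ln_powr mult_ac)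
      then have x: "x \<ge> real N\<^sub>0 + real L + 1" using lnK by (simp add: x_def pos_le_divide_eq)
      then have n: "n \<ge> N\<^sub>0 + L" "real n \<le> x" "x - 1 \<le> real n" unfolding n_def by linarith+
      have A: "real (max_length \<zeta> n) \<le> R powr (1 / 2)"
      proof -
        have "real (max_length \<zeta> n) \<le> real (max_length \<zeta> 1) ^ n"
          using max_length_power[of \<zeta> n] by (simp flip: of_nat_power)
        also have "\<dots> \<le> K ^ n" by (intro power_mono) (auto simp: K_def)
        also have "\<dots> = K powr n" using K by (simp add: powr_realpow)
        also have "\<dots> \<le> K powr x" using n K by (intro powr_mono) auto
        also have "\<dots> = R powr (1 / 2)" using K R1 lnK by (simp add: powr_def x_def)
        finally show ?thesis .
      qed
      define D where "D = \<beta> ^ card (far_levels \<zeta> s (c # v) \<rho> L \<omega> n)"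
      have D0: "D \<ge> 0" using \<beta> by (simp add: D_def)
      have "far_indices \<rho> (n - L) (\<lambda>k. \<omega> * flow_length s (subst_iter \<zeta> k (c # v)))
          \<subseteq> far_levels \<zeta> s (c # v) \<rho> L \<omega> n"
        by (auto simp: far_indices_def far_levels_def)
      then have "card (far_indices \<rho> (n - L) (\<lambda>k. \<omega> * flow_length s (subst_iter \<zeta> k (c # v))))
          \<le> card (far_levels \<zeta> s (c # v) \<rho> L \<omega> n)"
        by (rule card_mono[OF finite_far_levels])
      moreover have "\<delta> * real (n - L) < card (far_indices \<rho> (n - L) (\<lambda>k. \<omega> * flow_length s (subst_iter \<zeta> k (c # v))))"
        using n(1) by (intro far[rule_format, OF _ \<omega>]) linarith
      ultimately have cd: "\<delta> * real (n - L) \<le> card (far_levels \<zeta> s (c # v) \<rho> L \<omega> n)" by linarith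
      have "D = \<beta> powr card (far_levels \<zeta> s (c # v) \<rho> L \<omega> n)" using \<beta> by (simp add: D_def powr_realpow)
      also have "\<dots> \<le> \<beta> powr (\<delta> * real (n - L))" using \<beta> cd by (intro powr_mono') auto
      also have "\<dots> = \<tau> powr real (n - L)" by (simp add: \<tau>_def powr_powr)
      also have "\<dots> \<le> \<tau> powr (x - 1 - L)" using n \<tau> by (intro powr_mono') auto
      also have "\<dots> = C * \<tau> powr x" using \<tau> by (simp add: C_def powr_add[symmetric] algebra_simps)
      also have "\<tau> powr x = R powr (ln \<tau> / (2 * ln K))" using \<tau> R1 by (simp add: powr_def x_def)
      also have "C * R powr (ln \<tau> / (2 * ln K)) \<le> C * R powr (- \<gamma>)"
        using R1 by (intro mult_left_mono powr_mono) (auto simp: \<gamma>_def C_def)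
      finally have D: "D \<le> C * R powr (- \<gamma>)" .
      have "norm (exp_sum s a \<omega> u) \<le> D * length u + 2 * max_length \<zeta> n"
        using decay u D0 by (intro exp_sum_language_le[OF sub]) (auto simp: D_def)
      also have "\<dots> \<le> C * R powr (- \<gamma>) * length u + 2 * R powr (1 / 2)"
        using A D by (intro add_mono mult_right_mono) auto
      finally show ?thesis by (simp only: mult_ac)
    qed
    note bound = this
    have "C > 0" using \<tau> by (simp add: C_def)
    moreover have "R\<^sub>0 \<ge> 1" using K ge_one_powr_ge_zero[of K "2 * (real N\<^sub>0 + real L + 1)"] by (simp add: R\<^sub>0_def)
    ultimately show ?thesis
      using bound unfolding power_saving_def by - (rule exI[of _ C], rule conjI, assumption, rule exI[of _ R\<^sub>0], simp)
  qed
  then show thesis by (intro that[OF \<gamma>]) simp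
qed

section \<open>Spectral measures\<close>

lemma bounded_integrable_finite:
  fixes f :: "'b \<Rightarrow> complex"
  assumes "finite_measure M" "f \<in> borel_measurable M" "\<And>z. z \<in> space M \<Longrightarrow> norm (f z) \<le> B"
  shows "integrable M f"
  using assms(2,3) by (intro finite_measure.integrable_const_bound[OF assms(1), of _ B]) (auto intro: AE_I2)

lemma borel_measurable_cnj:
  "f \<in> borel_measurable M \<Longrightarrow> (\<lambda>x. cnj (f x)) \<in> borel_measurable M"
  by (rule measurable_compose[OF _ borel_measurable_continuous_onI]) (auto intro: continuous_intros)

text \<open>Fubini, twice. The left side depends on the correlation kernel alone, so two families
  with the same kernel, even over different spaces, have time integrals of equal mean
  square.\<close>

lemma gram_double_integral:
  fixes h :: "'t \<Rightarrow> 'b \<Rightarrow> complex"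
  assumes T: "finite_measure T" and N: "finite_measure N"
    and meas: "(\<lambda>(t, z). h t z) \<in> borel_measurable (T \<Otimes>\<^sub>M N)"
    and bd: "\<And>t z. norm (h t z) \<le> 1"
  shows "(LINT t|T. LINT t'|T. LINT z|N. h t z * cnj (h t' z))
    = (LINT z|N. (LINT t|T. h t z) * cnj (LINT t|T. h t z))"
proof -
  interpret T: finite_measure T by (rule T)
  interpret N: finite_measure N by (rule N)
  interpret P: pair_sigma_finite T N ..
  have TN: "finite_measure (T \<Otimes>\<^sub>M N)" 
    by (rule finite_measureI) (simp add: space_pair_measure N.emeasure_pair_measure_Times ennreal_mult_eq_top_iff)
  define H where "H z = (LINT t|T. h t z)" for z
  note [measurable] = meas
  have ht [measurable]: "(\<lambda>z. h t z) \<in> borel_measurable N" if "t \<in> space T" for t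
    using measurable_compose[OF measurable_Pair1'[OF that] meas] by simp
  have hz: "(\<lambda>t. h t z) \<in> borel_measurable T" if "z \<in> space N" for z
    using measurable_compose[OF measurable_Pair2'[OF that] meas] by simp
  have swap: "(\<lambda>(z, t). h t z) \<in> borel_measurable (N \<Otimes>\<^sub>M T)"
    using measurable_compose[OF measurable_pair_swap' meas] by (simp add: case_prod_beta)
  have H [measurable]: "H \<in> borel_measurable N"
    unfolding H_def using T.borel_measurable_lebesgue_integral[OF swap] by simp
  have int: "integrable T (\<lambda>t. h t z)" if "z \<in> space N" for z
    using bd by (intro bounded_integrable_finite[OF T hz[OF that]])
  have Hb: "norm (H z) \<le> measure T (space T)" if "z \<in> space N" for z
  proof -
    from int[OF that] have "norm (H z) \<le> (LINT t|T. 1)" unfolding H_def using bd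
      by (intro order.trans[OF integral_norm_bound integral_mono]) (auto simp: integrable_norm)
    then show ?thesis by simp
  qed
  have inner: "(LINT t'|T. LINT z|N. h t z * cnj (h t' z)) = (LINT z|N. h t z * cnj (H z))" if t: "t \<in> space T" for t
  proof -
    have m: "(\<lambda>(t', z). h t z * cnj (h t' z)) \<in> borel_measurable (T \<Otimes>\<^sub>M N)"
    proof -
      have "(\<lambda>x. h t (snd x)) \<in> borel_measurable (T \<Otimes>\<^sub>M N)"
        by (rule measurable_compose[OF measurable_snd ht[OF t]])
      moreover have "(\<lambda>x. cnj (h (fst x) (snd x))) \<in> borel_measurable (T \<Otimes>\<^sub>M N)"
        using meas by (intro borel_measurable_cnj) (simp add: case_prod_beta)
      ultimately show ?thesis by (simp add: case_prod_beta borel_measurable_times)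
    qed
    have "integrable (T \<Otimes>\<^sub>M N) (\<lambda>(t', z). h t z * cnj (h t' z))"
      using bd mult_mono[OF bd bd] by (intro bounded_integrable_finite[OF TN m, of 1]) (auto simp: norm_mult)
    then have "(LINT t'|T. LINT z|N. h t z * cnj (h t' z)) = (LINT z|N. LINT t'|T. h t z * cnj (h t' z))"
      by (rule P.Fubini_integral[symmetric])
    also have "\<dots> = (LINT z|N. h t z * cnj (H z))"
    proof (rule Bochner_Integration.integral_cong[OF refl])
      fix z assume "z \<in> space N"
      then have "(LINT t'|T. cnj (h t' z)) = cnj (H z)"
        unfolding H_def by (rule integral_bounded_linear[OF bounded_linear_cnj int])
      then show "(LINT t'|T. h t z * cnj (h t' z)) = h t z * cnj (H z)"
        by (simp only: integral_mult_right_zero)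
    qed
    finally show ?thesis .
  qed
  have "(LINT t|T. LINT t'|T. LINT z|N. h t z * cnj (h t' z)) = (LINT t|T. LINT z|N. h t z * cnj (H z))"
    using inner by (intro Bochner_Integration.integral_cong) auto
  also have "\<dots> = (LINT z|N. LINT t|T. h t z * cnj (H z))"
  proof (rule P.Fubini_integral[symmetric])
    have "(\<lambda>x. cnj (H (snd x))) \<in> borel_measurable (T \<Otimes>\<^sub>M N)"
      by (intro borel_measurable_cnj measurable_compose[OF measurable_snd H])
    then have m: "(\<lambda>(t, z). h t z * cnj (H z)) \<in> borel_measurable (T \<Otimes>\<^sub>M N)"
      using meas by (simp add: case_prod_beta borel_measurable_times)
    have "norm (h t z * cnj (H z)) \<le> 1 * measure T (space T)" if "z \<in> space N" for t z
      unfolding norm_mult using bd[of t z] Hb[OF that] by (intro mult_mono) auto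
    then show "integrable (T \<Otimes>\<^sub>M N) (\<lambda>(t, z). h t z * cnj (H z))"
      by (intro bounded_integrable_finite[OF TN m, of "measure T (space T)"]) (auto simp: space_pair_measure)
  qed
  also have "\<dots> = (LINT z|N. H z * cnj (H z))"
    unfolding H_def by (simp only: integral_mult_left_zero)
  finally show ?thesis by (simp only: H_def)
qed

lemma finite_measure_lborel_restrict: "finite_measure (restrict_space lborel {0..R :: real})"
  by (rule finite_measureI) (simp add: emeasure_restrict_space space_restrict_space emeasure_lborel_Icc_eq)

text \<open>The family g twisted by \<omega> and the characters on \<sigma> have the same kernel, so
  \<open>gram_double_integral\<close> equates the mean squares of their integrals over [0, R]. The
  first is at most B^2; in the second, every frequency of the window contributes at least (R /
  2)^2.\<close>

lemma spectral_concentration: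
  fixes g :: "real \<Rightarrow> 'b \<Rightarrow> complex" and R :: real
  defines "T \<equiv> restrict_space lborel {0..R}"
  assumes M: "prob_space M" and \<sigma>: "finite_measure \<sigma>" "sets \<sigma> = sets borel" and R: "R > 0"
    and meas: "(\<lambda>(t, p). g t p) \<in> borel_measurable (borel \<Otimes>\<^sub>M M)" and bd: "\<And>t p. norm (g t p) \<le> 1"
    and corr: "\<And>t t'. (LINT p|M. g t p * cnj (g t' p)) = (LINT \<xi>|\<sigma>. cis (2 * pi * \<xi> * (t - t')))"
    and bound: "\<And>p. p \<in> space M \<Longrightarrow> norm (LINT t|T. cis (- 2 * pi * \<omega> * t) * g t p) \<le> B"
  shows "measure \<sigma> {\<omega> - 1 / (6 * R)..\<omega> + 1 / (6 * R)} \<le> 4 * B\<^sup>2 / R\<^sup>2"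
proof -
  interpret M: prob_space M by (rule M)
  interpret S: finite_measure \<sigma> by (rule \<sigma>)
  have T: "finite_measure T" unfolding T_def by (rule finite_measure_lborel_restrict)
  then interpret T: finite_measure T .
  have spT: "space T = {0..R}" by (simp add: T_def space_restrict_space)
  have idT: "(\<lambda>t. t) \<in> T \<rightarrow>\<^sub>M borel"
    unfolding T_def by (rule measurable_restrict_space1) simp
  have contm: "(\<lambda>x. f (fst x) (snd x)) \<in> borel_measurable (T \<Otimes>\<^sub>M \<sigma>)"
    if "(\<lambda>x. f (fst x) (snd x)) \<in> borel_measurable (borel \<Otimes>\<^sub>M borel)" for f :: "real \<Rightarrow> real \<Rightarrow> complex"
  proof -
    have "(\<lambda>x. x) \<in> \<sigma> \<rightarrow>\<^sub>M borel" using \<sigma>(2) by (simp add: measurable_ident_sets)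
    then have "(\<lambda>x. (fst x, snd x)) \<in> T \<Otimes>\<^sub>M \<sigma> \<rightarrow>\<^sub>M borel \<Otimes>\<^sub>M borel"
      by (intro measurable_Pair measurable_compose[OF measurable_fst idT] measurable_compose[OF measurable_snd])
    from measurable_compose[OF this that] show ?thesis by simp
  qed
  define hM where "hM = (\<lambda>t p. cis (- 2 * pi * \<omega> * t) * g t p)"
  define hS where "hS = (\<lambda>t \<xi> :: real. cis (2 * pi * (\<xi> - \<omega>) * t))"
  have cis_meas: "(\<lambda>x. cis (f x)) \<in> borel_measurable N" if "f \<in> borel_measurable N" for f :: "'z \<Rightarrow> real" and N
    unfolding cis_conv_exp using that by measurable
  have mS: "(\<lambda>(t, \<xi>). hS t \<xi>) \<in> borel_measurable (T \<Otimes>\<^sub>M \<sigma>)"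
    unfolding hS_def case_prod_beta by (rule contm) (intro cis_meas, measurable)
  have mM: "(\<lambda>(t, p). hM t p) \<in> borel_measurable (T \<Otimes>\<^sub>M M)"
  proof -
    have "(\<lambda>x. (fst x, snd x)) \<in> T \<Otimes>\<^sub>M M \<rightarrow>\<^sub>M borel \<Otimes>\<^sub>M M"
      by (intro measurable_Pair measurable_compose[OF measurable_fst idT] measurable_snd)
    from measurable_compose[OF this meas] have "(\<lambda>x. g (fst x) (snd x)) \<in> borel_measurable (T \<Otimes>\<^sub>M M)" by simp
    moreover have "(\<lambda>x. cis (- 2 * pi * \<omega> * fst x)) \<in> borel_measurable (T \<Otimes>\<^sub>M M)"
      by (intro cis_meas borel_measurable_times borel_measurable_const measurable_compose[OF measurable_fst idT])
    ultimately show ?thesis unfolding hM_def case_prod_beta by (rule borel_measurable_times[rotated])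
  qed
  have "(LINT p|M. hM t p * cnj (hM t' p)) = (LINT \<xi>|\<sigma>. hS t \<xi> * cnj (hS t' \<xi>))" for t t'
  proof -
    have "(LINT p|M. hM t p * cnj (hM t' p)) = (LINT p|M. cis (- 2 * pi * \<omega> * (t - t')) * (g t p * cnj (g t' p)))"
    proof -
      have "cis (- 2 * pi * \<omega> * (t - t')) = cis (- 2 * pi * \<omega> * t) * cnj (cis (- 2 * pi * \<omega> * t'))"
        by (simp add: cis_cnj cis_mult algebra_simps)
      then show ?thesis by (simp only: hM_def complex_cnj_mult mult_ac)
    qed
    also have "\<dots> = cis (- 2 * pi * \<omega> * (t - t')) * (LINT \<xi>|\<sigma>. cis (2 * pi * \<xi> * (t - t')))"
      by (simp only: integral_mult_right_zero corr)
    also have "\<dots> = (LINT \<xi>|\<sigma>. cis (- 2 * pi * \<omega> * (t - t')) * cis (2 * pi * \<xi> * (t - t')))"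
      by (simp only: integral_mult_right_zero)
    also have "\<dots> = (LINT \<xi>|\<sigma>. hS t \<xi> * cnj (hS t' \<xi>))"
      unfolding hS_def by (intro Bochner_Integration.integral_cong) (auto simp: cis_cnj cis_mult algebra_simps)
    finally show ?thesis .
  qed
  then have "(LINT t|T. LINT t'|T. LINT p|M. hM t p * cnj (hM t' p)) = (LINT t|T. LINT t'|T. LINT \<xi>|\<sigma>. hS t \<xi> * cnj (hS t' \<xi>))"
    by simp
  moreover have "norm (hM t p) \<le> 1" "norm (hS t \<xi>) \<le> 1" for t p \<xi>
    using bd by (auto simp: hM_def hS_def norm_mult)
  ultimately have eq: "(LINT p|M. (LINT t|T. hM t p) * cnj (LINT t|T. hM t p)) = (LINT \<xi>|\<sigma>. (LINT t|T. hS t \<xi>) * cnj (LINT t|T. hS t \<xi>))"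
    using gram_double_integral[OF T M.finite_measure_axioms mM] gram_double_integral[OF T \<sigma>(1) mS] by simp
  define AM where "AM = (\<lambda>p. (norm (LINT t|T. hM t p))\<^sup>2)"
  define AS where "AS = (\<lambda>\<xi>. (norm (LINT t|T. hS t \<xi>))\<^sup>2)"
  have "complex_of_real (LINT p|M. AM p) = complex_of_real (LINT \<xi>|\<sigma>. AS \<xi>)"
    using eq unfolding AM_def AS_def by (simp only: complex_norm_square[symmetric] of_real_power[symmetric] integral_complex_of_real)
  then have AA: "(LINT p|M. AM p) = (LINT \<xi>|\<sigma>. AS \<xi>)" by (simp only: of_real_eq_iff)
  have AMle: "AM p \<le> B\<^sup>2" if "p \<in> space M" for p
    unfolding AM_def hM_def using bound[OF that] by (intro power_mono) auto
  have upper: "(LINT p|M. AM p) \<le> B\<^sup>2"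
  proof -
    have "(LINT p|M. AM p) \<le> (LINT p|M. B\<^sup>2)"
      using AMle by (intro integral_mono') auto
    then show ?thesis by (simp add: M.prob_space)
  qed
  define J where "J = {\<omega> - 1 / (6 * R)..\<omega> + 1 / (6 * R)}"
  have J: "J \<in> sets \<sigma>" using \<sigma>(2) by (simp add: J_def)
  \<comment> \<open>The phase stays within \<pi>/3 on [0, R], so the real part of the integrand is
    at least 1/2. This is the origin of the 6.\<close>
  have low: "R / 2 \<le> norm (LINT t|T. hS t \<xi>)" if \<xi>: "\<xi> \<in> J" for \<xi>
  proof -
    have hSm: "(\<lambda>t. hS t \<xi>) \<in> borel_measurable T"
      unfolding hS_def by (intro cis_meas borel_measurable_times borel_measurable_const idT)
    then have int: "integrable T (\<lambda>t. hS t \<xi>)"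
      by (rule bounded_integrable_finite[OF T, where B = 1]) (simp add: hS_def)
    have "1 / 2 \<le> Re (hS t \<xi>)" if t: "t \<in> space T" for t
    proof -
      have t: "0 \<le> t" "t \<le> R" using t spT by auto
      have "\<bar>\<xi> - \<omega>\<bar> \<le> 1 / (6 * R)" using \<xi> by (auto simp: J_def)
      then have "\<bar>\<xi> - \<omega>\<bar> * t \<le> 1 / (6 * R) * R" using t R by (intro mult_mono) auto
      then have "2 * pi * (\<bar>\<xi> - \<omega>\<bar> * t) \<le> 2 * pi * (1 / 6)" using R by (intro mult_left_mono) auto
      then have "cos (pi / 3) \<le> cos (2 * pi * (\<bar>\<xi> - \<omega>\<bar> * t))"
        using t by (intro cos_monotone_0_pi_le) auto
      also have "2 * pi * (\<bar>\<xi> - \<omega>\<bar> * t) = \<bar>2 * pi * (\<xi> - \<omega>) * t\<bar>"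
        unfolding abs_mult using t by simp
      also have "cos \<bar>2 * pi * (\<xi> - \<omega>) * t\<bar> = cos (2 * pi * (\<xi> - \<omega>) * t)" by (rule cos_abs_real)
      finally show ?thesis by (simp add: hS_def cos_60)
    qed
    then have "(LINT t|T. 1 / 2) \<le> (LINT t|T. Re (hS t \<xi>))"
      using int by (intro integral_mono) auto
    moreover have "measure T (space T) = R"
      using R by (simp add: spT T_def measure_restrict_space)
    ultimately have "R / 2 \<le> (LINT t|T. Re (hS t \<xi>))" by simp
    also have "\<dots> = Re (LINT t|T. hS t \<xi>)" using int by simp
    also have "\<dots> \<le> norm (LINT t|T. hS t \<xi>)" by (rule complex_Re_le_cmod)
    finally show ?thesis .
  qed
  have "(R / 2)\<^sup>2 * measure \<sigma> J = (LINT \<xi>|\<sigma>. (R / 2)\<^sup>2 * indicator J \<xi>)"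
    using J by simp
  also have "\<dots> \<le> (LINT \<xi>|\<sigma>. AS \<xi>)"
  proof (rule integral_mono)
    show "integrable \<sigma> (\<lambda>\<xi>. (R / 2)\<^sup>2 * indicator J \<xi>)" using J by (intro integrable_mult_right integrable_real_indicator) (auto simp: less_top[symmetric])
    have swap: "(\<lambda>(\<xi>, t). hS t \<xi>) \<in> borel_measurable (\<sigma> \<Otimes>\<^sub>M T)"
      using measurable_compose[OF measurable_pair_swap' mS] by (simp add: case_prod_beta)
    have "(\<lambda>\<xi>. LINT t|T. hS t \<xi>) \<in> borel_measurable \<sigma>"
      by (rule T.borel_measurable_lebesgue_integral[OF swap])
    then have ASm: "AS \<in> borel_measurable \<sigma>" unfolding AS_def by measurable
    have "norm (LINT t|T. hS t \<xi>) \<le> R" for \<xi>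
    proof -
      have "norm (LINT t|T. hS t \<xi>) \<le> (LINT t|T. norm (hS t \<xi>))" by (rule integral_norm_bound)
      also have "\<dots> = R" using R by (simp add: hS_def spT T_def measure_restrict_space)
      finally show ?thesis .
    qed
    then have "norm (AS \<xi>) \<le> R\<^sup>2" for \<xi> unfolding AS_def using R by (simp add: power_mono)
    then show "integrable \<sigma> AS" by (intro S.integrable_const_bound[of _ "R\<^sup>2"] AE_I2 ASm)
    show "(R / 2)\<^sup>2 * indicator J \<xi> \<le> AS \<xi>" for \<xi>
      using low[of \<xi>] R unfolding AS_def by (cases "\<xi> \<in> J") (auto intro!: power_mono)
  qed
  finally have "(R / 2)\<^sup>2 * measure \<sigma> J \<le> B\<^sup>2" using upper AA by simp
  then show ?thesis using R by (simp add: J_def field_simps power2_eq_square)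
qed

section \<open>The suspension flow\<close>

lemma roof_sum_0 [simp]: "roof_sum s x 0 = 0"
  by (simp add: roof_sum_def)

lemma roof_sum_Suc: "roof_sum s x (n + 1) = roof_sum s x n + s $ x n"
proof (cases "n \<ge> 0")
  case True
  then have "{0..<n + 1} = insert n {0..<n}" by auto
  then show ?thesis using True by (simp add: roof_sum_def)
next
  case False
  then have "{n..<0} = insert n {n + 1..<0}" "{0..<n + 1} = {}" "{0..<n} = {}" by auto
  then show ?thesis by (simp add: roof_sum_def)
qed

lemma roof_sum_shift: "roof_sum s (\<lambda>k. x (k + n)) k = roof_sum s x (k + n) - roof_sum s x n"
proof (induction k rule: int_induct[of _ 0])
  case (step1 i)
  then show ?case
    using roof_sum_Suc[of s x "i + n"] roof_sum_Suc[of s "\<lambda>k. x (k + n)" i] by (simp add: ac_simps)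
next
  case (step2 i)
  then show ?case
    using roof_sum_Suc[of s x "i - 1 + n"] roof_sum_Suc[of s "\<lambda>k. x (k + n)" "i - 1"] by (simp add: algebra_simps)
qed simp

lemma roof_sum_ge:
  fixes s :: "real ^ 'a"
  assumes "\<And>a. c \<le> s $ a"
  shows "c * int k \<le> roof_sum s x (n + int k) - roof_sum s x n"
proof (induction k)
  case (Suc k)
  then show ?case
    using roof_sum_Suc[of s x "n + int k"] assms[of "x (n + int k)"] by (simp add: algebra_simps)
qed simp

lemma roof_sum_mono:
  fixes s :: "real ^ 'a"
  assumes "\<And>a. 0 \<le> s $ a" "n \<le> m"
  shows "roof_sum s x n \<le> roof_sum s x m"
  using roof_sum_ge[of 0 s "nat (m - n)" x n] assms by simp

lemma positive_lower_bound:
  fixes s :: "real ^ 'a"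
  assumes "\<And>a. 0 < s $ a"
  obtains c where "c > 0" "\<And>a. c \<le> s $ a"
proof -
  have "Min (range (($) s)) > 0" using assms by (subst Min_gr_iff) auto
  moreover have "Min (range (($) s)) \<le> s $ a" for a by (rule Min_le) auto
  ultimately show thesis using that by blast
qed

text \<open>Roofs are at least some c > 0, so the sums are unbounded in both directions. Counting up
  from a start below t, the first index that exceeds t is one too far.\<close>

lemma roof_sum_index_exists:
  fixes s :: "real ^ 'a"
  assumes "\<And>a. 0 < s $ a"
  obtains n where "roof_sum s x n \<le> t" "t < roof_sum s x (n + 1)"
proof -
  obtain c where c: "c > 0" "\<And>a. c \<le> s $ a" using positive_lower_bound[OF assms] by blast
  obtain k :: nat where k: "\<bar>t\<bar> / c < real k" using reals_Archimedean2 by blast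
  then have ck: "\<bar>t\<bar> < c * real k" using c(1) by (simp add: field_simps)
  have lo: "roof_sum s x (- int k) \<le> t"
    using roof_sum_ge[of c s k x "- int k"] c(2) ck by simp
  have hi: "t < roof_sum s x (- int k + int (k + k))"
    using roof_sum_ge[of c s k x 0] c(2) ck by simp
  define j where "j = (LEAST j. t < roof_sum s x (- int k + int j))"
  have j: "t < roof_sum s x (- int k + int j)" unfolding j_def using hi by (rule LeastI)
  then have "j \<noteq> 0" using lo by (metis add.right_neutral leD of_nat_0)
  then obtain i where i: "j = Suc i" by (cases j) auto
  have "\<not> t < roof_sum s x (- int k + int i)"
    by (rule not_less_Least[of i "\<lambda>j. t < roof_sum s x (- int k + int j)", folded j_def]) (simp add: i)
  then show thesis using j by (intro that[of "- int k + int i"]) (simp_all add: i algebra_simps)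
qed

lemma susp_repr_eq:
  fixes s :: "real ^ 'a"
  assumes s: "\<And>a. 0 < s $ a" and n: "roof_sum s x n \<le> t" "t < roof_sum s x (n + 1)"
  shows "susp_repr s (x, t) = ((\<lambda>k. x (k + n)), t - roof_sum s x n)"
proof -
  have uniq: "m = n" if m: "roof_sum s x m \<le> t \<and> t < roof_sum s x (m + 1)" for m
  proof (rule ccontr)
    assume "m \<noteq> n"
    then consider "m + 1 \<le> n" | "n + 1 \<le> m" by linarith
    then show False
    proof cases
      case 1
      then have "roof_sum s x (m + 1) \<le> roof_sum s x n" by (rule roof_sum_mono[OF less_imp_le[OF s]])
      then show False using m n by linarith
    next
      case 2
      then have "roof_sum s x (n + 1) \<le> roof_sum s x m" by (rule roof_sum_mono[OF less_imp_le[OF s]])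
      then show False using m n by linarith
    qed
  qed
  have "(THE n. roof_sum s x n \<le> t \<and> t < roof_sum s x (n + 1)) = n"
    by (rule the_equality, rule conjI[OF n], rule uniq)
  then show ?thesis by (simp add: susp_repr_def Let_def)
qed

lemma susp_repr_self:
  fixes s :: "real ^ 'a"
  assumes "\<And>a. 0 < s $ a" "0 \<le> t" "t < s $ x 0"
  shows "susp_repr s (x, t) = (x, t)"
  using susp_repr_eq[OF assms(1), of x 0 t] roof_sum_Suc[of s x 0] assms by simp

text \<open>Well-definedness on the quotient: pairs that the identification relates have the same
  representative.\<close>

lemma susp_repr_shift:
  fixes s :: "real ^ 'a"
  assumes s: "\<And>a. 0 < s $ a"
  shows "susp_repr s ((\<lambda>k. x (k + n)), t) = susp_repr s (x, t + roof_sum s x n)"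
proof -
  obtain m where m: "roof_sum s (\<lambda>k. x (k + n)) m \<le> t" "t < roof_sum s (\<lambda>k. x (k + n)) (m + 1)"
    using roof_sum_index_exists[OF s] by blast
  have "susp_repr s (x, t + roof_sum s x n) = ((\<lambda>k. x (k + (m + n))), t + roof_sum s x n - roof_sum s x (m + n))"
    using m unfolding roof_sum_shift by (intro susp_repr_eq[OF s]) (auto simp: algebra_simps)
  then show ?thesis
    unfolding susp_repr_eq[OF s m] by (simp add: roof_sum_shift algebra_simps)
qed

lemma susp_flow_repr:
  fixes s :: "real ^ 'a"
  assumes s: "\<And>a. 0 < s $ a"
  shows "susp_flow s t (susp_repr s (x, u)) = susp_repr s (x, u + t)"
proof -
  obtain m where m: "roof_sum s x m \<le> u" "u < roof_sum s x (m + 1)"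
    using roof_sum_index_exists[OF s] by blast
  show ?thesis
    unfolding susp_repr_eq[OF s m] susp_flow_def by (simp add: susp_repr_shift[OF s])
qed

lemma subst_space_shift:
  assumes "x \<in> subst_space \<zeta>"
  shows "(\<lambda>k. x (k + n)) \<in> subst_space \<zeta>"
proof -
  have "map (\<lambda>k. x (k + n)) [i..j] = map x [i + n..j + n]" for i j
    by (rule nth_equalityI) (auto simp: algebra_simps)
  then show ?thesis using assms by (simp add: subst_space_def)
qed

lemma susp_repr_in_space:
  fixes s :: "real ^ 'a"
  assumes s: "\<And>a. 0 < s $ a" and x: "x \<in> subst_space \<zeta>"
  shows "susp_repr s (x, t) \<in> {(x, t). x \<in> subst_space \<zeta> \<and> 0 \<le> t \<and> t < s $ x 0}"
proof -
  obtain m where m: "roof_sum s x m \<le> t" "t < roof_sum s x (m + 1)"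
    using roof_sum_index_exists[OF s] by blast
  then show ?thesis
    unfolding susp_repr_eq[OF s m] using subst_space_shift[OF x] by (simp add: roof_sum_Suc)
qed

lemma susp_space_eq:
  fixes s :: "real ^ 'a"
  assumes s: "\<And>a. 0 < s $ a"
  shows "susp_space \<zeta> s = {(x, t). x \<in> subst_space \<zeta> \<and> 0 \<le> t \<and> t < s $ x 0}"
proof
  show "susp_space \<zeta> s \<subseteq> {(x, t). x \<in> subst_space \<zeta> \<and> 0 \<le> t \<and> t < s $ x 0}"
    unfolding susp_space_def
  proof (rule image_subsetI)
    fix p assume "p \<in> {(x, t). x \<in> subst_space \<zeta> \<and> 0 \<le> t \<and> t \<le> s $ x 0}"
    then show "susp_repr s p \<in> {(x, t). x \<in> subst_space \<zeta> \<and> 0 \<le> t \<and> t < s $ x 0}"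
      using susp_repr_in_space[OF s, of "fst p" \<zeta> "snd p"] by auto
  qed
  show "{(x, t). x \<in> subst_space \<zeta> \<and> 0 \<le> t \<and> t < s $ x 0} \<subseteq> susp_space \<zeta> s"
  proof
    fix p assume "p \<in> {(x, t). x \<in> subst_space \<zeta> \<and> 0 \<le> t \<and> t < s $ x 0}"
    then show "p \<in> susp_space \<zeta> s"
      unfolding susp_space_def by (intro image_eqI[of _ _ p]) (auto simp: susp_repr_self[OF s])
  qed
qed

lemma susp_flow_in_space:
  fixes s :: "real ^ 'a"
  assumes s: "\<And>a. 0 < s $ a" and "p \<in> susp_space \<zeta> s"
  shows "susp_flow s t p \<in> susp_space \<zeta> s"
  using assms(2) susp_repr_in_space[OF s] unfolding susp_space_eq[OF s] susp_flow_def by (cases p) auto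

lemma susp_flow_add:
  fixes s :: "real ^ 'a"
  assumes s: "\<And>a. 0 < s $ a"
  shows "susp_flow s t (susp_flow s t' p) = susp_flow s (t + t') p"
proof (cases p)
  case (Pair x u)
  then show ?thesis
    using susp_flow_repr[OF s, of t x "u + t'"] by (simp add: susp_flow_def[of s "t + t'"] susp_flow_def[of s t'] ac_simps)
qed

section \<open>The indicator of a cylinder along an orbit\<close>

definition on_letter :: "real ^ 'a \<Rightarrow> 'a \<Rightarrow> (int \<Rightarrow> 'a) \<Rightarrow> real \<Rightarrow> bool" where
  "on_letter s a x v \<longleftrightarrow> (\<exists>n. roof_sum s x n \<le> v \<and> v \<le> roof_sum s x (n + 1) \<and> x n = a)"

text \<open>The closed intervals in \<open>on_letter\<close> reflect that the cylinder contains the representatives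
  \<open>(T x, 0)\<close> of the points \<open>(x, s\<^bsub>a\<^esub>)\<close> on its upper edge.\<close>

lemma susp_repr_in_cylinder_iff:
  fixes s :: "real ^ 'a"
  assumes s: "\<And>a. 0 < s $ a" and x: "x \<in> subst_space \<zeta>"
  shows "susp_repr s (x, v) \<in> susp_cylinder \<zeta> s a \<longleftrightarrow> on_letter s a x v"
proof
  assume "on_letter s a x v"
  then obtain n where n: "roof_sum s x n \<le> v" "v \<le> roof_sum s x (n + 1)" "x n = a"
    by (auto simp: on_letter_def)
  have "susp_repr s (x, v) = susp_repr s ((\<lambda>k. x (k + n)), v - roof_sum s x n)"
    by (simp add: susp_repr_shift[OF s])
  then show "susp_repr s (x, v) \<in> susp_cylinder \<zeta> s a"
    unfolding susp_cylinder_def using n subst_space_shift[OF x, of n]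
    by (intro image_eqI[of _ _ "((\<lambda>k. x (k + n)), v - roof_sum s x n)"]) (auto simp: roof_sum_Suc)
next
  assume "susp_repr s (x, v) \<in> susp_cylinder \<zeta> s a"
  then obtain y t where eq: "susp_repr s (x, v) = susp_repr s (y, t)" and y: "y 0 = a" "0 \<le> t" "t \<le> s $ a"
    unfolding susp_cylinder_def by blast
  obtain n where n: "roof_sum s x n \<le> v" "v < roof_sum s x (n + 1)"
    using roof_sum_index_exists[OF s] by blast
  note repr = susp_repr_eq[OF s n]
  show "on_letter s a x v"
  proof (cases "t < s $ a")
    case True
    then have "susp_repr s (y, t) = (y, t)" using y by (intro susp_repr_self[OF s]) auto
    then have "(\<lambda>k. x (k + n)) = y" using eq repr by simp
    then have "x n = a" using y(1) by auto
    then show ?thesis using n by (auto simp: on_letter_def intro: less_imp_le)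
  next
    case False
    then have t: "t = s $ a" using y by simp
    have "roof_sum s y 1 = s $ a" using roof_sum_Suc[of s y 0] y by simp
    moreover have "roof_sum s y (1 + 1) = roof_sum s y 1 + s $ y 1" by (rule roof_sum_Suc)
    ultimately have "susp_repr s (y, t) = ((\<lambda>k. y (k + 1)), t - roof_sum s y 1)"
      using t s[of "y 1"] by (intro susp_repr_eq[OF s]) auto
    then have "(\<lambda>k. x (k + n)) = (\<lambda>k. y (k + 1))" and v: "v = roof_sum s x n"
      using eq repr t \<open>roof_sum s y 1 = s $ a\<close> by auto
    then have "x (n - 1) = a" using y(1) fun_cong[of "\<lambda>k. x (k + n)" "\<lambda>k. y (k + 1)" "-1"] by (simp add: algebra_simps)
    moreover have "roof_sum s x (n - 1) \<le> v" using v roof_sum_mono[OF less_imp_le[OF s], of "n - 1" n x] by simp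
    ultimately show ?thesis using v unfolding on_letter_def by (intro exI[of _ "n - 1"]) auto
  qed
qed

text \<open>Replaces the representative, with its definite description, by an explicit condition on
  the orbit; measurability and integration go through \<open>on_letter\<close>.\<close>

lemma susp_flow_in_cylinder_iff:
  fixes s :: "real ^ 'a"
  assumes s: "\<And>a. 0 < s $ a" and p: "(x, u) \<in> susp_space \<zeta> s"
  shows "susp_flow s t (x, u) \<in> susp_cylinder \<zeta> s a \<longleftrightarrow> on_letter s a x (u + t)"
  using p susp_repr_in_cylinder_iff[OF s] by (simp add: susp_flow_def susp_space_eq[OF s])

lemma measurable_roof_sum [measurable]:
  "(\<lambda>x. roof_sum s x n) \<in> borel_measurable (\<Pi>\<^sub>M k\<in>(UNIV :: int set). count_space (UNIV :: 'a::finite set))"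
proof -
  have "(\<lambda>x. s $ x k) \<in> borel_measurable (\<Pi>\<^sub>M k\<in>(UNIV :: int set). count_space (UNIV :: 'a set))" for k
    by (rule measurable_compose[OF measurable_component_singleton[of k]]) simp_all
  then show ?thesis
    unfolding roof_sum_def by (intro borel_measurable_diff borel_measurable_sum)
qed

text \<open>Joint measurability in time and point, as Fubini needs it. The existential in
  \<open>on_letter\<close> runs over the integers, a countable set.\<close>

lemma measurable_on_letter:
  fixes s :: "real ^ 'a"
  assumes "sets M = sets (susp_borel \<zeta> s)"
  shows "(\<lambda>(t, p). of_bool (on_letter s a (fst p) (snd p + t)) :: complex) \<in> borel_measurable (borel \<Otimes>\<^sub>M M)"
proof -
  let ?P = "(\<Pi>\<^sub>M k\<in>(UNIV :: int set). count_space (UNIV :: 'a set)) \<Otimes>\<^sub>M (borel :: real measure)"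
  have id: "(\<lambda>p. p) \<in> M \<rightarrow>\<^sub>M ?P"
    unfolding measurable_cong_sets[OF assms refl] susp_borel_def
    by (rule measurable_restrict_space1[OF measurable_ident_sets[OF refl]])
  have [measurable]: "(\<lambda>x. x n) \<in> (\<Pi>\<^sub>M k\<in>(UNIV :: int set). count_space (UNIV :: 'a set)) \<rightarrow>\<^sub>M count_space UNIV" for n
    by (rule measurable_component_singleton) simp
  have [measurable]: "Measurable.pred (borel \<Otimes>\<^sub>M ?P) (\<lambda>z :: real \<times> (int \<Rightarrow> 'a) \<times> real.
      on_letter s a (fst (snd z)) (snd (snd z) + fst z))"
    unfolding on_letter_def by measurable
  have "(\<lambda>z :: real \<times> (int \<Rightarrow> 'a) \<times> real. of_bool (on_letter s a (fst (snd z)) (snd (snd z) + fst z)) :: complex)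
      \<in> borel_measurable (borel \<Otimes>\<^sub>M ?P)"
    by measurable
  moreover have "(\<lambda>z :: real \<times> (int \<Rightarrow> 'a) \<times> real. (fst z, snd z)) \<in> borel \<Otimes>\<^sub>M M \<rightarrow>\<^sub>M borel \<Otimes>\<^sub>M ?P"
    by (intro measurable_Pair measurable_fst measurable_compose[OF measurable_snd id])
  ultimately show ?thesis
    using measurable_compose[of "\<lambda>z. (fst z, snd z)" "borel \<Otimes>\<^sub>M M" "borel \<Otimes>\<^sub>M ?P"] by (simp add: case_prod_beta)
qed

lemma on_letter_interior:
  fixes s :: "real ^ 'a"
  assumes s: "\<And>a. 0 < s $ a" and v: "roof_sum s x n < v" "v < roof_sum s x (n + 1)"
  shows "on_letter s a x v \<longleftrightarrow> x n = a"
proof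
  assume "on_letter s a x v"
  then obtain m where m: "roof_sum s x m \<le> v" "v \<le> roof_sum s x (m + 1)" "x m = a"
    by (auto simp: on_letter_def)
  have "\<not> m + 1 \<le> n" "\<not> n + 1 \<le> m"
    using roof_sum_mono[OF less_imp_le[OF s], of "m + 1" n x] roof_sum_mono[OF less_imp_le[OF s], of "n + 1" m x] m v
    by linarith+
  then have "m = n" by linarith
  then show "x n = a" using m by simp
next
  assume "x n = a"
  then show "on_letter s a x v" unfolding on_letter_def using v by (intro exI[of _ n]) simp
qed

section \<open>Twisted orbit integrals\<close>

definition letter_wave :: "real ^ 'a \<Rightarrow> 'a \<Rightarrow> real \<Rightarrow> (int \<Rightarrow> 'a) \<Rightarrow> real \<Rightarrow> complex" where
  "letter_wave s a \<omega> x v = cis (- 2 * pi * \<omega> * v) * of_bool (on_letter s a x v)"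

text \<open>The antiderivative of the wave without additive constant, so that translation is
  multiplication by a phase (\<open>wave_primitive_add\<close>).\<close>

definition wave_primitive :: "real \<Rightarrow> real \<Rightarrow> complex" where
  "wave_primitive \<omega> v = cis (- 2 * pi * \<omega> * v) / (- 2 * pi * \<omega> * \<i>)"

lemma wave_primitive_add:
  "wave_primitive \<omega> (u + v) = cis (- 2 * pi * \<omega> * u) * wave_primitive \<omega> v"
  by (simp only: wave_primitive_def times_divide_eq_right cis_mult distrib_left)

lemma has_integral_wave:
  assumes "\<omega> \<noteq> 0" "u \<le> v"
  shows "((\<lambda>t. cis (- 2 * pi * \<omega> * t)) has_integral (wave_primitive \<omega> v - wave_primitive \<omega> u)) {u..v}"
proof (rule fundamental_theorem_of_calculus[OF assms(2)])
  fix t assume "t \<in> {u..v}"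
  have "((\<lambda>t. exp (of_real t * (- 2 * pi * \<omega> * \<i>))) has_vector_derivative
      (- 2 * pi * \<omega> * \<i>) * exp (of_real t * (- 2 * pi * \<omega> * \<i>))) (at t within {u..v})"
    by (rule has_vector_derivative_real_field) (auto intro!: derivative_eq_intros)
  then have "((\<lambda>t. cis (- 2 * pi * \<omega> * t)) has_vector_derivative
      (- 2 * pi * \<omega> * \<i>) * cis (- 2 * pi * \<omega> * t)) (at t within {u..v})"
    by (simp add: cis_conv_exp mult_ac)
  from has_vector_derivative_divide[OF this, of "- 2 * pi * \<omega> * \<i>"]
  show "(wave_primitive \<omega> has_vector_derivative cis (- 2 * pi * \<omega> * t)) (at t within {u..v})"
    using assms(1) by (simp add: wave_primitive_def[abs_def])
qed

text \<open>The indicator is constant inside the interval. At the endpoints the closed intervals of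
  neighbouring letters overlap, which the integral does not see.\<close>

lemma has_integral_letter_wave_step:
  fixes s :: "real ^ 'a"
  assumes s: "\<And>a. 0 < s $ a" and \<omega>: "\<omega> \<noteq> 0"
  shows "(letter_wave s a \<omega> x has_integral (if x n = a then cis (- 2 * pi * \<omega> * roof_sum s x n)
      * (wave_primitive \<omega> (s $ a) - wave_primitive \<omega> 0) else 0)) {roof_sum s x n..roof_sum s x (n + 1)}"
proof -
  let ?u = "roof_sum s x n" and ?v = "roof_sum s x (n + 1)"
  have uv: "?u \<le> ?v" using roof_sum_Suc[of s x n] s[of "x n"] by simp
  let ?f = "\<lambda>t. if x n = a then cis (- 2 * pi * \<omega> * t) else 0"
  have "(?f has_integral (if x n = a then wave_primitive \<omega> ?v - wave_primitive \<omega> ?u else 0)) {?u..?v}"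
    using has_integral_wave[OF \<omega> uv] by simp
  then have "(letter_wave s a \<omega> x has_integral (if x n = a then wave_primitive \<omega> ?v - wave_primitive \<omega> ?u else 0)) {?u..?v}"
  proof (rule has_integral_spike_interior[of _ _ ?u ?v, unfolded cbox_interval])
    fix t assume "t \<in> box ?u ?v"
    then show "letter_wave s a \<omega> x t = ?f t"
      using on_letter_interior[OF s, of x n t a] by (simp add: letter_wave_def box_real)
  qed
  moreover have "wave_primitive \<omega> ?v - wave_primitive \<omega> ?u
      = cis (- 2 * pi * \<omega> * ?u) * (wave_primitive \<omega> (s $ a) - wave_primitive \<omega> 0)" if "x n = a"
    using wave_primitive_add[of \<omega> ?u "s $ a"] wave_primitive_add[of \<omega> ?u 0] roof_sum_Suc[of s x n] that
    by (simp add: right_diff_distrib)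
  ultimately show ?thesis by (cases "x n = a") simp_all
qed

lemma upto_int_Suc: "[0..int (Suc N) - 1] = [0..int N - 1] @ [int N]"
  by (subst upto_rec2) auto

lemma flow_length_upto: "flow_length s (map x [0..int N - 1]) = roof_sum s x (int N)"
proof (induction N)
  case (Suc N)
  then show ?case unfolding upto_int_Suc using roof_sum_Suc[of s x "int N"] by (simp add: add.commute)
qed simp

text \<open>Every visit to the letter a contributes the same integral up to the phase of its
  starting height, so over whole letters the orbit integral is the twisted sum times a constant
  independent of the word.\<close>

lemma has_integral_letter_wave:
  fixes s :: "real ^ 'a"
  assumes s: "\<And>a. 0 < s $ a" and \<omega>: "\<omega> \<noteq> 0"
  shows "(letter_wave s a \<omega> x has_integral
    (wave_primitive \<omega> (s $ a) - wave_primitive \<omega> 0) * exp_sum s a \<omega> (map x [0..int N - 1])) {0..roof_sum s x (int N)}"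
proof (induction N)
  case 0
  then show ?case using has_integral_refl(2)[of "letter_wave s a \<omega> x" "0 :: real"] by (simp add: cbox_interval)
next
  case (Suc N)
  let ?q = "wave_primitive \<omega> (s $ a) - wave_primitive \<omega> 0" and ?w = "map x [0..int N - 1]"
  have le: "0 \<le> roof_sum s x (int N)" "roof_sum s x (int N) \<le> roof_sum s x (int N + 1)"
    using roof_sum_mono[OF less_imp_le[OF s], of 0 "int N" x] roof_sum_mono[OF less_imp_le[OF s], of "int N" "int N + 1" x]
    by simp_all
  from has_integral_combine[OF le Suc has_integral_letter_wave_step[OF s \<omega>]]
  have "(letter_wave s a \<omega> x has_integral ?q * exp_sum s a \<omega> ?w + (if x (int N) = a
      then cis (- 2 * pi * \<omega> * roof_sum s x (int N)) * ?q else 0)) {0..roof_sum s x (int N + 1)}" .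
  moreover have "exp_sum s a \<omega> (map x [0..int (Suc N) - 1])
      = exp_sum s a \<omega> ?w + cis (- 2 * pi * \<omega> * roof_sum s x (int N)) * (if x (int N) = a then 1 else 0)"
    unfolding upto_int_Suc map_append exp_sum_append flow_length_upto by simp
  ultimately show ?case by (simp add: distrib_left add.commute[of 1] mult.commute split: if_splits)
qed

lemma letter_wave_measurable: "letter_wave s a \<omega> x \<in> borel_measurable borel"
proof -
  have "Measurable.pred borel (\<lambda>v :: real. on_letter s a x v)"
    unfolding on_letter_def by measurable
  then have "(\<lambda>v. of_bool (on_letter s a x v) :: complex) \<in> borel_measurable borel" by measurable
  moreover have "(\<lambda>v. cis (- 2 * pi * \<omega> * v)) \<in> borel_measurable borel"
    unfolding cis_conv_exp by measurable
  ultimately show ?thesis unfolding letter_wave_def[abs_def] by (rule borel_measurable_times[rotated])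
qed

lemma norm_letter_wave_le: "norm (letter_wave s a \<omega> x v) \<le> 1"
  by (simp add: letter_wave_def norm_mult)

lemma letter_wave_set_integrable: "set_integrable lborel {u..v} (letter_wave s a \<omega> x)"
proof -
  have "set_integrable lborel {u..v} (\<lambda>_. 1 :: complex)"
    unfolding set_integrable_def by (cases "u \<le> v") (simp_all add: emeasure_lborel_Icc_eq)
  then show ?thesis
    by (rule set_integrable_bound) (auto simp: set_borel_measurable_def norm_letter_wave_le
        intro!: borel_measurable_scaleR letter_wave_measurable)
qed

lemma letter_wave_integrable_on: "letter_wave s a \<omega> x integrable_on {u..v}"
  by (rule set_borel_integral_eq_integral(1)[OF letter_wave_set_integrable])

lemma norm_integral_letter_wave_le:
  assumes "u \<le> v" shows "norm (integral {u..v} (letter_wave s a \<omega> x)) \<le> v - u"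
proof -
  have "norm (integral {u..v} (letter_wave s a \<omega> x)) \<le> integral {u..v} (\<lambda>_. 1)"
    by (rule integral_norm_bound_integral) (auto intro: letter_wave_integrable_on norm_letter_wave_le)
  then show ?thesis using assms by simp
qed

lemma norm_wave_primitive: "norm (wave_primitive \<omega> v) = 1 / (2 * pi * \<bar>\<omega>\<bar>)"
  by (simp add: wave_primitive_def norm_divide norm_mult)

text \<open>The path from height u to u + R is compared with the first N whole letters of x. The
  piece below u and the piece after the last whole letter have length at most 1 each, which gives
  the 2; the total height u + R \<le> 1 + R limits N.\<close>

proposition path_integral_bound:
  fixes s :: "real ^ 'a"
  assumes s: "\<And>a. 0 < s $ a" "\<And>a. s $ a \<le> 1" and \<omega>: "\<omega> \<noteq> 0" and u: "0 \<le> u" "u < s $ x 0"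
    and R: "0 \<le> R" and c: "c > 0" "\<And>a. c \<le> s $ a"
    and bound: "\<And>N :: nat. N \<le> (1 + R) / c \<Longrightarrow> norm (exp_sum s a \<omega> (map x [0..int N - 1])) \<le> E"
  shows "norm (LINT t|restrict_space lborel {0..R}. cis (- 2 * pi * \<omega> * t) * of_bool (on_letter s a x (u + t)))
    \<le> E / \<bar>\<omega>\<bar> + 2"
proof -
  let ?f = "letter_wave s a \<omega> x"
  obtain n where n: "roof_sum s x n \<le> u + R" "u + R < roof_sum s x (n + 1)"
    using roof_sum_index_exists[OF s(1)] by blast
  have "\<not> n + 1 \<le> 0"
    using roof_sum_mono[OF less_imp_le[OF s(1)], of "n + 1" 0 x] n u R by auto
  then obtain N where N: "n = int N" using zero_le_imp_eq_int[of n] by auto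
  let ?r = "roof_sum s x (int N)"
  have r: "0 \<le> ?r" "?r \<le> u + R" "u + R \<le> ?r + 1"
    using roof_sum_mono[OF less_imp_le[OF s(1)], of 0 "int N" x] n s(2)[of "x n"] roof_sum_Suc[of s x n] unfolding N by auto
  have "c * real N \<le> 1 + R"
    using roof_sum_ge[of c s N x 0] c(2) r(2) u(2) s(2)[of "x 0"] by simp
  then have "real N \<le> (1 + R) / c" using c(1) by (simp add: field_simps)
  then have E: "norm (exp_sum s a \<omega> (map x [0..int N - 1])) \<le> E" by (rule bound)
  have "norm (wave_primitive \<omega> (s $ a) - wave_primitive \<omega> 0) \<le> 1 / (2 * pi * \<bar>\<omega>\<bar>) + 1 / (2 * pi * \<bar>\<omega>\<bar>)"
    by (rule order.trans[OF norm_triangle_ineq4]) (simp add: norm_wave_primitive)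
  also have "\<dots> \<le> 1 / \<bar>\<omega>\<bar>" using \<omega> pi_ge_two by (simp add: field_simps)
  finally have q: "norm (wave_primitive \<omega> (s $ a) - wave_primitive \<omega> 0) \<le> 1 / \<bar>\<omega>\<bar>" .
  have "norm (integral {0..?r} ?f) = norm (wave_primitive \<omega> (s $ a) - wave_primitive \<omega> 0) * norm (exp_sum s a \<omega> (map x [0..int N - 1]))"
    using integral_unique[OF has_integral_letter_wave[OF s(1) \<omega>, of a x N]] by (simp add: norm_mult)
  also have "\<dots> \<le> 1 / \<bar>\<omega>\<bar> * E" using q E by (intro mult_mono) auto
  finally have main: "norm (integral {0..?r} ?f) \<le> E / \<bar>\<omega>\<bar>" by simp
  have "integral {0..u} ?f + integral {u..u + R} ?f = integral {0..u + R} ?f"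
    using u R by (intro Henstock_Kurzweil_Integration.integral_combine letter_wave_integrable_on) auto
  also have "\<dots> = integral {0..?r} ?f + integral {?r..u + R} ?f"
    using r by (intro Henstock_Kurzweil_Integration.integral_combine[symmetric] letter_wave_integrable_on) auto
  finally have split: "integral {u..u + R} ?f = integral {0..?r} ?f + integral {?r..u + R} ?f - integral {0..u} ?f"
    by (simp add: algebra_simps)
  have "norm (integral {u..u + R} ?f) \<le> norm (integral {0..?r} ?f) + norm (integral {?r..u + R} ?f) + norm (integral {0..u} ?f)"
    unfolding split using norm_triangle_ineq4[of "integral {0..?r} ?f + integral {?r..u + R} ?f" "integral {0..u} ?f"]
      norm_triangle_ineq[of "integral {0..?r} ?f" "integral {?r..u + R} ?f"] by linarith
  moreover have "norm (integral {?r..u + R} ?f) \<le> 1" using norm_integral_letter_wave_le[OF r(2), of s a \<omega> x] r(3) by linarith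
  moreover have "norm (integral {0..u} ?f) \<le> 1"
    using norm_integral_letter_wave_le[OF u(1), of s a \<omega> x] u(2) s(2)[of "x 0"] by linarith
  ultimately have total: "norm (integral {u..u + R} ?f) \<le> E / \<bar>\<omega>\<bar> + 2" using main by linarith
  have "(LINT t|restrict_space lborel {0..R}. cis (- 2 * pi * \<omega> * t) * of_bool (on_letter s a x (u + t)))
      = (LINT t|lborel. indicator {0..R} t *\<^sub>R (cis (- 2 * pi * \<omega> * t) * of_bool (on_letter s a x (u + t))))"
    by (subst integral_restrict_space) auto
  \<comment> \<open>Translating time by u turns the integrand into \<open>letter_wave\<close>, at
    the price of a constant phase.\<close>
  also have "\<dots> = (LINT t|lborel. cis (2 * pi * \<omega> * u) * (indicator {u..u + R} (u + 1 * t) *\<^sub>R ?f (u + 1 * t)))"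
  proof (intro Bochner_Integration.integral_cong refl)
    fix t
    have "cis (2 * pi * \<omega> * u) * cis (- 2 * pi * \<omega> * (u + t)) = cis (- 2 * pi * \<omega> * t)"
      by (simp add: cis_mult algebra_simps)
    then show "indicator {0..R} t *\<^sub>R (cis (- 2 * pi * \<omega> * t) * of_bool (on_letter s a x (u + t)))
        = cis (2 * pi * \<omega> * u) * (indicator {u..u + R} (u + 1 * t) *\<^sub>R ?f (u + 1 * t))"
      by (auto simp: letter_wave_def indicator_def mult.assoc[symmetric])
  qed
  also have "\<dots> = cis (2 * pi * \<omega> * u) * (LINT t|lborel. indicator {u..u + R} (u + 1 * t) *\<^sub>R ?f (u + 1 * t))"
    by (rule integral_mult_right_zero)
  also have "(LINT t|lborel. indicator {u..u + R} (u + 1 * t) *\<^sub>R ?f (u + 1 * t)) = (LINT t:{u..u + R}|lborel. ?f t)"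
    using lborel_integral_real_affine[of 1 "\<lambda>t. indicator {u..u + R} t *\<^sub>R ?f t" u]
    by (simp add: set_lebesgue_integral_def)
  also have "\<dots> = integral {u..u + R} ?f"
    by (rule set_borel_integral_eq_integral(2)[OF letter_wave_set_integrable])
  finally show ?thesis using total by (simp add: norm_mult)
qed

section \<open>The main theorem\<close>

lemma space_susp_borel: "space (susp_borel \<zeta> s) = susp_space \<zeta> s"
  by (simp add: susp_borel_def space_restrict_space space_pair_measure space_PiM PiE_UNIV_domain)

text \<open>Invariance moves the pair of times (t, t') to (t - t', 0), where the correlation is the
  one that defines the spectral measure.\<close>

lemma suspension_correlation:
  fixes s :: "real ^ 'a"
  assumes s: "\<And>a. 0 < s $ a" and inv: "invariant_prob \<zeta> s M"
    and spec: "spectral_measure M (susp_flow s) (indicator (susp_cylinder \<zeta> s a)) \<sigma>"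
  defines "g \<equiv> \<lambda>t p. of_bool (on_letter s a (fst p) (snd p + t)) :: complex"
  shows "(LINT p|M. g t p * cnj (g t' p)) = (LINT \<xi>|\<sigma>. cis (2 * pi * \<xi> * (t - t')))"
proof -
  have M: "prob_space M" "sets M = sets (susp_borel \<zeta> s)"
    and invar: "\<And>t A. A \<in> sets M \<Longrightarrow> emeasure M (susp_flow s t -` A \<inter> space M) = emeasure M A"
    using inv by (auto simp: invariant_prob_def)
  interpret prob_space M by (rule M)
  have sp: "space M = susp_space \<zeta> s" using sets_eq_imp_space_eq[OF M(2)] by (simp add: space_susp_borel)
  let ?cyl = "susp_cylinder \<zeta> s a"
  define A where "A = (\<lambda>t. {p \<in> space M. susp_flow s t p \<in> ?cyl})"
  have gA: "g t p = indicator (A t) p" if "p \<in> space M" for t p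
    using that susp_flow_in_cylinder_iff[OF s, of "fst p" "snd p" \<zeta> t a]
    unfolding g_def A_def sp by (simp add: indicator_def)
  have Am: "A t \<in> sets M" for t
  proof -
    have "(\<lambda>p. g t p) \<in> borel_measurable M"
      using measurable_compose[OF measurable_Pair1'[of t borel M] measurable_on_letter[OF M(2), where a = a]]
      by (simp add: g_def)
    then have "{p \<in> space M. g t p = 1} \<in> sets M" by measurable
    moreover have "{p \<in> space M. g t p = 1} = A t"
      using gA by (auto simp: A_def indicator_def split: if_splits)
    ultimately show ?thesis by simp
  qed
  have int: "(LINT p|M. g t p * cnj (g t' p)) = measure M (A t \<inter> A t')" for t t'
  proof -
    have "(LINT p|M. g t p * cnj (g t' p)) = (LINT p|M. complex_of_real (indicator (A t \<inter> A t') p))"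
      using gA by (intro Bochner_Integration.integral_cong) (auto simp: indicator_def)
    also have "\<dots> = complex_of_real (LINT p|M. indicator (A t \<inter> A t') p)" by (rule integral_complex_of_real)
    also have "(LINT p|M. indicator (A t \<inter> A t') p) = measure M (A t \<inter> A t')" using Am by simp
    finally show ?thesis .
  qed
  have pre: "A t \<inter> A t' = susp_flow s t' -` (A (t - t') \<inter> A 0) \<inter> space M"
    using susp_flow_in_space[OF s] by (auto simp: A_def sp susp_flow_add[OF s])
  have "measure M (A t \<inter> A t') = measure M (A (t - t') \<inter> A 0)"
    unfolding measure_def pre using invar[of "A (t - t') \<inter> A 0" t'] Am by simp
  also have "complex_of_real \<dots> = (LINT p|M. g (t - t') p * cnj (g 0 p))" by (simp only: int)
  also have "\<dots> = (LINT p|M. indicator ?cyl (susp_flow s (t - t') p) * cnj (indicator ?cyl p))"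
  proof (rule Bochner_Integration.integral_cong[OF refl])
    fix p assume p: "p \<in> space M"
    have "susp_flow s 0 p = p"
      using p susp_repr_self[OF s, of "snd p" "fst p"] by (auto simp: sp susp_space_eq[OF s] susp_flow_def)
    then show "g (t - t') p * cnj (g 0 p) = indicator ?cyl (susp_flow s (t - t') p) * cnj (indicator ?cyl p)"
      using p unfolding gA[OF p] by (simp add: A_def indicator_def)
  qed
  also have "\<dots> = (LINT \<xi>|\<sigma>. cis (2 * pi * \<xi> * (t - t')))"
    using spec by (simp add: spectral_measure_def)
  finally show ?thesis by (simp only: int)
qed

text \<open>Every window of a sequence in \<open>subst_space\<close> is a factor of some iterate, so
  a bound on factors controls the orbit integral from every point.\<close>

lemma suspension_spectral_bound:
  fixes s :: "real ^ 'a" and \<gamma> B C R E :: real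
  assumes s: "\<And>a. 0 < s $ a" "\<And>a. s $ a \<le> 1" and inv: "invariant_prob \<zeta> s M"
    and spec: "spectral_measure M (susp_flow s) (indicator (susp_cylinder \<zeta> s a)) \<sigma>"
    and \<omega>: "\<omega> \<noteq> 0" and R: "R > 0" and c: "c > 0" "\<And>a. c \<le> s $ a"
    and bound: "\<And>k d u. sublist u (subst_iter \<zeta> k [d]) \<Longrightarrow> length u \<le> (1 + R) / c \<Longrightarrow> norm (exp_sum s a \<omega> u) \<le> E"
  shows "measure \<sigma> {\<omega> - 1 / (6 * R)..\<omega> + 1 / (6 * R)} \<le> 4 * (E / \<bar>\<omega>\<bar> + 2)\<^sup>2 / R\<^sup>2"
proof -
  have M: "prob_space M" "sets M = sets (susp_borel \<zeta> s)" using inv by (auto simp: invariant_prob_def)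
  have \<sigma>: "finite_measure \<sigma>" "sets \<sigma> = sets borel" using spec by (auto simp: spectral_measure_def)
  have sp: "space M = susp_space \<zeta> s" using sets_eq_imp_space_eq[OF M(2)] by (simp add: space_susp_borel)
  show ?thesis
  proof (rule spectral_concentration[OF M(1) \<sigma> R measurable_on_letter[OF M(2), where a = a]])
    show "norm (of_bool (on_letter s a (fst p) (snd p + t)) :: complex) \<le> 1" for t and p :: "(int \<Rightarrow> 'a) \<times> real" by simp
    show "(LINT p|M. of_bool (on_letter s a (fst p) (snd p + t)) * cnj (of_bool (on_letter s a (fst p) (snd p + t'))))
      = (LINT \<xi>|\<sigma>. cis (2 * pi * \<xi> * (t - t')))" for t t'
      by (rule suspension_correlation[OF s(1) inv spec])
    fix p assume "p \<in> space M"
    then have p: "fst p \<in> subst_space \<zeta>" "0 \<le> snd p" "snd p < s $ (fst p) 0" by (auto simp: sp susp_space_eq[OF s(1)])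
    show "norm (LINT t|restrict_space lborel {0..R}. cis (- 2 * pi * \<omega> * t) * of_bool (on_letter s a (fst p) (snd p + t)))
      \<le> E / \<bar>\<omega>\<bar> + 2"
    proof (rule path_integral_bound[OF s \<omega>, where c = c and x = "fst p" and u = "snd p"])
      show "0 \<le> snd p" "snd p < s $ (fst p) 0" by (rule p)+
      show "0 \<le> R" "0 < c" "c \<le> s $ a" for a using R c by simp_all
      fix N :: nat assume N: "N \<le> (1 + R) / c"
      obtain d k where "sublist (map (fst p) [0..int N - 1]) ((subst_word \<zeta> ^^ k) [d])"
        using p(1) unfolding subst_space_def by blast
      then have "sublist (map (fst p) [0..int N - 1]) (subst_iter \<zeta> k [d])" by (simp only: subst_iter_def)
      then show "norm (exp_sum s a \<omega> (map (fst p) [0..int N - 1])) \<le> E"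
        by (rule bound) (use N in simp)
    qed
  qed
qed

section \<open>The real characteristic polynomial and the population vectors\<close>

lemma subst_matrix_of_rat:
  "(subst_matrix \<zeta> :: 'b::field_char_0 ^ 'a ^ 'a) = map_matrix of_rat (subst_matrix \<zeta>)"
  by (simp add: subst_matrix_def vec_eq_iff)

definition real_charpoly :: "('a::finite \<Rightarrow> 'a list) \<Rightarrow> real poly" where
  "real_charpoly \<zeta> = map_poly of_rat (charpoly (subst_matrix \<zeta> :: rat ^ 'a ^ 'a))"

lemma coeff_real_charpoly: "coeff (real_charpoly \<zeta>) i = of_rat (coeff (charpoly (subst_matrix \<zeta>)) i)"
  by (simp add: real_charpoly_def coeff_map_poly)

lemma degree_real_charpoly:
  "degree (real_charpoly (\<zeta> :: 'a::finite \<Rightarrow> 'a list)) = CARD('a)" "lead_coeff (real_charpoly \<zeta>) = 1"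
proof -
  show 1: "degree (real_charpoly \<zeta>) = CARD('a)"
    by (simp add: real_charpoly_def degree_map_poly charpoly_monic)
  show "lead_coeff (real_charpoly \<zeta>) = 1"
    unfolding 1 coeff_real_charpoly by (simp add: charpoly_monic)
qed

lemma char_roots_real_charpoly:
  "char_roots (real_charpoly \<zeta>) = {z. poly (map_poly of_rat (charpoly (subst_matrix \<zeta>))) z = 0}"
  "char_roots (real_charpoly \<zeta>) = eigenvalues (subst_matrix \<zeta> :: complex ^ 'a ^ 'a)"
proof -
  have "complex_of_real (of_rat x) = of_rat x" for x
    by (cases x) (simp add: of_rat_rat)
  then have "cpoly (real_charpoly \<zeta>) = map_poly of_rat (charpoly (subst_matrix \<zeta>))"
    by (simp add: poly_eq_iff coeff_real_charpoly coeff_map_poly)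
  then show 1: "char_roots (real_charpoly \<zeta>) = {z. poly (map_poly of_rat (charpoly (subst_matrix \<zeta>))) z = 0}"
    by (simp add: char_roots_def)
  show "char_roots (real_charpoly \<zeta>) = eigenvalues (subst_matrix \<zeta> :: complex ^ 'a ^ 'a)"
    unfolding 1 eigenvalues_charpoly subst_matrix_of_rat[where 'b = complex] charpoly_of_rat ..
qed

definition count_vector :: "('a::finite \<Rightarrow> 'a list) \<Rightarrow> 'a list \<Rightarrow> nat \<Rightarrow> real ^ 'a" where
  "count_vector \<zeta> w k = (\<chi> a. of_nat (count_list (subst_iter \<zeta> k w) a))"

text \<open>Population vectors are iterates of the substitution matrix, so
  \<open>Cayley_Hamilton\<close>, applied over the rationals, is the recurrence.\<close>

lemma lin_rec_count_vector: "lin_rec (real_charpoly \<zeta>) (\<lambda>k. count_vector \<zeta> w k $ a)"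
  unfolding lin_rec_def
proof
  fix k
  let ?S = "subst_matrix \<zeta> :: rat ^ 'a ^ 'a"
  let ?p = "charpoly ?S"
  have "poly_act ?S ?p (\<chi> a. of_nat (count_list (subst_iter \<zeta> k w) a)) $ a = 0"
    by (simp add: Cayley_Hamilton)
  then have "(\<Sum>i\<le>CARD('a). coeff ?p i * of_nat (count_list (subst_iter \<zeta> (i + k) w) a)) = 0"
    by (simp add: poly_act_def subst_matrix_vector_power charpoly_monic subst_iter_add)
  then have "of_rat (\<Sum>i\<le>CARD('a). coeff ?p i * of_nat (count_list (subst_iter \<zeta> (i + k) w) a)) = (0 :: real)"
    by simp
  then show "(\<Sum>i\<le>degree (real_charpoly \<zeta>). coeff (real_charpoly \<zeta>) i * count_vector \<zeta> w (k + i) $ a) = 0"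
    by (simp add: degree_real_charpoly coeff_real_charpoly count_vector_def of_rat_sum of_rat_mult add.commute)
qed

text \<open>Irreducibility is over the rationals, so cyclicity is used there: unit vectors are
  rational combinations of the first population vectors. These identities are carried to the reals
  and paired with y.\<close>

lemma count_vector_spans:
  fixes \<zeta> :: "'a::finite \<Rightarrow> 'a list"
  assumes irr: "irreducible (charpoly (subst_matrix \<zeta> :: rat ^ 'a ^ 'a))" and w: "w \<noteq> []"
  obtains b :: "'a \<Rightarrow> nat \<Rightarrow> real" where "\<And>y a. y $ a = (\<Sum>i<CARD('a). b a i * (y \<bullet> count_vector \<zeta> w i))"
proof -
  let ?S = "subst_matrix \<zeta> :: rat ^ 'a ^ 'a" and ?v = "(\<chi> a. of_nat (count_list w a)) :: rat ^ 'a"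
  have "?v $ hd w \<noteq> 0" using w by (cases w) auto
  then have v: "?v \<noteq> 0" by (metis zero_index)
  have "\<exists>b :: nat \<Rightarrow> real. \<forall>y. y $ a = (\<Sum>i<CARD('a). b i * (y \<bullet> count_vector \<zeta> w i))" for a
  proof -
    obtain b where b: "axis a 1 = (\<Sum>i<CARD('a). b i *s (((*v) ?S) ^^ i) ?v)"
      using cyclic_vector_spans[OF irr v] .
    have "(if c = a then 1 else 0 :: real) = (\<Sum>i<CARD('a). of_rat (b i) * count_vector \<zeta> w i $ c)" for c
    proof -
      have "(if c = a then 1 else 0) = (\<Sum>i<CARD('a). b i * of_nat (count_list (subst_iter \<zeta> i w) c))"
        using arg_cong[OF b, of "\<lambda>x. x $ c"] by (simp add: subst_matrix_vector_power axis_def)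
      then have "of_rat (if c = a then 1 else 0) = (of_rat (\<Sum>i<CARD('a). b i * of_nat (count_list (subst_iter \<zeta> i w) c)) :: real)"
        by (rule arg_cong)
      then show ?thesis by (simp add: count_vector_def of_rat_sum of_rat_mult if_distrib cong: if_cong)
    qed
    note delta = this
    have "y $ a = (\<Sum>i<CARD('a). of_rat (b i) * (y \<bullet> count_vector \<zeta> w i))" for y :: "real ^ 'a"
    proof -
      have "y $ a = (\<Sum>c\<in>UNIV. y $ c * (if c = a then 1 else 0))"
        by (simp add: if_distrib cong: if_cong)
      also have "\<dots> = (\<Sum>c\<in>UNIV. y $ c * (\<Sum>i<CARD('a). of_rat (b i) * count_vector \<zeta> w i $ c))"
        by (simp only: delta)
      also have "\<dots> = (\<Sum>i<CARD('a). of_rat (b i) * (y \<bullet> count_vector \<zeta> w i))"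
        unfolding inner_vec_def sum_distrib_left by (subst sum.swap) (simp add: mult_ac)
      finally show ?thesis .
    qed
    then show ?thesis by (intro exI[of _ "\<lambda>i. of_rat (b i)"] allI)
  qed
  then have "\<forall>a. \<exists>b :: nat \<Rightarrow> real. \<forall>y. y $ a = (\<Sum>i<CARD('a). b i * (y \<bullet> count_vector \<zeta> w i))" by (rule allI)
  from choice[OF this] obtain b :: "'a \<Rightarrow> nat \<Rightarrow> real" where "\<forall>a y. y $ a = (\<Sum>i<CARD('a). b a i * (y \<bullet> count_vector \<zeta> w i))" by blast
  then show thesis by (intro that[of b]) blast
qed

theorem theorem4p2:
  fixes \<zeta> :: "'a::finite \<Rightarrow> 'a list" and q :: nat
  assumes "CARD('a) \<ge> 2"
    and "substitution \<zeta>"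
    and "primitive \<zeta>"
    and "aperiodic \<zeta>"
    and "irreducible (charpoly (subst_matrix \<zeta> :: rat ^ 'a ^ 'a))"
    and "card {z \<in> eigenvalues (subst_matrix \<zeta> :: complex ^ 'a ^ 'a). cmod z \<le> 1} = q"
    and "q < CARD('a) - 1"
  shows "\<forall>\<eta>>0. \<exists>\<gamma>>0. \<exists>E \<subseteq> (open_simplex :: (real ^ 'a) set).
    hausdorff_dim E \<le> ennreal (real q + \<eta>) \<and>
    (\<forall>s \<in> open_simplex - E. \<forall>B>1. \<exists>r\<^sub>0>0. \<exists>C>0.
       \<forall>M. invariant_prob \<zeta> s M \<longrightarrow>
         (\<forall>a \<sigma>. spectral_measure M (susp_flow s) (indicator (susp_cylinder \<zeta> s a)) \<sigma> \<longrightarrow>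
           (\<forall>\<omega> r. 1 / B \<le> \<bar>\<omega>\<bar> \<and> \<bar>\<omega>\<bar> \<le> B \<and> 0 < r \<and> r \<le> r\<^sub>0 \<longrightarrow>
             measure \<sigma> {\<omega> - r..\<omega> + r} \<le> C * r powr \<gamma>)))"
proof (intro allI impI)
  fix \<eta> :: real assume \<eta>: "\<eta> > 0"
  let ?p = "real_charpoly \<zeta>"
  let ?Q = "\<lambda>(s :: real ^ 'a) B r\<^sub>0 C \<gamma>. \<forall>M. invariant_prob \<zeta> s M \<longrightarrow>
         (\<forall>a \<sigma>. spectral_measure M (susp_flow s) (indicator (susp_cylinder \<zeta> s a)) \<sigma> \<longrightarrow>
           (\<forall>\<omega> r. 1 / B \<le> \<bar>\<omega>\<bar> \<and> \<bar>\<omega>\<bar> \<le> B \<and> 0 < r \<and> r \<le> r\<^sub>0 \<longrightarrow>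
             measure \<sigma> {\<omega> - r..\<omega> + r} \<le> C * r powr \<gamma>))"
  note irr = \<open>irreducible _\<close> and sub = \<open>substitution \<zeta>\<close>
  obtain L c v where L: "L \<ge> 1" and all: "\<forall>a b. a \<in> set (subst_iter \<zeta> L [b])"
    and ret: "\<forall>b. \<exists>x y. subst_iter \<zeta> L [b] = x @ [c] @ v @ [c] @ y"
    using primitive_common_return_word[OF \<open>primitive \<zeta>\<close> \<open>CARD('a) \<ge> 2\<close>] .
  define l where "l = count_vector \<zeta> (c # v)"
  obtain b where span: "\<And>y a. y $ a = (\<Sum>i<CARD('a). b a i * (y \<bullet> l i))"
    using count_vector_spans[OF irr, of "c # v"] unfolding l_def by blast
  have card: "card (char_roots ?p) = degree ?p"
    unfolding char_roots_real_charpoly(1) degree_real_charpoly(1)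
    using irreducible_complex_roots[OF irr] by (simp add: charpoly_monic)
  have q: "card (stable_roots ?p) = q"
    unfolding stable_roots_def char_roots_real_charpoly(2) by (rule assms(6))
  have qd: "card (stable_roots ?p) < degree ?p"
    using \<open>q < CARD('a) - 1\<close> by (simp add: q degree_real_charpoly)
  obtain \<rho> \<delta> :: real and E where \<rho>: "\<rho> > 0" and \<delta>: "\<delta> > 0" and E: "E \<subseteq> open_simplex"
    and dim: "hausdorff_dim E \<le> ennreal (card (stable_roots ?p) + \<eta>)"
    and good: "\<forall>s\<in>open_simplex - E. \<forall>B>1. \<exists>N\<^sub>0. \<forall>N\<ge>N\<^sub>0. \<forall>w. 1 / B \<le> \<bar>w\<bar> \<and> \<bar>w\<bar> \<le> B \<longrightarrow>
       \<delta> * N < card (far_indices \<rho> N (\<lambda>k. w * (s \<bullet> l k)))"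
  proof (rule exceptional_set[OF card qd degree_real_charpoly(2) \<eta>, of l b])
    show "lin_rec ?p (\<lambda>k. l k $ a)" for a unfolding l_def by (rule lin_rec_count_vector)
    show "y $ a = (\<Sum>i<degree ?p. b a i * (y \<bullet> l i))" for y a
      unfolding degree_real_charpoly by (rule span)
  qed (rule that)
  have len: "s \<bullet> l k = flow_length s (subst_iter \<zeta> k (c # v))" for s k
    by (simp add: l_def count_vector_def flow_length_inner)
  obtain \<gamma> :: real where \<gamma>: "0 < \<gamma>" "\<gamma> \<le> 1 / 2" and
    decay: "\<forall>s \<Omega> N\<^sub>0. (\<forall>N\<ge>N\<^sub>0. \<forall>\<omega>\<in>\<Omega>. \<delta> * N < card (far_indices \<rho> N (\<lambda>k. \<omega> * flow_length s (subst_iter \<zeta> k (c # v)))))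
     \<longrightarrow> (\<exists>C>0. \<exists>R\<^sub>0\<ge>1. power_saving \<zeta> s \<Omega> \<gamma> C R\<^sub>0)"
    by (rule exp_sum_power_bound[OF sub L all ret \<rho> \<delta>])
  \<comment> \<open>The exponent doubles because the spectral bound squares an orbit integral of
    order R^(1 - \<gamma>) and divides by R^2.\<close>
  have main: "\<exists>r\<^sub>0>0. \<exists>C>0. ?Q s B r\<^sub>0 C (2 * \<gamma>)"
    if s: "s \<in> open_simplex - E" and B: "B > 1" for s B
  proof -
    have pos: "0 < s $ a" "s $ a \<le> 1" for a using s open_simplex_le_1[of s a] by (auto simp: open_simplex_def)
    obtain c\<^sub>0 where c0: "c\<^sub>0 > 0" "\<And>a. c\<^sub>0 \<le> s $ a" using positive_lower_bound[OF pos(1)] by blast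
    define \<Omega> where "\<Omega> = {\<omega>. 1 / B \<le> \<bar>\<omega>\<bar> \<and> \<bar>\<omega>\<bar> \<le> B}"
    obtain N\<^sub>0 where "\<forall>N\<ge>N\<^sub>0. \<forall>w. 1 / B \<le> \<bar>w\<bar> \<and> \<bar>w\<bar> \<le> B \<longrightarrow>
       \<delta> * N < card (far_indices \<rho> N (\<lambda>k. w * (s \<bullet> l k)))"
      using good[rule_format, OF s B] by (rule exE)
    then have far: "\<forall>N\<ge>N\<^sub>0. \<forall>\<omega>\<in>\<Omega>. \<delta> * N < card (far_indices \<rho> N (\<lambda>k. \<omega> * flow_length s (subst_iter \<zeta> k (c # v))))"
      by (simp add: \<Omega>_def len)
    from decay[THEN spec, THEN spec, THEN spec, THEN mp, OF far]
    obtain C R\<^sub>0 :: real where C: "C > 0" and R0: "R\<^sub>0 \<ge> 1" and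
      bd: "power_saving \<zeta> s \<Omega> \<gamma> C R\<^sub>0"
      by (elim exE conjE) (rule that)
    \<comment> \<open>\<open>C\<^sub>1\<close> bounds sums over words of length up to 2 R /
      \<open>c\<^sub>0\<close>, its summand 2 coming from the square-root term.
      \<open>C\<^sub>2\<close> adds the factor B for 1 / |\<omega>| and the 2 for the ends of the
      path. \<open>C\<^sub>3\<close> squares this and turns 1 / R into 6 r.\<close>
    define C\<^sub>1 where "C\<^sub>1 = 2 * C / c\<^sub>0 + 2"
    define C\<^sub>2 where "C\<^sub>2 = C\<^sub>1 * B + 2"
    define C\<^sub>3 where "C\<^sub>3 = 4 * C\<^sub>2\<^sup>2 * 6 powr (2 * \<gamma>)"
    have C1: "C\<^sub>1 > 0" using C c0 by (auto simp: C\<^sub>1_def intro!: add_pos_pos)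
    then have C2: "C\<^sub>2 > 0" using B by (auto simp: C\<^sub>2_def intro!: add_pos_pos)
    have bound: "measure \<sigma> {\<omega> - r..\<omega> + r} \<le> C\<^sub>3 * r powr (2 * \<gamma>)"
      if inv: "invariant_prob \<zeta> s M" and spec: "spectral_measure M (susp_flow s) (indicator (susp_cylinder \<zeta> s a)) \<sigma>"
        and \<omega>: "1 / B \<le> \<bar>\<omega>\<bar>" "\<bar>\<omega>\<bar> \<le> B" and r: "0 < r" "r \<le> 1 / (6 * R\<^sub>0)" for M a \<sigma> \<omega> r
    proof -
      \<comment> \<open>Makes the window of radius 1 / (6 R) the given one; the upper bound on r
        makes R at least \<open>R\<^sub>0\<close>.\<close>
      define R where "R = 1 / (6 * r)"
      have RR0: "R \<ge> R\<^sub>0" using r R0 by (simp add: R_def field_simps)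
      then have R1: "R \<ge> 1" using R0 by linarith
      have w0: "\<bar>\<omega>\<bar> > 0" using \<omega>(1) B by (meson divide_pos_pos less_le_trans less_trans zero_less_one)
      have iw: "1 / \<bar>\<omega>\<bar> \<le> B" using \<omega>(1) B w0 by (simp add: field_simps)
      define P where "P = R powr (1 - \<gamma>)"
      have P1: "P \<ge> 1" unfolding P_def using R1 \<gamma> by (intro ge_one_powr_ge_zero) auto
      have half: "R powr (1 / 2) \<le> P" unfolding P_def using R1 \<gamma> by (intro powr_mono) auto
      have RP: "R * R powr (- \<gamma>) = P" using R1 by (simp add: P_def powr_diff powr_minus_divide)
      have es: "norm (exp_sum s a \<omega> u) \<le> C\<^sub>1 * P"
        if u: "sublist u (subst_iter \<zeta> k [d])" and lu: "length u \<le> (1 + R) / c\<^sub>0" for k d u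
      proof -
        have "(1 + R) / c\<^sub>0 \<le> 2 * R / c\<^sub>0" using R1 c0 by (intro divide_right_mono) auto
        then have "length u \<le> 2 * R / c\<^sub>0" using lu by linarith
        then have "C * real (length u) * R powr (- \<gamma>) \<le> C * (2 * R / c\<^sub>0) * R powr (- \<gamma>)"
          using C by (intro mult_right_mono mult_left_mono) auto
        also have "\<dots> = 2 * C / c\<^sub>0 * (R * R powr (- \<gamma>))" by simp
        finally have "C * real (length u) * R powr (- \<gamma>) \<le> 2 * C / c\<^sub>0 * P" by (simp only: RP)
        moreover have "norm (exp_sum s a \<omega> u) \<le> C * real (length u) * R powr (- \<gamma>) + 2 * R powr (1 / 2)"
          using bd[unfolded power_saving_def, rule_format, OF RR0 _ u, of \<omega> a] \<omega> by (simp add: \<Omega>_def)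
        ultimately have "norm (exp_sum s a \<omega> u) \<le> 2 * C / c\<^sub>0 * P + 2 * P" using half by linarith
        then show ?thesis by (simp add: C\<^sub>1_def distrib_right)
      qed
      have "measure \<sigma> {\<omega> - 1 / (6 * R)..\<omega> + 1 / (6 * R)} \<le> 4 * (C\<^sub>1 * P / \<bar>\<omega>\<bar> + 2)\<^sup>2 / R\<^sup>2"
      proof (rule suspension_spectral_bound[OF pos inv spec, where c = c\<^sub>0])
        show "\<omega> \<noteq> 0" "R > 0" using w0 R1 by auto
        show "norm (exp_sum s a \<omega> u) \<le> C\<^sub>1 * P"
          if "sublist u (subst_iter \<zeta> k [d])" "length u \<le> (1 + R) / c\<^sub>0" for k d u
          using that by (rule es)
      qed (rule c0)+
      moreover have "1 / (6 * R) = r" using r by (simp add: R_def)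
      moreover have "4 * (C\<^sub>1 * P / \<bar>\<omega>\<bar> + 2)\<^sup>2 / R\<^sup>2 \<le> C\<^sub>3 * r powr (2 * \<gamma>)"
      proof -
        have "C\<^sub>1 * P * (1 / \<bar>\<omega>\<bar>) \<le> C\<^sub>1 * P * B" using iw C1 P1 by (intro mult_left_mono) auto
        then have "C\<^sub>1 * P / \<bar>\<omega>\<bar> + 2 \<le> C\<^sub>1 * P * B + 2 * P" using P1 by simp
        also have "\<dots> = C\<^sub>2 * P" by (simp add: C\<^sub>2_def algebra_simps)
        finally have "(C\<^sub>1 * P / \<bar>\<omega>\<bar> + 2)\<^sup>2 \<le> (C\<^sub>2 * P)\<^sup>2" using C1 P1 w0 by (intro power_mono) auto
        then have "4 * (C\<^sub>1 * P / \<bar>\<omega>\<bar> + 2)\<^sup>2 / R\<^sup>2 \<le> 4 * (C\<^sub>2 * P)\<^sup>2 / R\<^sup>2" by (intro divide_right_mono) auto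
        also have "\<dots> = 4 * C\<^sub>2\<^sup>2 * (P / R)\<^sup>2" by (simp add: power_mult_distrib power_divide)
        also have "P / R = R powr (- \<gamma>)" using R1 by (simp add: RP[symmetric])
        also have "(R powr (- \<gamma>))\<^sup>2 = R powr (- (2 * \<gamma>))" by (simp add: power2_eq_square powr_add[symmetric])
        also have "\<dots> = (6 * r) powr (2 * \<gamma>)" using r by (simp add: R_def powr_minus powr_divide inverse_eq_divide)
        also have "\<dots> = 6 powr (2 * \<gamma>) * r powr (2 * \<gamma>)" using r by (simp add: powr_mult)
        finally show ?thesis by (simp only: C\<^sub>3_def mult.assoc)
      qed
      ultimately show ?thesis by (simp only:)
    qed
    have r0: "1 / (6 * R\<^sub>0) > 0" using R0 by simp
    have C3: "C\<^sub>3 > 0" using C2 by (simp add: C\<^sub>3_def)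
    show ?thesis
      by (rule exI[of _ "1 / (6 * R\<^sub>0)"], rule conjI[OF r0], rule exI[of _ "C\<^sub>3"], rule conjI[OF C3],
          intro allI impI, elim conjE) (rule bound)
  qed
  have g2: "2 * \<gamma> > 0" using \<gamma> by simp
  show "\<exists>\<gamma>>0. \<exists>E \<subseteq> (open_simplex :: (real ^ 'a) set). hausdorff_dim E \<le> ennreal (real q + \<eta>) \<and>
    (\<forall>s \<in> open_simplex - E. \<forall>B>1. \<exists>r\<^sub>0>0. \<exists>C>0. ?Q s B r\<^sub>0 C \<gamma>)"
    by (rule exI[of _ "2 * \<gamma>"], rule conjI[OF g2], rule exI[of _ E], rule conjI[OF E],
        rule conjI[OF dim[unfolded q]], intro ballI allI impI) (rule main)
qed

end
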